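(* Let $G$ be a connected subcubic graph which is not isomorphic to $K_{3,3}$ and has $n$ vertices, $m$ edges and $n_1$ vertices of degree $1$. Let $I=1$ if $G$ is cubic and $I=0$ otherwise, and let $K=1$ if $G$ is isomorphic to the complete graph $K_2$ and $K=0$ otherwise. Define $$\mu(G):=\frac{4n- m}{6} + \frac{ 2I + K -n_1}{6}.$$ Then $\gamma(G) \leq \mu(G)$. Moreover, if $G$ is not isomorphic to $K_2$ and has a vertex $v$ of degree $1$ with neighbour $u$, then $G$ has a maximal matching of size at most $\mu(G)$ which does not contain the edge $uv$.
   Context: All graphs are finite, undirected and simple. A graph is subcubic if its maximum degree is at most $3$, and cubic if it is $3$-regular. A matching is a set of pairwise non-adjacent edges; a maximal matching is a matching not contained in any larger matching. For a graph $G$, $\gamma(G)$ denotes the minimum size of a maximal matching of $G$. *)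

theory Defs
  imports Complex_Main
begin

text \<open>A graph is a pair of a vertex set and a set of edges, each edge being a two-element set of
  vertices.\<close>

type_synonym 'a ugraph = "'a set \<times> 'a set set"

abbreviation verts :: "'a ugraph \<Rightarrow> 'a set" where
  "verts \<equiv> fst"

abbreviation edges :: "'a ugraph \<Rightarrow> 'a set set" where
  "edges \<equiv> snd"

definition simple_graph :: "'a ugraph \<Rightarrow> bool" where
  "simple_graph G \<longleftrightarrow> finite (verts G) \<and> (\<forall>e\<in>edges G. e \<subseteq> verts G \<and> card e = 2)"

definition degree :: "'a ugraph \<Rightarrow> 'a \<Rightarrow> nat" where
  "degree G v = card {e \<in> edges G. v \<in> e}"

definition subcubic :: "'a ugraph \<Rightarrow> bool" where
  "subcubic G \<longleftrightarrow> (\<forall>v\<in>verts G. degree G v \<le> 3)"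

definition cubic :: "'a ugraph \<Rightarrow> bool" where
  "cubic G \<longleftrightarrow> (\<forall>v\<in>verts G. degree G v = 3)"

text \<open>As usual, the graph without vertices does not count as connected.\<close>

definition connected_graph :: "'a ugraph \<Rightarrow> bool" where
  "connected_graph G \<longleftrightarrow> verts G \<noteq> {} \<and>
     (\<forall>u\<in>verts G. \<forall>v\<in>verts G. (u, v) \<in> {(x, y). {x, y} \<in> edges G}\<^sup>*)"

definition isomorphic :: "'a ugraph \<Rightarrow> 'b ugraph \<Rightarrow> bool" where
  "isomorphic G H \<longleftrightarrow> (\<exists>f. bij_betw f (verts G) (verts H) \<and>
     (\<forall>u\<in>verts G. \<forall>v\<in>verts G. {u, v} \<in> edges G \<longleftrightarrow> {f u, f v} \<in> edges H))"

definition complete_graph :: "nat \<Rightarrow> nat ugraph" where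
  "complete_graph k = ({..<k}, {{i, j} | i j. i < k \<and> j < k \<and> i \<noteq> j})"

definition complete_bipartite_graph :: "nat \<Rightarrow> nat \<Rightarrow> (nat + nat) ugraph" where
  "complete_bipartite_graph a b = ({..<a} <+> {..<b}, {{Inl i, Inr j} | i j. i < a \<and> j < b})"

definition matching :: "'a ugraph \<Rightarrow> 'a set set \<Rightarrow> bool" where
  "matching G M \<longleftrightarrow> M \<subseteq> edges G \<and> (\<forall>e\<in>M. \<forall>f\<in>M. e \<noteq> f \<longrightarrow> e \<inter> f = {})"

definition maximal_matching :: "'a ugraph \<Rightarrow> 'a set set \<Rightarrow> bool" where
  "maximal_matching G M \<longleftrightarrow> matching G M \<and> \<not> (\<exists>M'. matching G M' \<and> M \<subset> M')"

text \<open>The minimum is taken over a finite nonempty set whenever \<open>G\<close> is a simple graph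
  (lemmas \<open>finite_maximal_matchings\<close> and \<open>maximal_matching_exists\<close>).\<close>

definition gamma :: "'a ugraph \<Rightarrow> nat" where
  "gamma G = Min (card ` {M. maximal_matching G M})"

lemma finite_edges: "simple_graph G \<Longrightarrow> finite (edges G)"
  unfolding simple_graph_def by (rule finite_subset[of _ "Pow (verts G)"]) auto

lemma finite_matchings: "simple_graph G \<Longrightarrow> finite {M. matching G M}"
  by (rule finite_subset[of _ "Pow (edges G)"]) (auto simp: matching_def finite_edges)

lemma finite_maximal_matchings: "simple_graph G \<Longrightarrow> finite {M. maximal_matching G M}"
  by (rule finite_subset[OF _ finite_matchings]) (auto simp: maximal_matching_def)

lemma maximal_matching_exists:
  assumes "simple_graph G"
  shows "\<exists>M. maximal_matching G M"
proof -
  have "{} \<in> {M. matching G M}"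
    by (simp add: matching_def)
  then obtain M where "M \<in> {M. matching G M}" and "\<forall>M'\<in>{M. matching G M}. M \<subseteq> M' \<longrightarrow> M = M'"
    using finite_has_maximal[OF finite_matchings[OF assms]] by auto
  then show ?thesis
    unfolding maximal_matching_def by blast
qed

definition mu :: "'a ugraph \<Rightarrow> real" where
  "mu G =
    (let n = real (card (verts G));
         m = real (card (edges G));
         n1 = real (card {v \<in> verts G. degree G v = 1});
         I = (if cubic G then 1 else 0);
         K = (if isomorphic G (complete_graph 2) then 1 else 0)
     in (4 * n - m) / 6 + (2 * I + K - n1) / 6)"

end

theory Submission imports Defs begin

text \<open>Give every component of at least three vertices the budget \<open>4n - m - n\<^sub>1\<close>, and let every edge of
  the matching cost 6. For graphs without cubic components the budget is additive over components, and
  one argues by induction on the number of vertices. Deleting vertices keeps the class, and most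
  configurations are reduced by deleting the ends of a few matching edges together with vertices all of
  whose neighbours are covered. This settles leaves, and it fails at a vertex \<open>v\<close> of degree two
  with neighbours \<open>x\<close> and \<open>y\<close> of degree three only because one has to cover both \<open>x\<close> and \<open>y\<close>
  after deleting \<open>v\<close>.

  For this there is a gadget: if \<open>x\<close> is adjacent to \<open>p\<close> and \<open>q\<close>, and \<open>p\<close> to \<open>j\<close>, then
  delete \<open>x\<close> and \<open>p\<close> and add the edge \<open>qj\<close>. A maximal matching of the new graph lifts to one that
  covers \<open>x\<close>: use \<open>xq\<close> and \<open>pj\<close> if it contains \<open>qj\<close>, and add \<open>xp\<close> otherwise. The added edge is one
  unit of budget saved, and applying the gadget at \<open>x\<close> and at \<open>y\<close> gives exactly what is needed.
  The gadget is unavailable if \<open>q\<close> is adjacent to all other neighbours of \<open>p\<close>, or if the new edge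
  completes a cubic component. The former leads to a complete bipartite graph with parts of sizes 2 and
  3, which can be removed as a whole; the latter leads to a bridge, where both sides can be treated
  separately and rounding to multiples of 6 wins. A cubic graph is handled by one gadget.\<close>

section \<open>Neighbourhoods, deletion and maximal matchings\<close>

text \<open>Matching two vertices of degree three removes 5 edges, so the budget falls by only 8 - 5
  = 3 where 6 is spent. The deficit has to come from skipped vertices: a vertex all of whose
  neighbours are covered is worth 4 and costs nothing. At a vertex \<open>v\<close> of degree two,
  deleting \<open>v\<close> gains 4 - 2 = 2 units. Covering \<open>x\<close>, which then has two
  neighbours, by an ordinary matching edge costs 6 - 8 + 4 = 2 units, and so does covering
  \<open>y\<close>: two units are missing. The gadget lowers the price to one unit per vertex, which
  balances the account with nothing to spare. This lack of slack is why exceptional neighbourhoods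
  need their own reductions. Cubic components are excluded because they may cost additional units.
  Deleting vertices of a connected subcubic graph never creates one; only the added edge of a gadget
  can, so two positions for that edge are kept in reserve. At a bridge each side is charged in
  multiples of 6, and the residues modulo 6 of the two budgets decide which treatment of the bridge
  is affordable.\<close>

definition nb :: "'a ugraph \<Rightarrow> 'a \<Rightarrow> 'a set" where
  "nb G v = {u. {u, v} \<in> edges G}"

definition del :: "'a ugraph \<Rightarrow> 'a set \<Rightarrow> 'a ugraph" where
  "del G S = (verts G - S, {e \<in> edges G. e \<inter> S = {}})"

definition add :: "'a ugraph \<Rightarrow> 'a \<Rightarrow> 'a \<Rightarrow> 'a ugraph" where
  "add G k j = (verts G, insert {k, j} (edges G))"

definition subcubic_graph :: "'a ugraph \<Rightarrow> bool" where
  "subcubic_graph G \<longleftrightarrow> simple_graph G \<and> (\<forall>v. card (nb G v) \<le> 3)"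

text \<open>No component is cubic; \<open>U\<close> ranges over the unions of components.\<close>

definition no_cubic_part :: "'a ugraph \<Rightarrow> bool" where
  "no_cubic_part G \<longleftrightarrow> (\<forall>U. U \<subseteq> verts G \<longrightarrow> U \<noteq> {} \<longrightarrow> (\<forall>u\<in>U. nb G u \<subseteq> U) \<longrightarrow> (\<exists>u\<in>U. card (nb G u) \<noteq> 3))"

definition beta :: "'a ugraph \<Rightarrow> int" where
  "beta G = 4 * int (card (verts G)) - int (card (edges G))"

definition pendant :: "'a ugraph \<Rightarrow> 'a set set" where
  "pendant G = {e \<in> edges G. \<exists>z\<in>e. card (nb G z) = 1}"

definition isolated :: "'a ugraph \<Rightarrow> 'a set" where
  "isolated G = {v \<in> verts G. nb G v = {}}"

text \<open>For a connected graph on at least three vertices, \<open>budget G\<close> is \<open>6 \<mu>(G)\<close> without the term \<open>2 I\<close>.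
  Since an isolated edge is one pendant edge with two leaves, counting pendant edges instead of leaves
  accounts for the term \<open>K\<close>; isolated vertices get budget 0. In this form the budget is additive
  over components.\<close>

definition budget :: "'a ugraph \<Rightarrow> int" where
  "budget G = beta G - int (card (pendant G)) - 4 * int (card (isolated G))"

lemma simpleD:
  assumes "simple_graph G"
  shows "finite (verts G)" "e \<in> edges G \<Longrightarrow> e \<subseteq> verts G" "e \<in> edges G \<Longrightarrow> card e = 2"
  using assms unfolding simple_graph_def by auto

lemma edgeE:
  assumes "simple_graph G" "e \<in> edges G"
  obtains u w where "e = {u, w}" "u \<noteq> w" "u \<in> verts G" "w \<in> verts G" "u \<in> nb G w" "w \<in> nb G u"
proof -
  from assms have "card e = 2" "e \<subseteq> verts G" by (auto simp: simple_graph_def)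
  then obtain u w where "e = {u, w}" "u \<noteq> w" by (auto simp: card_2_iff)
  with assms \<open>e \<subseteq> verts G\<close> show ?thesis
    by (intro that[of u w]) (auto simp: nb_def insert_commute)
qed

lemma nb_sym: "u \<in> nb G v \<longleftrightarrow> v \<in> nb G u"
  by (simp add: nb_def insert_commute)

lemma nb_edge: "u \<in> nb G v \<longleftrightarrow> {u, v} \<in> edges G" "u \<in> nb G v \<longleftrightarrow> {v, u} \<in> edges G"
  by (simp_all add: nb_def insert_commute)

lemma nb_irrefl: "simple_graph G \<Longrightarrow> v \<notin> nb G v"
  by (auto simp: nb_def simple_graph_def)

lemma nb_verts: "simple_graph G \<Longrightarrow> u \<in> nb G v \<Longrightarrow> u \<in> verts G \<and> v \<in> verts G"
  by (auto simp: nb_def simple_graph_def)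

lemma nb_subset: "simple_graph G \<Longrightarrow> nb G v \<subseteq> verts G"
  using nb_verts by fast

lemma finite_nb: "simple_graph G \<Longrightarrow> finite (nb G v)"
  by (rule finite_subset[OF nb_subset]) (auto simp: simpleD)

lemma degree_nb:
  assumes "simple_graph G"
  shows "degree G v = card (nb G v)"
proof -
  have "{e \<in> edges G. v \<in> e} = (\<lambda>u. {u, v}) ` nb G v"
  proof (intro equalityI subsetI)
    fix e assume "e \<in> {e \<in> edges G. v \<in> e}"
    then have "e \<in> edges G" "v \<in> e" by auto
    from edgeE[OF assms this(1)] obtain u w where "e = {u, w}" "u \<in> nb G w" "w \<in> nb G u" by metis
    with \<open>v \<in> e\<close> show "e \<in> (\<lambda>u. {u, v}) ` nb G v" by auto
  qed (auto simp: nb_def)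
  moreover have "inj_on (\<lambda>u. {u, v}) (nb G v)"
    by (auto simp: inj_on_def doubleton_eq_iff)
  ultimately show ?thesis
    by (simp add: degree_def card_image)
qed

lemma subcubic_graph_simple: "subcubic_graph G \<Longrightarrow> simple_graph G"
  by (simp add: subcubic_graph_def)

lemma subcubic_graph_card: "subcubic_graph G \<Longrightarrow> card (nb G v) \<le> 3"
  by (simp add: subcubic_graph_def)

lemma subcubic_graph_iff: "subcubic_graph G \<longleftrightarrow> simple_graph G \<and> subcubic G"
proof (cases "simple_graph G")
  case True
  have "nb G v = {}" if "v \<notin> verts G" for v
    using nb_verts[OF True] that by blast
  then have "card (nb G v) \<le> 3" if "v \<notin> verts G" for v
    using that by simp
  then show ?thesis
    by (auto simp: subcubic_graph_def subcubic_def degree_nb[OF True])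
qed (simp add: subcubic_graph_def)

lemma verts_del [simp]: "verts (del G S) = verts G - S"
  by (simp add: del_def)

lemma edges_del: "edges (del G S) = {e \<in> edges G. e \<inter> S = {}}"
  by (simp add: del_def)

lemma nb_del: "nb (del G S) v = (if v \<in> S then {} else nb G v - S)"
  by (auto simp: nb_def del_def)

lemma del_del: "del (del G S) T = del G (S \<union> T)"
  by (auto simp: del_def)

lemma del_empty [simp]: "del G {} = G"
  by (auto simp: del_def)

lemma simple_del: "simple_graph G \<Longrightarrow> simple_graph (del G S)"
  by (auto simp: simple_graph_def del_def)

lemma subcubic_graph_del: "subcubic_graph G \<Longrightarrow> subcubic_graph (del G S)"
  unfolding subcubic_graph_def
  by (auto simp: simple_del nb_del intro: order_trans[OF card_mono] finite_nb)

lemma verts_add [simp]: "verts (add G k j) = verts G"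
  by (simp add: add_def)

lemma edges_add: "edges (add G k j) = insert {k, j} (edges G)"
  by (simp add: add_def)

lemma nb_add: "k \<noteq> j \<Longrightarrow>
    nb (add G k j) v = (if v = k then insert j (nb G v) else if v = j then insert k (nb G v) else nb G v)"
  by (auto simp: nb_def add_def doubleton_eq_iff)

lemma simple_add: "simple_graph G \<Longrightarrow> k \<noteq> j \<Longrightarrow> k \<in> verts G \<Longrightarrow> j \<in> verts G \<Longrightarrow> simple_graph (add G k j)"
  by (auto simp: simple_graph_def add_def)

lemma no_cubic_partD:
  assumes "no_cubic_part G" "U \<subseteq> verts G" "U \<noteq> {}" "\<And>u. u \<in> U \<Longrightarrow> nb G u \<subseteq> U"
    "\<And>u. u \<in> U \<Longrightarrow> card (nb G u) = 3"
  shows False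
  using assms unfolding no_cubic_part_def by metis

lemma no_cubic_partI:
  assumes "\<And>U. U \<subseteq> verts G \<Longrightarrow> U \<noteq> {} \<Longrightarrow> (\<And>u. u \<in> U \<Longrightarrow> nb G u \<subseteq> U) \<Longrightarrow>
    (\<And>u. u \<in> U \<Longrightarrow> card (nb G u) = 3) \<Longrightarrow> False"
  shows "no_cubic_part G"
  using assms unfolding no_cubic_part_def by metis

text \<open>Three known neighbours are all of them. This is how a vertex that still has degree three
  after a deletion is seen to have lost nothing.\<close>

lemma nb_full:
  assumes "subcubic_graph G" "A \<subseteq> nb G v" "card A = 3"
  shows "A = nb G v"
  by (rule card_seteq) (use assms in \<open>auto simp: subcubic_graph_simple finite_nb subcubic_graph_card\<close>)

lemma no_cubic_part_del:
  assumes "subcubic_graph G" "no_cubic_part G"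
  shows "no_cubic_part (del G S)"
proof (rule no_cubic_partI)
  fix U
  assume U: "U \<subseteq> verts (del G S)" "U \<noteq> {}" "\<And>u. u \<in> U \<Longrightarrow> nb (del G S) u \<subseteq> U"
    "\<And>u. u \<in> U \<Longrightarrow> card (nb (del G S) u) = 3"
  have eq: "nb (del G S) u = nb G u" if "u \<in> U" for u
    by (rule nb_full[OF assms(1)]) (use U(4)[OF that] in \<open>auto simp: nb_del\<close>)
  show False
    by (rule no_cubic_partD[OF assms(2), of U]) (use U eq in auto)
qed

section \<open>Lifting maximal matchings from smaller graphs\<close>

lemma maximal_matching_iff:
  assumes "simple_graph G"
  shows "maximal_matching G M \<longleftrightarrow> M \<subseteq> edges G \<and> (\<forall>e\<in>M. \<forall>f\<in>M. e \<noteq> f \<longrightarrow> e \<inter> f = {}) \<and>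
    (\<forall>e\<in>edges G. e \<inter> \<Union>M \<noteq> {})"
proof (intro iffI conjI)
  assume mm: "maximal_matching G M"
  show "M \<subseteq> edges G" "\<forall>e\<in>M. \<forall>f\<in>M. e \<noteq> f \<longrightarrow> e \<inter> f = {}"
    using mm by (auto simp: maximal_matching_def matching_def)
  show "\<forall>e\<in>edges G. e \<inter> \<Union>M \<noteq> {}"
  proof (rule ballI, rule notI)
    fix e assume e: "e \<in> edges G" "e \<inter> \<Union>M = {}"
    then have "matching G (insert e M)"
      using mm by (auto simp: maximal_matching_def matching_def)
    moreover have "e \<noteq> {}" using simpleD(3)[OF assms e(1)] by auto
    with e(2) have "e \<notin> M" by auto
    ultimately show False
      using mm by (auto simp: maximal_matching_def)
  qed
next
  assume r: "M \<subseteq> edges G \<and> (\<forall>e\<in>M. \<forall>f\<in>M. e \<noteq> f \<longrightarrow> e \<inter> f = {}) \<and> (\<forall>e\<in>edges G. e \<inter> \<Union>M \<noteq> {})"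
  show "maximal_matching G M"
    unfolding maximal_matching_def
  proof (intro conjI notI)
    show "matching G M" using r by (simp add: matching_def)
    assume "\<exists>M'. matching G M' \<and> M \<subset> M'"
    then obtain M' e where M': "matching G M'" "M \<subseteq> M'" "e \<in> M'" "e \<notin> M" by auto
    then have "e \<in> edges G" by (auto simp: matching_def)
    with r have "e \<inter> \<Union>M \<noteq> {}" by blast
    then obtain f where "f \<in> M" "e \<inter> f \<noteq> {}" by auto
    moreover from M' this have "e \<noteq> f" "f \<in> M'" by auto
    ultimately show False using M'(1,3) unfolding matching_def by meson
  qed
qed

text \<open>\<open>X\<close> records vertices that must be matched, so that vertices deleted
  beforehand can be put back without further edges.\<close>

definition ach :: "'a ugraph \<Rightarrow> 'a set \<Rightarrow> nat \<Rightarrow> bool" where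
  "ach G X k \<longleftrightarrow> (\<exists>M. maximal_matching G M \<and> X \<subseteq> \<Union>M \<and> card M \<le> k)"

lemma finite_mm: "simple_graph G \<Longrightarrow> maximal_matching G M \<Longrightarrow> finite M"
  by (auto simp: maximal_matching_def matching_def intro: finite_subset[OF _ finite_edges])

lemma ach_mono: "ach G X k \<Longrightarrow> Y \<subseteq> X \<Longrightarrow> k \<le> l \<Longrightarrow> ach G Y l"
  unfolding ach_def by (meson order_trans)

lemma maximal_matching_match:
  assumes G: "simple_graph G" and e: "{s, t} \<in> edges G" and M: "maximal_matching (del G {s, t}) M"
  shows "maximal_matching G (insert {s, t} M)"
proof -
  note M1 = M[unfolded maximal_matching_iff[OF simple_del[OF G]] edges_del]
  show ?thesis
    unfolding maximal_matching_iff[OF G]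
  proof (intro conjI)
    show "insert {s, t} M \<subseteq> edges G" using M1 e by auto
    have "f \<inter> {s, t} = {}" if "f \<in> M" for f
      using that M1 by blast
    then show "\<forall>e\<in>insert {s, t} M. \<forall>f\<in>insert {s, t} M. e \<noteq> f \<longrightarrow> e \<inter> f = {}"
      using M1 by (metis Int_commute insert_iff)
    show "\<forall>e\<in>edges G. e \<inter> \<Union> (insert {s, t} M) \<noteq> {}"
    proof
      fix f assume "f \<in> edges G"
      with M1 show "f \<inter> \<Union> (insert {s, t} M) \<noteq> {}"
        by (cases "f \<inter> {s, t} = {}") auto
    qed
  qed
qed

lemma ach_match:
  assumes G: "simple_graph G" and e: "{s, t} \<in> edges G" and a: "ach (del G {s, t}) X k"
  shows "ach G (insert s (insert t X)) (Suc k)"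
proof -
  from a obtain M where M: "maximal_matching (del G {s, t}) M" "X \<subseteq> \<Union>M" "card M \<le> k"
    by (auto simp: ach_def)
  have "card (insert {s, t} M) \<le> Suc k"
    using M(3) finite_mm[OF simple_del[OF G] M(1)] by (simp add: card_insert_if)
  then show ?thesis
    unfolding ach_def using M(2) maximal_matching_match[OF G e M(1)]
    by (intro exI[of _ "insert {s, t} M"]) auto
qed

lemma maximal_matching_skip:
  assumes G: "simple_graph G" and n: "\<And>u. u \<in> U \<Longrightarrow> nb G u \<subseteq> \<Union>M" and M: "maximal_matching (del G U) M"
  shows "maximal_matching G M"
proof -
  note M1 = M[unfolded maximal_matching_iff[OF simple_del[OF G]] edges_del]
  show ?thesis
    unfolding maximal_matching_iff[OF G]
  proof (intro conjI)
    show "M \<subseteq> edges G" "\<forall>e\<in>M. \<forall>f\<in>M. e \<noteq> f \<longrightarrow> e \<inter> f = {}" using M1 by auto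
    show "\<forall>e\<in>edges G. e \<inter> \<Union>M \<noteq> {}"
    proof
      fix f assume f: "f \<in> edges G"
      show "f \<inter> \<Union>M \<noteq> {}"
      proof (cases "f \<inter> U = {}")
        case True
        with f M1 show ?thesis by auto
      next
        case False
        from edgeE[OF G f] obtain a b where f: "f = {a, b}" "a \<in> nb G b" "b \<in> nb G a" by metis
        with False n have "a \<in> \<Union>M \<or> b \<in> \<Union>M" by fast
        with f show ?thesis by fast
      qed
    qed
  qed
qed

text \<open>Every edge at \<open>U\<close> has its other end in \<open>X\<close>, so putting
  \<open>U\<close> back leaves no undominated edge.\<close>

lemma ach_skip:
  assumes G: "simple_graph G" and n: "\<And>u. u \<in> U \<Longrightarrow> nb G u \<subseteq> X" and a: "ach (del G U) X k"
  shows "ach G X k"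
  using a maximal_matching_skip[OF G] n unfolding ach_def by (meson order_trans)

text \<open>If the matching contains the added edge, the rest is maximal once both ends are removed.
  If not, maximality still forces it to dominate the added edge, so one of the two ends comes
  covered for free.\<close>

lemma ach_add:
  assumes K: "simple_graph K" and ab: "a \<noteq> b" "a \<in> verts K" "b \<in> verts K" and M: "ach (add K a b) X k"
  obtains (used) l where "k = Suc l" "ach (del K {a, b}) (X - {a, b}) l"
  | (unused) c where "c \<in> {a, b}" "ach K (insert c X) k"
proof -
  note S = simple_add[OF K ab]
  from M obtain M where M: "maximal_matching (add K a b) M" "X \<subseteq> \<Union>M" "card M \<le> k"
    by (auto simp: ach_def)
  have sub: "M \<subseteq> insert {a, b} (edges K)"
    and dis: "\<And>e f. e \<in> M \<Longrightarrow> f \<in> M \<Longrightarrow> e \<noteq> f \<Longrightarrow> e \<inter> f = {}"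
    and dom: "\<And>e. e \<in> edges K \<Longrightarrow> e \<inter> \<Union>M \<noteq> {}" and dom_ab: "{a, b} \<inter> \<Union>M \<noteq> {}"
    using M(1)[unfolded maximal_matching_iff[OF S] edges_add] by auto
  show thesis
  proof (cases "{a, b} \<in> M")
    case True
    let ?N = "M - {{a, b}}"
    have ab: "f \<inter> {a, b} = {}" if "f \<in> ?N" for f
      using dis[of f "{a, b}"] that True by auto
    have "maximal_matching (del K {a, b}) ?N"
      unfolding maximal_matching_iff[OF simple_del[OF K]] edges_del
    proof (intro conjI)
      show "?N \<subseteq> {e \<in> edges K. e \<inter> {a, b} = {}}" using sub ab by blast
      show "\<forall>e\<in>?N. \<forall>f\<in>?N. e \<noteq> f \<longrightarrow> e \<inter> f = {}" using dis by simp
      show "\<forall>e\<in>{e \<in> edges K. e \<inter> {a, b} = {}}. e \<inter> \<Union>?N \<noteq> {}" using dom by fastforce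
    qed
    moreover have "X - {a, b} \<subseteq> \<Union>?N" using M(2) by auto
    moreover have "Suc (card ?N) = card M"
      by (rule card_Suc_Diff1[OF finite_mm[OF S M(1)] True])
    ultimately show thesis
      using M(3) by (intro used[of "k - 1"]) (auto simp: ach_def)
  next
    case False
    then have "maximal_matching K M"
      unfolding maximal_matching_iff[OF K] using sub dis dom by auto
    moreover from dom_ab obtain c where "c \<in> {a, b}" "c \<in> \<Union>M" by auto
    ultimately show thesis using M by (intro unused[of c]) (auto simp: ach_def)
  qed
qed

text \<open>Each edge costs 6, but \<open>b\<close> need not be a multiple of 6. The resulting slack
  is what the bridge arguments exploit.\<close>

definition cov :: "'a ugraph \<Rightarrow> 'a set \<Rightarrow> int \<Rightarrow> bool" where
  "cov G X b \<longleftrightarrow> (\<exists>k. ach G X k \<and> 6 * int k \<le> b)"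

lemma cov_mono: "cov G X b \<Longrightarrow> Y \<subseteq> X \<Longrightarrow> b \<le> c \<Longrightarrow> cov G Y c"
  unfolding cov_def by (meson ach_mono order_trans order_refl)

fun ends :: "('a \<times> 'a) list \<Rightarrow> 'a list" where
  "ends [] = []"
| "ends ((a, b) # ms) = a # b # ends ms"

lemma length_ends: "length (ends ms) = 2 * length ms"
  by (induction ms rule: ends.induct) auto

lemma ach_ends:
  assumes "simple_graph G" "distinct (ends ms)" "\<And>a b. (a, b) \<in> set ms \<Longrightarrow> b \<in> nb G a"
    "ach (del G (set (ends ms))) X k"
  shows "ach G (X \<union> set (ends ms)) (k + length ms)"
  using assms
proof (induction ms arbitrary: G rule: ends.induct)
  case (2 a b ms)
  have sub: "{c, d} \<subseteq> set (ends ms)" if "(c, d) \<in> set ms" for c d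
    using that by (induction ms rule: ends.induct) auto
  have "ach (del G {a, b}) (X \<union> set (ends ms)) (k + length ms)"
  proof (rule "2.IH")
    show "simple_graph (del G {a, b})" by (rule simple_del[OF "2.prems"(1)])
    show "distinct (ends ms)" using "2.prems"(2) by simp
    show "d \<in> nb (del G {a, b}) c" if "(c, d) \<in> set ms" for c d
      using "2.prems"(2,3) that sub[OF that] by (auto simp: nb_del)
    show "ach (del (del G {a, b}) (set (ends ms))) X k"
      using "2.prems"(4) by (simp add: del_del)
  qed
  moreover have "{a, b} \<in> edges G"
    using "2.prems"(3)[of a b] by (simp add: nb_edge(2))
  ultimately have "ach G (insert a (insert b (X \<union> set (ends ms)))) (Suc (k + length ms))"
    by (intro ach_match[OF "2.prems"(1)])
  then show ?case by (rule ach_mono) auto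
qed simp

text \<open>The general reduction: only the pairs in \<open>ms\<close> are paid for. The vertices of
  \<open>U\<close> are free, because their edges are dominated by \<open>X\<close> and the matched
  ends.\<close>

lemma cov_reduce:
  assumes "simple_graph G" "distinct (ends ms)" "set (ends ms) \<inter> U = {}"
    "\<And>a b. (a, b) \<in> set ms \<Longrightarrow> b \<in> nb G a"
    "\<And>u. u \<in> U \<Longrightarrow> nb G u \<subseteq> X \<union> set (ends ms)"
    "cov (del G (set (ends ms) \<union> U)) X b" "b + 6 * int (length ms) \<le> c"
  shows "cov G (X \<union> set (ends ms)) c"
proof -
  from assms(6) obtain k where k: "ach (del G (set (ends ms) \<union> U)) X k" "6 * int k \<le> b"
    by (auto simp: cov_def)
  have sub: "{c, d} \<subseteq> set (ends ms)" if "(c, d) \<in> set ms" for c d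
    using that by (induction ms rule: ends.induct) auto
  have "ach (del G U) (X \<union> set (ends ms)) (k + length ms)"
  proof (rule ach_ends[OF simple_del[OF assms(1)] assms(2)])
    show "d \<in> nb (del G U) c" if "(c, d) \<in> set ms" for c d
      using assms(3,4) that sub[OF that] by (auto simp: nb_del)
    show "ach (del (del G U) (set (ends ms))) X k"
      using k(1) by (simp add: del_del Un_commute)
  qed
  then have "ach G (X \<union> set (ends ms)) (k + length ms)"
    by (intro ach_skip[OF assms(1), of U]) (use assms(5) in auto)
  moreover have "6 * int (k + length ms) \<le> c" using k(2) assms(7) by simp
  ultimately show ?thesis unfolding cov_def by blast
qed

lemma cov_add:
  assumes "simple_graph K" "a \<noteq> b" "a \<in> verts K" "b \<in> verts K" "cov (add K a b) X w"
  obtains (used) "cov (del K {a, b}) (X - {a, b}) (w - 6)"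
  | (unused) c where "c \<in> {a, b}" "cov K (insert c X) w"
proof -
  from assms(5) obtain k where k: "ach (add K a b) X k" "6 * int k \<le> w" by (auto simp: cov_def)
  show thesis
  proof (cases rule: ach_add[OF assms(1-4) k(1), case_names used unused])
    case (used l)
    with k(2) show thesis by (intro that(1)) (auto simp: cov_def)
  next
    case (unused c)
    with k(2) show thesis by (intro that(2)[of c]) (auto simp: cov_def)
  qed
qed

lemma cov_gadget:
  assumes G: "simple_graph G" and e: "p \<in> nb G s" "q \<in> nb G s" "j \<in> nb G p"
    and d: "q \<noteq> j" "q \<noteq> p" "j \<noteq> s" and c: "cov (add (del G {s, p}) q j) X b" "b + 6 \<le> c"
  shows "cov G (insert s (insert p X)) c"
proof -
  have dd: "q \<noteq> s" "j \<noteq> p" "s \<noteq> p" "q \<in> verts G" "j \<in> verts G"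
    using e d nb_irrefl[OF G] nb_verts[OF G] by auto
  show ?thesis
  proof (rule cov_add[OF simple_del[OF G] d(1) _ _ c(1)])
    \<comment> \<open>The edge \<open>qj\<close> was used: its 6 units are released and the two
      edges \<open>sq\<close> and \<open>pj\<close> cost 12, again a net price of 6.\<close>
    assume "cov (del (del G {s, p}) {q, j}) (X - {q, j}) (b - 6)"
    then have "cov G ((X - {q, j}) \<union> set (ends [(s, q), (p, j)])) c"
      by (intro cov_reduce[OF G, where b = "b - 6" and U = "{}"])
        (use e d dd c(2) in \<open>auto simp: del_del insert_commute nb_sym[of q]\<close>)
    then show ?thesis by (rule cov_mono) auto
  next
    fix i assume "cov (del G {s, p}) (insert i X) b"
    then have "cov G (insert i X \<union> set (ends [(s, p)])) c"
      by (intro cov_reduce[OF G, where b = b and U = "{}"]) (use e dd c(2) in auto)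
    then show ?thesis by (rule cov_mono) auto
  qed (use d dd in auto)
qed

section \<open>Counting vertices, edges and leaves after deletions\<close>

lemma beta_del:
  assumes G: "simple_graph G" and S: "S \<subseteq> verts G"
    and E: "\<And>s z. s \<in> S \<Longrightarrow> z \<in> nb G s \<Longrightarrow> {s, z} \<in> set Es"
  shows "beta (del G S) \<le> beta G - 4 * int (card S) + int (length Es)"
proof -
  have fin: "finite S" using S simpleD(1)[OF G] finite_subset by blast
  have "edges G \<subseteq> edges (del G S) \<union> set Es"
  proof
    fix e assume e: "e \<in> edges G"
    from edgeE[OF G e] obtain a b where ab: "e = {a, b}" "a \<in> nb G b" "b \<in> nb G a" by metis
    show "e \<in> edges (del G S) \<union> set Es"
    proof (cases "e \<inter> S = {}")
      case True
      with e show ?thesis by (simp add: edges_del)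
    next
      case False
      with ab have "a \<in> S \<or> b \<in> S" by auto
      with E[of a b] E[of b a] ab show ?thesis by (auto simp: insert_commute)
    qed
  qed
  then have "card (edges G) \<le> card (edges (del G S) \<union> set Es)"
    by (intro card_mono) (auto simp: finite_edges simple_del G)
  also have "\<dots> \<le> card (edges (del G S)) + length Es"
    by (meson card_Un_le card_length add_left_mono order_trans)
  finally have "card (edges G) \<le> card (edges (del G S)) + length Es" .
  moreover have "int (card (verts G - S)) = int (card (verts G)) - int (card S)"
    using S fin simpleD(1)[OF G] by (simp add: card_Diff_subset card_mono of_nat_diff)
  ultimately show ?thesis by (simp add: beta_def)
qed

text \<open>\<open>Es\<close> may contain repetitions or pairs that are not edges. Only its length
  enters, as an upper bound for the number of lost edges, so one list can serve vertices of degree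
  two and three alike.\<close>

definition touched :: "'a ugraph \<Rightarrow> 'a set list \<Rightarrow> 'a \<Rightarrow> bool" where
  "touched G Es s \<longleftrightarrow> nb G s \<subseteq> {z. {s, z} \<in> set Es}"

lemma touchedI: "nb G s \<subseteq> N \<Longrightarrow> N \<subseteq> {z. {s, z} \<in> set Es} \<Longrightarrow> touched G Es s"
  by (auto simp: touched_def)

lemma beta_del_list:
  assumes "simple_graph G" "distinct ss" "set ss \<subseteq> verts G" "list_all (touched G Es) ss"
  shows "beta (del G (set ss)) \<le> beta G - 4 * int (length ss) + int (length Es)"
proof -
  have "beta (del G (set ss)) \<le> beta G - 4 * int (card (set ss)) + int (length Es)"
    by (rule beta_del[OF assms(1,3)]) (use assms(4) in \<open>auto simp: list_all_iff touched_def\<close>)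
  then show ?thesis by (simp add: distinct_card assms(2))
qed

lemma beta_add:
  assumes "simple_graph G" "j \<notin> nb G k"
  shows "beta (add G k j) = beta G - 1"
  using assms by (simp add: beta_def edges_add nb_edge insert_commute card_insert_if finite_edges)

lemma budget_le: "budget G \<le> beta G"
  by (simp add: budget_def)

lemma finite_pendant: "simple_graph G \<Longrightarrow> finite (pendant G)"
  by (auto simp: pendant_def finite_edges)

lemma finite_isolated: "simple_graph G \<Longrightarrow> finite (isolated G)"
  by (auto simp: isolated_def simpleD)

lemma card_le_1_cases:
  assumes "finite A" "card A \<le> 1"
  obtains "A = {}" | y where "A = {y}"
  using assms by (metis card_0_eq card_1_singletonE le_eq_less_or_eq less_one)

lemma budget_isolated:
  assumes "simple_graph G" "z \<in> verts G" "nb G z = {}"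
  shows "budget G \<le> beta G - 4"
proof -
  have "z \<in> isolated G" using assms by (simp add: isolated_def)
  then have "card (isolated G) \<noteq> 0" using finite_isolated[OF assms(1)] by auto
  then show ?thesis by (simp add: budget_def)
qed

lemma budget_leaf:
  assumes G: "simple_graph G" and z: "z \<in> verts G" "card (nb G z) \<le> 1"
  shows "budget G \<le> beta G - 1"
  using finite_nb[OF G] z(2)
proof (cases rule: card_le_1_cases)
  case 1
  then show ?thesis using budget_isolated[OF G z(1)] by simp
next
  case (2 y)
  then have "{z, y} \<in> pendant G" using nb_edge(2)[of y G z] by (auto simp: pendant_def)
  then have "card (pendant G) \<noteq> 0" using finite_pendant[OF G] by auto
  then show ?thesis by (simp add: budget_def)
qed

text \<open>Two adjacent leaves would share their pendant edge and yield one unit only; nonadjacent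
  ones have different pendant edges, even with a common neighbour.\<close>

lemma budget_leaves:
  assumes G: "simple_graph G" and z: "z \<in> verts G" "card (nb G z) \<le> 1"
    and w: "w \<in> verts G" "card (nb G w) \<le> 1" and zw: "z \<noteq> w" "z \<notin> nb G w"
  shows "budget G \<le> beta G - 2"
  using finite_nb[OF G] z(2)
proof (cases rule: card_le_1_cases)
  case 1
  then show ?thesis using budget_isolated[OF G z(1)] by simp
next
  case (2 y)
  from finite_nb[OF G] w(2) show ?thesis
  proof (cases rule: card_le_1_cases)
    case 1
    then show ?thesis using budget_isolated[OF G w(1)] by simp
  next
    case (2 x)
    have "{{z, y}, {w, x}} \<subseteq> pendant G"
      using \<open>nb G z = {y}\<close> 2 nb_edge(2)[of y G z] nb_edge(2)[of x G w] by (auto simp: pendant_def)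
    then have "card {{z, y}, {w, x}} \<le> card (pendant G)"
      by (rule card_mono[OF finite_pendant[OF G]])
    moreover have "{z, y} \<noteq> {w, x}" using zw 2 by (auto simp: doubleton_eq_iff)
    ultimately show ?thesis by (simp add: budget_def)
  qed
qed

text \<open>The matchings of the two sides cannot conflict. Only edges between the sides escape both
  maximality conditions, and for these an end in \<open>X\<close> or \<open>Y\<close> is
  demanded.\<close>

lemma cov_union:
  assumes G: "simple_graph G" and B: "B \<subseteq> verts G"
    and c1: "cov (del G (verts G - B)) X ba" and c2: "cov (del G B) Y bb"
    and cr: "\<And>u w. u \<in> B \<Longrightarrow> w \<in> nb G u \<Longrightarrow> w \<notin> B \<Longrightarrow> u \<in> X \<or> w \<in> Y"
    and b: "ba + bb \<le> b"
  shows "cov G (X \<union> Y) b"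
proof -
  from c1 obtain k1 M1 where M1: "maximal_matching (del G (verts G - B)) M1" "X \<subseteq> \<Union>M1" "card M1 \<le> k1" "6 * int k1 \<le> ba"
    by (auto simp: cov_def ach_def)
  from c2 obtain k2 M2 where M2: "maximal_matching (del G B) M2" "Y \<subseteq> \<Union>M2" "card M2 \<le> k2" "6 * int k2 \<le> bb"
    by (auto simp: cov_def ach_def)
  have s1: "M1 \<subseteq> {e \<in> edges G. e \<inter> (verts G - B) = {}}"
    and d1: "\<And>e f. e \<in> M1 \<Longrightarrow> f \<in> M1 \<Longrightarrow> e \<noteq> f \<Longrightarrow> e \<inter> f = {}"
    and m1: "\<And>e. e \<in> edges G \<Longrightarrow> e \<inter> (verts G - B) = {} \<Longrightarrow> e \<inter> \<Union>M1 \<noteq> {}"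
    using M1(1)[unfolded maximal_matching_iff[OF simple_del[OF G]] edges_del] by auto
  have s2: "M2 \<subseteq> {e \<in> edges G. e \<inter> B = {}}"
    and d2: "\<And>e f. e \<in> M2 \<Longrightarrow> f \<in> M2 \<Longrightarrow> e \<noteq> f \<Longrightarrow> e \<inter> f = {}"
    and m2: "\<And>e. e \<in> edges G \<Longrightarrow> e \<inter> B = {} \<Longrightarrow> e \<inter> \<Union>M2 \<noteq> {}"
    using M2(1)[unfolded maximal_matching_iff[OF simple_del[OF G]] edges_del] by auto
  have d12: "e \<inter> f = {}" if "e \<in> M1" "f \<in> M2" for e f
    using that s1 s2 simpleD(2)[OF G] by fast
  have mm: "maximal_matching G (M1 \<union> M2)"
    unfolding maximal_matching_iff[OF G]
  proof (intro conjI)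
    show "M1 \<union> M2 \<subseteq> edges G" using s1 s2 by auto
    show "\<forall>e\<in>M1 \<union> M2. \<forall>f\<in>M1 \<union> M2. e \<noteq> f \<longrightarrow> e \<inter> f = {}"
      by (intro ballI impI, elim UnE) (metis d1 d2 d12 Int_commute)+
    show "\<forall>e\<in>edges G. e \<inter> \<Union> (M1 \<union> M2) \<noteq> {}"
    proof
      fix e assume e: "e \<in> edges G"
      from edgeE[OF G e] obtain a c where ac: "e = {a, c}" "a \<in> nb G c" "c \<in> nb G a" by metis
      consider "e \<inter> B = {}" | "e \<inter> (verts G - B) = {}" | "a \<in> B" "c \<notin> B" | "c \<in> B" "a \<notin> B"
        using ac simpleD(2)[OF G e] by auto
      then show "e \<inter> \<Union> (M1 \<union> M2) \<noteq> {}"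
      proof cases
        case 1 then show ?thesis using m2[OF e] by fast
      next
        case 2 then show ?thesis using m1[OF e] by fast
      next
        case 3 then have "a \<in> X \<or> c \<in> Y" using cr[of a c] ac by auto
        then show ?thesis using ac(1) M1(2) M2(2) by fast
      next
        case 4 then have "c \<in> X \<or> a \<in> Y" using cr[of c a] ac by auto
        then show ?thesis using ac(1) M1(2) M2(2) by fast
      qed
    qed
  qed
  have "card (M1 \<union> M2) \<le> k1 + k2"
    using card_Un_le[of M1 M2] M1(3) M2(3) by linarith
  moreover have "X \<union> Y \<subseteq> \<Union> (M1 \<union> M2)" using M1(2) M2(2) by auto
  ultimately have "ach G (X \<union> Y) (k1 + k2)"
    unfolding ach_def using mm by blast
  then show ?thesis unfolding cov_def using M1(4) M2(4) b by (intro exI[of _ "k1 + k2"]) auto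
qed

lemma budget_closed:
  assumes G: "simple_graph G" and U: "U \<subseteq> verts G" "\<And>u. u \<in> U \<Longrightarrow> nb G u \<subseteq> U"
  shows "budget (del G (verts G - U)) + budget (del G U) = budget G"
proof -
  let ?A = "del G (verts G - U)" and ?B = "del G U"
  have fin: "finite (verts G)" by (rule simpleD(1)[OF G])
  have sA: "simple_graph ?A" and sB: "simple_graph ?B" by (rule simple_del[OF G])+
  have nA: "nb ?A v = nb G v" if "v \<in> U" for v
    using U that nb_subset[OF G, of v] by (fastforce simp: nb_del)
  have nB: "nb ?B v = nb G v" if "v \<notin> U" for v
    using U(2) that nb_sym[of _ G v] by (auto simp: nb_del)
  have eA: "e \<subseteq> U" if "e \<in> edges ?A" for e
    using that simpleD(2)[OF G, of e] by (auto simp: edges_del)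
  have eB: "e \<inter> U = {}" if "e \<in> edges ?B" for e
    using that by (auto simp: edges_del)
  have split: "e \<subseteq> U \<or> e \<inter> U = {}" if "e \<in> edges G" for e
  proof -
    from edgeE[OF G that] obtain a b where "e = {a, b}" "a \<in> nb G b" "b \<in> nb G a" by metis
    with U(2)[of a] U(2)[of b] show ?thesis by auto
  qed
  have E: "edges G = edges ?A \<union> edges ?B" "edges ?A \<inter> edges ?B = {}"
  proof -
    have "e \<in> edges ?A \<or> e \<in> edges ?B" if "e \<in> edges G" for e
      using split[OF that] that by (auto simp: edges_del)
    then show "edges G = edges ?A \<union> edges ?B" by (auto simp: edges_del)
    have "e \<notin> edges ?B" if "e \<in> edges ?A" for e
    proof
      assume "e \<in> edges ?B"
      then have "e = {}" using eA[OF that] eB by auto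
      moreover have "e \<in> edges G" using that by (simp add: edges_del)
      ultimately show False using simpleD(3)[OF G] by force
    qed
    then show "edges ?A \<inter> edges ?B = {}" by auto
  qed
  have V: "verts G = verts ?A \<union> verts ?B" "verts ?A \<inter> verts ?B = {}"
    using U by auto
  have pA: "e \<in> pendant G \<longleftrightarrow> e \<in> pendant ?A" if "e \<in> edges ?A" for e
  proof -
    have "nb ?A z = nb G z" if "z \<in> e" for z
      using nA eA[OF \<open>e \<in> edges ?A\<close>] that by auto
    with that show ?thesis by (simp add: pendant_def E(1))
  qed
  have pB: "e \<in> pendant G \<longleftrightarrow> e \<in> pendant ?B" if "e \<in> edges ?B" for e
  proof -
    have "nb ?B z = nb G z" if "z \<in> e" for z
      using nB eB[OF \<open>e \<in> edges ?B\<close>] that by auto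
    with that show ?thesis by (simp add: pendant_def E(1))
  qed
  have "e \<in> pendant G \<longleftrightarrow> e \<in> pendant ?A \<or> e \<in> pendant ?B" for e
  proof (cases "e \<in> edges G")
    case True
    then have "e \<in> edges ?A \<or> e \<in> edges ?B" using E(1) by blast
    moreover have "e \<in> pendant ?A \<Longrightarrow> e \<in> edges ?A" "e \<in> pendant ?B \<Longrightarrow> e \<in> edges ?B"
      by (simp_all add: pendant_def)
    ultimately show ?thesis using pA pB by metis
  next
    case False
    then have "e \<notin> edges ?A" "e \<notin> edges ?B" using E(1) by blast+
    with False show ?thesis by (simp add: pendant_def)
  qed
  then have P: "pendant G = pendant ?A \<union> pendant ?B" by blast
  have P2: "pendant ?A \<inter> pendant ?B = {}" using E(2) by (auto simp: pendant_def)
  have I: "isolated G = isolated ?A \<union> isolated ?B" "isolated ?A \<inter> isolated ?B = {}"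
  proof -
    have "v \<in> isolated ?A \<longleftrightarrow> v \<in> U \<and> nb G v = {}" "v \<in> isolated ?B \<longleftrightarrow> v \<in> verts G - U \<and> nb G v = {}" for v
      using nA[of v] nB[of v] U(1) by (auto simp: isolated_def)
    then show "isolated G = isolated ?A \<union> isolated ?B" "isolated ?A \<inter> isolated ?B = {}"
      using U(1) by (auto simp: isolated_def)
  qed
  have "card (verts G) = card (verts ?A) + card (verts ?B)"
    by (subst V(1), rule card_Un_disjoint) (use fin V(2) in auto)
  moreover have "card (edges G) = card (edges ?A) + card (edges ?B)"
    by (subst E(1), rule card_Un_disjoint) (use finite_edges[OF sA] finite_edges[OF sB] E(2) in auto)
  moreover have "card (pendant G) = card (pendant ?A) + card (pendant ?B)"
    by (subst P, rule card_Un_disjoint) (use finite_pendant[OF sA] finite_pendant[OF sB] P2 in auto)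
  moreover have "card (isolated G) = card (isolated ?A) + card (isolated ?B)"
    by (subst I(1), rule card_Un_disjoint) (use finite_isolated[OF sA] finite_isolated[OF sB] I(2) in auto)
  ultimately show ?thesis by (simp add: budget_def beta_def)
qed

section \<open>Cubic parts created by an added edge\<close>

lemma no_cubic_part_add:
  assumes "no_cubic_part G" "k \<noteq> j" "\<not> no_cubic_part (add G k j)"
  obtains U where "U \<subseteq> verts G" "k \<in> U" "j \<in> U" "\<And>u. u \<in> U \<Longrightarrow> nb (add G k j) u \<subseteq> U"
    "\<And>u. u \<in> U \<Longrightarrow> card (nb (add G k j) u) = 3"
proof -
  have "\<exists>U. U \<subseteq> verts G \<and> U \<noteq> {} \<and> (\<forall>u\<in>U. nb (add G k j) u \<subseteq> U) \<and> (\<forall>u\<in>U. card (nb (add G k j) u) = 3)"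
    using assms(3) by (simp add: no_cubic_part_def)
  then obtain U where U: "U \<subseteq> verts G" "U \<noteq> {}"
    "\<And>u. u \<in> U \<Longrightarrow> nb (add G k j) u \<subseteq> U" "\<And>u. u \<in> U \<Longrightarrow> card (nb (add G k j) u) = 3"
    by metis
  have "k \<in> U \<or> j \<in> U"
  proof (rule ccontr)
    assume "\<not> (k \<in> U \<or> j \<in> U)"
    then have "nb (add G k j) u = nb G u" if "u \<in> U" for u
      using that by (auto simp: nb_add[OF assms(2)])
    with no_cubic_partD[OF assms(1) U(1,2)] U(3,4) show False by simp
  qed
  with U(3)[of k] U(3)[of j] have "k \<in> U" "j \<in> U"
    using assms(2) by (auto simp: nb_add[OF assms(2)] split: if_splits)
  then show ?thesis using U by (intro that[of U])
qed

text \<open>The failure of both gadgets at \<open>p\<close> yields two sets whose intersection is the far side of the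
  bridge \<open>xq\<close>.\<close>

lemma gadget_or_bridge:
  assumes H: "subcubic_graph H" "no_cubic_part H" and x: "nb H x = {p, q}" and p: "nb H p = {x, p1, p2}"
    and d: "p \<noteq> q" "p1 \<noteq> p2" "p1 \<noteq> x" "p2 \<noteq> x" "q \<noteq> p1" "q \<noteq> p2"
    and nK: "\<not> (q \<in> nb H p1 \<and> q \<in> nb H p2)"
  obtains (gadget) i where "i \<in> {p1, p2}" "q \<notin> nb H i" "no_cubic_part (add (del H {x, p}) q i)"
  | (bridge) B where "q \<in> B" "B \<subseteq> verts H - {x, p}" "\<And>u. u \<in> B \<Longrightarrow> nb H u \<subseteq> insert x B"
    "\<And>u. u \<in> B \<Longrightarrow> card (nb H u) = 3"
proof -
  note S = subcubic_graph_simple[OF H(1)]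
  have fin: "finite (nb H u)" for u by (rule finite_nb[OF S])
  have d2: "p \<noteq> x" "q \<noteq> x" "p1 \<noteq> p" "p2 \<noteq> p"
    using x p nb_irrefl[OF S, of x] nb_irrefl[OF S, of p] by auto
  have pin: "p \<in> nb H p1" "p \<in> nb H p2" "x \<in> nb H q" using x p nb_sym[of _ H x] nb_sym[of _ H p] by auto
  have low: "card (nb H u - {x, p}) \<le> 2" if "p \<in> nb H u" for u
  proof -
    have "card (nb H u - {x, p}) < card (nb H u)"
      by (rule psubset_card_mono[OF fin]) (use that in auto)
    with subcubic_graph_card[OF H(1), of u] show ?thesis by simp
  qed
  \<comment> \<open>The cubic part \<open>U\<close> created by joining \<open>q\<close> to
    \<open>i\<close> cannot contain the other neighbour \<open>j\<close> of \<open>p\<close>, which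
    lost \<open>p\<close> and gained nothing. The vertex \<open>q\<close> lost \<open>x\<close> and
    gained \<open>i\<close>, hence it had degree three already.\<close>
  have key: "\<exists>U. U \<subseteq> verts H - {x, p} \<and> q \<in> U \<and> i \<in> U \<and> j \<notin> U \<and> nb H q - {x} \<subseteq> insert p U \<and>
      card (nb H q) = 3 \<and> (\<forall>u\<in>U. u \<noteq> q \<longrightarrow> u \<noteq> i \<longrightarrow> nb H u \<subseteq> U \<and> card (nb H u) = 3)"
    if ij: "{i, j} = {p1, p2}" and i: "q \<notin> nb H i" and n: "\<not> no_cubic_part (add (del H {x, p}) q i)" for i j
  proof -
    have ij2: "i \<noteq> j" "p \<in> nb H i" "p \<in> nb H j" "q \<noteq> i" "q \<noteq> j" "i \<noteq> p" "j \<noteq> p" "i \<noteq> x" "j \<noteq> x"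
      using ij d d2 pin by (auto simp: doubleton_eq_iff)
    from no_cubic_part_add[OF no_cubic_part_del[OF H] \<open>q \<noteq> i\<close> n] obtain U where U: "U \<subseteq> verts H - {x, p}" "q \<in> U" "i \<in> U"
      "\<And>u. u \<in> U \<Longrightarrow> nb (add (del H {x, p}) q i) u \<subseteq> U"
      "\<And>u. u \<in> U \<Longrightarrow> card (nb (add (del H {x, p}) q i) u) = 3" by auto
    have j: "j \<notin> U"
      using U(5)[of j] low[OF ij2(3)] ij2 by (auto simp: nb_add nb_del)
    have q: "nb H q - {x} \<subseteq> insert p U"
      using U(4)[OF U(2)] ij2 d d2 by (auto simp: nb_add nb_del)
    have q3: "card (nb H q) = 3"
    proof -
      have "3 = card (insert i (nb H q - {x, p}))"
        using U(5)[OF U(2)] ij2 d d2 by (simp add: nb_add nb_del)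
      also have "\<dots> \<le> Suc (card (nb H q - {x, p}))"
        by (simp add: card_insert_if fin)
      also have "card (nb H q - {x, p}) < card (nb H q)"
        by (rule psubset_card_mono[OF fin]) (use pin in auto)
      finally show ?thesis using subcubic_graph_card[OF H(1), of q] by linarith
    qed
    have "nb H u \<subseteq> U \<and> card (nb H u) = 3" if u: "u \<in> U" "u \<noteq> q" "u \<noteq> i" for u
    proof -
      have "u \<noteq> x" "u \<noteq> p" using U(1) u by auto
      then have e: "nb (add (del H {x, p}) q i) u = nb H u - {x, p}"
        using u ij2 by (simp add: nb_add nb_del)
      then have "nb H u - {x, p} = nb H u"
        by (intro nb_full[OF H(1)]) (use U(5)[OF u(1)] in auto)
      with e U(4)[OF u(1)] U(5)[OF u(1)] show ?thesis by simp
    qed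
    then show ?thesis using U(1-3) j q q3 by (intro exI[of _ U] conjI ballI impI) simp_all
  qed
  show thesis
  proof (cases "\<exists>i\<in>{p1, p2}. q \<notin> nb H i \<and> no_cubic_part (add (del H {x, p}) q i)")
    case True
    then show ?thesis using gadget by blast
  next
    case False
    \<comment> \<open>An edge from \<open>q\<close> to \<open>j\<close> survives in the new graph
      and would drag \<open>j\<close> into \<open>U\<close>. Hence \<open>q\<close> is adjacent to
      neither \<open>p1\<close> nor \<open>p2\<close>, and both joins are available and
      fail.\<close>
    have one: False if ij: "{i, j} = {p1, p2}" and j: "q \<in> nb H j" for i j
    proof -
      have i: "q \<notin> nb H i" using nK ij j by (auto simp: doubleton_eq_iff)
      have "\<not> no_cubic_part (add (del H {x, p}) q i)" using False ij i by auto
      from key[OF ij i this] obtain U where U: "q \<in> U" "j \<notin> U" "nb H q - {x} \<subseteq> insert p U" by blast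
      have "j \<noteq> x" "j \<noteq> p" using ij d d2 by (auto simp: doubleton_eq_iff)
      with U(2,3) j show False by (auto simp: nb_sym[of q H])
    qed
    have q1: "q \<notin> nb H p1" and q2: "q \<notin> nb H p2"
      using one[of p2 p1] one[of p1 p2] by auto
    from False q1 q2 have n: "\<not> no_cubic_part (add (del H {x, p}) q p1)" "\<not> no_cubic_part (add (del H {x, p}) q p2)" by auto
    from key[OF refl q1 n(1)] obtain U1 where U1: "U1 \<subseteq> verts H - {x, p}" "q \<in> U1" "p1 \<in> U1" "p2 \<notin> U1"
      "nb H q - {x} \<subseteq> insert p U1" "card (nb H q) = 3" "\<forall>u\<in>U1. u \<noteq> q \<longrightarrow> u \<noteq> p1 \<longrightarrow> nb H u \<subseteq> U1 \<and> card (nb H u) = 3"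
      by blast
    from key[OF _ q2 n(2), of p1] obtain U2 where U2: "U2 \<subseteq> verts H - {x, p}" "q \<in> U2" "p2 \<in> U2" "p1 \<notin> U2"
      "nb H q - {x} \<subseteq> insert p U2" "\<forall>u\<in>U2. u \<noteq> q \<longrightarrow> u \<noteq> p2 \<longrightarrow> nb H u \<subseteq> U2 \<and> card (nb H u) = 3"
      by (auto simp: insert_commute)
    have pq: "p \<notin> nb H q" using p d d2 by (auto simp: nb_sym[of p H])
    show ?thesis
    \<comment> \<open>\<open>U1\<close> omits \<open>p2\<close> and \<open>U2\<close> omits
      \<open>p1\<close>, so \<open>q\<close> is the only vertex of the intersection whose
      neighbourhood was altered, and all it misses is \<open>x\<close>.\<close>
    proof (rule bridge[of "U1 \<inter> U2"])
      show "q \<in> U1 \<inter> U2" using U1 U2 by simp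
      show "U1 \<inter> U2 \<subseteq> verts H - {x, p}" using U1 by auto
      fix u assume u: "u \<in> U1 \<inter> U2"
      then have "u \<noteq> p1" "u \<noteq> p2" using U1 U2 by auto
      then show "nb H u \<subseteq> insert x (U1 \<inter> U2)" "card (nb H u) = 3"
        using U1(5,6,7) U2(5,6) u pq by (cases "u = q"; blast)+
    qed
  qed
qed

lemma nb_sub3:
  assumes "subcubic_graph G" "x \<in> nb G v"
  obtains a b where "nb G v \<subseteq> {x, a, b}"
proof -
  have "card (nb G v - {x}) \<le> 2"
    using subcubic_graph_card[OF assms(1), of v] assms(2) finite_nb[OF subcubic_graph_simple[OF assms(1)]] by (simp add: card_Diff_singleton)
  moreover have "finite (nb G v - {x})" using finite_nb[OF subcubic_graph_simple[OF assms(1)]] by simp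
  ultimately have "\<exists>a b. nb G v - {x} \<subseteq> {a, b}"
  proof -
    assume c: "card (nb G v - {x}) \<le> 2" and f: "finite (nb G v - {x})"
    show ?thesis
    proof (cases "card (nb G v - {x}) = 2")
      case True then show ?thesis by (metis card_2_iff subset_refl)
    next
      case False
      with c have "card (nb G v - {x}) \<le> 1" by simp
      from f this show ?thesis by (rule card_le_1_cases) auto
    qed
  qed
  then show ?thesis using that by blast
qed

lemma nb_sub3':
  assumes "subcubic_graph G" "x \<in> nb G v" "y \<in> nb G v" "x \<noteq> y"
  obtains a where "nb G v \<subseteq> {x, y, a}"
proof -
  have "card (nb G v - {x, y}) \<le> 1"
    using subcubic_graph_card[OF assms(1), of v] assms finite_nb[OF subcubic_graph_simple[OF assms(1)]]
    by (simp add: card_Diff_subset)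
  moreover have "finite (nb G v - {x, y})" using finite_nb[OF subcubic_graph_simple[OF assms(1)]] by simp
  ultimately have "\<exists>a. nb G v - {x, y} \<subseteq> {a}"
    by (metis card_le_1_cases empty_subsetI subset_refl)
  then show ?thesis using that by blast
qed

lemma card_3_elem:
  assumes "card A = 3" "x \<in> A"
  obtains a b where "A = {x, a, b}" "a \<noteq> b" "a \<noteq> x" "b \<noteq> x"
proof -
  have "finite A" using assms(1) by (intro card_ge_0_finite) simp
  then have "card (A - {x}) = 2" using assms by simp
  then obtain a b where "A - {x} = {a, b}" "a \<noteq> b" by (auto simp: card_2_iff)
  then show ?thesis using assms(2) by (intro that[of a b]) blast+
qed

lemma card_2_elem:
  assumes "card A = 2" "x \<in> A"
  obtains a where "A = {x, a}" "a \<noteq> x"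
  using assms by (auto simp: card_2_iff)

lemma card_3_elem2:
  assumes "card A = 3" "x \<in> A" "y \<in> A" "x \<noteq> y"
  obtains a where "A = {x, y, a}" "a \<noteq> x" "a \<noteq> y"
proof -
  from card_3_elem[OF assms(1,2)] obtain a b where ab: "A = {x, a, b}" "a \<noteq> b" "a \<noteq> x" "b \<noteq> x" by blast
  with assms(3,4) have "y = a \<or> y = b" by auto
  with ab show ?thesis by (auto intro: that)
qed

text \<open>Vertices are distributed exactly; each edge between the sides disappears from both and
  raises the sum by one.\<close>

lemma beta_split:
  assumes G: "simple_graph G" and B: "B \<subseteq> verts G"
    and E: "\<And>u w. u \<in> B \<Longrightarrow> w \<in> nb G u \<Longrightarrow> w \<notin> B \<Longrightarrow> {u, w} \<in> set Es"
  shows "beta (del G (verts G - B)) + beta (del G B) \<le> beta G + int (length Es)"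
proof -
  let ?A = "del G (verts G - B)" and ?B = "del G B"
  have "edges G \<subseteq> edges ?A \<union> (edges ?B \<union> set Es)"
  proof
    fix e assume e: "e \<in> edges G"
    from edgeE[OF G e] obtain a b where ab: "e = {a, b}" "a \<in> nb G b" "b \<in> nb G a" "a \<in> verts G" "b \<in> verts G" by metis
    show "e \<in> edges ?A \<union> (edges ?B \<union> set Es)"
      using E[of a b] E[of b a] ab e by (cases "a \<in> B"; cases "b \<in> B") (auto simp: edges_del insert_commute)
  qed
  then have "card (edges G) \<le> card (edges ?A \<union> (edges ?B \<union> set Es))"
    by (intro card_mono) (auto simp: finite_edges simple_del G)
  also have "\<dots> \<le> card (edges ?A) + (card (edges ?B) + length Es)"
    by (meson card_Un_le card_length add_left_mono order_trans)
  finally have "int (card (edges G)) \<le> int (card (edges ?A)) + (int (card (edges ?B)) + int (length Es))"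
    by linarith
  moreover have "card (verts G) = card B + card (verts G - B)"
    using card_Un_disjoint[of B "verts G - B"] B simpleD(1)[OF G] finite_subset[OF B] by (simp add: Un_absorb1)
  moreover have "verts G - (verts G - B) = B" using B by auto
  ultimately show ?thesis by (simp add: beta_def)
qed

section \<open>Minimal counterexamples\<close>

text \<open>Only smaller graphs are required to have no cubic part; \<open>G\<close> itself may be
  cubic, so that the same lemmas serve the cubic case. It is not assumed that \<open>G\<close>
  violates the bound: the lemmas prove it directly.\<close>

locale descent =
  fixes G :: "'a ugraph"
  assumes subcubic_graph: "subcubic_graph G"
    and conn: "\<And>U. U \<subseteq> verts G \<Longrightarrow> U \<noteq> {} \<Longrightarrow> (\<And>u. u \<in> U \<Longrightarrow> nb G u \<subseteq> U) \<Longrightarrow> U = verts G"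
    and IH: "\<And>H :: 'a ugraph. subcubic_graph H \<Longrightarrow> no_cubic_part H \<Longrightarrow> card (verts H) < card (verts G) \<Longrightarrow> cov H {} (budget H)"
begin

lemmas simple = subcubic_graph_simple[OF subcubic_graph]

lemma nbV: "u \<in> nb G v \<Longrightarrow> u \<in> verts G"
  using nb_verts[OF simple] by blast

lemma nb_ne: "u \<in> nb G v \<Longrightarrow> u \<noteq> v"
  using nb_irrefl[OF simple] by blast

text \<open>Here connectedness replaces the hypothesis on \<open>G\<close> in
  \<open>no_cubic_part_del\<close>: a closed cubic set in the remainder has lost no edges, so it is
  closed in \<open>G\<close> and is everything.\<close>

lemma no_cubic_part_delete:
  assumes "R \<inter> verts G \<noteq> {}"
  shows "no_cubic_part (del G R)"
proof (rule no_cubic_partI)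
  fix U
  assume U: "U \<subseteq> verts (del G R)" "U \<noteq> {}" "\<And>u. u \<in> U \<Longrightarrow> nb (del G R) u \<subseteq> U"
    "\<And>u. u \<in> U \<Longrightarrow> card (nb (del G R) u) = 3"
  have eq: "nb (del G R) u = nb G u" if "u \<in> U" for u
    by (rule nb_full[OF subcubic_graph]) (use U(4)[OF that] in \<open>auto simp: nb_del\<close>)
  have "U = verts G"
    by (rule conn) (use U eq in auto)
  with U(1) assms show False by auto
qed

lemma cov_IH:
  assumes "subcubic_graph H" "no_cubic_part H" "verts H \<subset> verts G"
  shows "cov H {} (budget H)"
  by (rule IH[OF assms(1,2)]) (rule psubset_card_mono[OF simpleD(1)[OF simple] assms(3)])

lemma cov_del:
  assumes "R \<inter> verts G \<noteq> {}"
  shows "cov (del G R) {} (budget (del G R))"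
  by (rule cov_IH[OF subcubic_graph_del[OF subcubic_graph] no_cubic_part_delete[OF assms]]) (use assms in auto)

lemma cov_del_beta:
  assumes "R \<inter> verts G \<noteq> {}"
  shows "cov (del G R) {} (beta (del G R))"
  by (rule cov_mono[OF cov_del[OF assms] order_refl budget_le])

text \<open>A matched pair brings 8 units and costs 6, a skipped vertex brings 4, and every lost
  edge takes one away; \<open>d\<close> is the surcharge (or, if negative, the rebate) for the
  remaining graph. This is the inequality in the last hypothesis.\<close>

lemma reduce_cov:
  assumes d: "distinct (ends ms @ us)" and V: "set (ends ms @ us) \<subseteq> verts G"
    and e: "list_all (\<lambda>(a, b). b \<in> nb G a) ms"
    and u: "list_all (\<lambda>u. nb G u \<subseteq> X \<union> set (ends ms)) us"
    and Es: "list_all (touched G Es) (ends ms @ us)"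
    and c: "cov (del G (set (ends ms @ us))) X b" and b: "b \<le> beta (del G (set (ends ms @ us))) + d"
    and n: "d + int (length Es) \<le> 2 * int (length ms) + 4 * int (length us)"
  shows "cov G {} (beta G)"
proof -
  have "beta (del G (set (ends ms @ us))) \<le> beta G - 4 * int (length (ends ms @ us)) + int (length Es)"
    by (rule beta_del_list[OF simple d V Es])
  moreover have "length (ends ms @ us) = 2 * length ms + length us"
    by (simp add: length_ends)
  ultimately have "b + 6 * int (length ms) \<le> beta G" using b n by simp
  then have "cov G (X \<union> set (ends ms)) (beta G)"
    by (intro cov_reduce[OF simple, where b = b and U = "set us"]) (use d c e u in \<open>auto simp: list_all_iff\<close>)
  then show ?thesis by (rule cov_mono) auto
qed

text \<open>Every explicit configuration is settled by naming matched pairs \<open>ms\<close>,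
  skipped vertices \<open>us\<close> and the edges \<open>Es\<close> at them; what remains is a
  comparison of lengths.\<close>

lemma reduce:
  assumes d: "distinct (ends ms @ us)" and V: "set (ends ms @ us) \<subseteq> verts G"
    and e: "list_all (\<lambda>(a, b). b \<in> nb G a) ms"
    and u: "list_all (\<lambda>u. nb G u \<subseteq> set (ends ms)) us"
    and Es: "list_all (touched G Es) (ends ms @ us)"
    and n: "length Es \<le> 2 * length ms + 4 * length us" "ms \<noteq> []"
  shows "cov G {} (beta G)"
proof (rule reduce_cov[OF d V e _ Es, where X = "{}" and d = 0])
  obtain a b ms' where "ms = (a, b) # ms'" using n(2) by (cases ms) auto
  with V have "set (ends ms @ us) \<inter> verts G \<noteq> {}" by auto
  then show "cov (del G (set (ends ms @ us))) {} (beta (del G (set (ends ms @ us))))"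
    by (rule cov_del_beta)
qed (use u n in auto)

text \<open>The constants: deleting \<open>s\<close> changes the budget by at most -4 + 2. Matching
  \<open>s\<close> to a neighbour deletes two vertices with at most 4 edges, which gives -8 + 4 +
  6.\<close>

lemma side:
  assumes R: "R \<inter> verts G \<noteq> {}" and s: "s \<in> verts G - R" and c: "card (nb (del G R) s) \<le> 2"
  shows "cov (del G (insert s R)) {} (beta (del G R) - 2)" (is ?A)
    and "nb (del G R) s \<noteq> {} \<Longrightarrow> cov (del G R) {s} (beta (del G R) + 2)" (is "_ \<Longrightarrow> ?B")
proof -
  let ?H = "del G R"
  have H: "subcubic_graph ?H" by (rule subcubic_graph_del[OF subcubic_graph])
  note SH = subcubic_graph_simple[OF H]
  obtain q r where q: "nb ?H s \<subseteq> {q, r}"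
  proof (cases "card (nb ?H s) = 2")
    case True then show ?thesis using that by (metis card_2_iff subset_refl)
  next
    case False
    with c have "card (nb ?H s) \<le> 1" by simp
    from finite_nb[OF SH] this show ?thesis by (rule card_le_1_cases) (use that in auto)
  qed
  have "beta (del ?H {s}) \<le> beta ?H - 4 * int (card {s}) + int (length [{s, q}, {s, r}])"
    by (rule beta_del[OF SH]) (use s q in auto)
  moreover have "del ?H {s} = del G (insert s R)" by (simp add: del_del)
  moreover have "cov (del G (insert s R)) {} (beta (del G (insert s R)))"
    by (rule cov_del_beta) (use R in auto)
  ultimately show ?A by (auto elim: cov_mono)
  assume "nb ?H s \<noteq> {}"
  then obtain p where p: "p \<in> nb ?H s" by auto
  with q obtain r' where q: "nb ?H s \<subseteq> {p, r'}" by blast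
  have "s \<in> nb ?H p" using p by (simp add: nb_sym)
  then obtain a b where ab: "nb ?H p \<subseteq> {s, a, b}" using nb_sub3[OF H] by metis
  have ne: "p \<noteq> s" using p nb_irrefl[OF SH] by auto
  have "beta (del ?H {s, p}) \<le> beta ?H - 4 * int (card {s, p}) + int (length [{s, p}, {s, r'}, {p, a}, {p, b}])"
    by (rule beta_del[OF SH]) (use s q ab nb_verts[OF SH p] in auto)
  moreover have "del ?H {s, p} = del G ({s, p} \<union> R)" by (simp add: del_del Un_commute)
  moreover have "cov (del G ({s, p} \<union> R)) {} (beta (del G ({s, p} \<union> R)))"
    by (rule cov_del_beta) (use R in auto)
  ultimately have "cov (del ?H {s, p}) {} (beta ?H - 4)" using ne by (auto elim: cov_mono)
  then have "cov ?H ({} \<union> set (ends [(s, p)])) (beta ?H + 2)"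
    by (intro cov_reduce[OF SH, where U = "{}"]) (use p ne in auto)
  then show ?B by (rule cov_mono) auto
qed

end

text \<open>Rounding down to multiples of 6 makes up for the missing units.\<close>

lemma round6:
  fixes s :: int
  assumes "6 * s0 \<le> s" "6 * s1 \<le> s - 2" "6 * s2 \<le> s + 2"
  obtains a c where "s = 6 * a + c" "0 \<le> c" "c \<le> 5" "s0 \<le> a" "s1 \<le> a" "s2 \<le> a + 1"
    "c \<le> 1 \<Longrightarrow> s1 \<le> a - 1" "c \<le> 3 \<Longrightarrow> s2 \<le> a"
proof -
  define a c where "a = s div 6" and "c = s mod 6"
  have *: "s = 6 * a + c" "0 \<le> c" "c < 6"
    by (simp_all add: a_def c_def)
  show ?thesis
    by (rule that[of a c]) (use * assms in linarith)+
qed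

text \<open>Let \<open>c\<close> and \<open>d\<close> be the residues of \<open>s\<close> and
  \<open>t\<close> modulo 6. If both are 0, deleting both ends saves an edge on each side, so
  matching the bridge is affordable. If c + d \<ge> 1 and one residue is at most 3, the end on that
  side is covered without an extra edge. If both are at least 4, then c + d - 1 \<ge> 6 pays for
  matching the bridge.\<close>

lemma bridge_arith_3:
  fixes s t :: int
  assumes "6 * s0 \<le> s" "6 * s1 \<le> s - 2" "6 * s2 \<le> s + 2" "6 * t0 \<le> t" "6 * t1 \<le> t - 2" "6 * t2 \<le> t + 2"
  shows "6 * (1 + s1 + t1) \<le> s + t - 1 \<or> 6 * (s2 + t0) \<le> s + t - 1 \<or> 6 * (s0 + t2) \<le> s + t - 1"
proof (rule round6[OF assms(1-3)], rule round6[OF assms(4-6)], rule ccontr)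
  fix a c b d
  assume "s = 6 * a + c" "0 \<le> c" "c \<le> 5" "s0 \<le> a" "s1 \<le> a" "s2 \<le> a + 1"
    "c \<le> 1 \<Longrightarrow> s1 \<le> a - 1" "c \<le> 3 \<Longrightarrow> s2 \<le> a"
    "t = 6 * b + d" "0 \<le> d" "d \<le> 5" "t0 \<le> b" "t1 \<le> b" "t2 \<le> b + 1"
    "d \<le> 1 \<Longrightarrow> t1 \<le> b - 1" "d \<le> 3 \<Longrightarrow> t2 \<le> b"
    "\<not> (6 * (1 + s1 + t1) \<le> s + t - 1 \<or> 6 * (s2 + t0) \<le> s + t - 1 \<or> 6 * (s0 + t2) \<le> s + t - 1)"
  then show False
    by (cases "c \<le> 1"; cases "c \<le> 3"; cases "d \<le> 1"; cases "d \<le> 3"; simp; linarith)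
qed

text \<open>If both residues modulo 6 are at most 3, both ends are covered without an extra edge.
  Otherwise the residues together with the summand 2 reach 6 and pay for one.\<close>

lemma bridge_arith_2:
  fixes s t :: int
  assumes "6 * s0 \<le> s" "6 * s1 \<le> s - 2" "6 * s2 \<le> s + 2" "6 * t0 \<le> t" "6 * t1 \<le> t - 2" "6 * t2 \<le> t + 2"
  shows "6 * (s2 + t2) \<le> s + t + 2 \<or> 6 * (1 + s1 + t0) \<le> s + t + 2"
proof (rule round6[OF assms(1-3)], rule round6[OF assms(4-6)], rule ccontr)
  fix a c b d
  assume "s = 6 * a + c" "0 \<le> c" "c \<le> 5" "s0 \<le> a" "s1 \<le> a" "s2 \<le> a + 1"
    "c \<le> 1 \<Longrightarrow> s1 \<le> a - 1" "c \<le> 3 \<Longrightarrow> s2 \<le> a"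
    "t = 6 * b + d" "0 \<le> d" "d \<le> 5" "t0 \<le> b" "t1 \<le> b" "t2 \<le> b + 1"
    "d \<le> 1 \<Longrightarrow> t1 \<le> b - 1" "d \<le> 3 \<Longrightarrow> t2 \<le> b"
    "\<not> (6 * (s2 + t2) \<le> s + t + 2 \<or> 6 * (1 + s1 + t0) \<le> s + t + 2)"
  then show False
    by (cases "c \<le> 1"; cases "c \<le> 3"; cases "d \<le> 1"; cases "d \<le> 3"; simp; linarith)
qed

section \<open>Leaves\<close>

context descent
begin

lemma leaf_K2:
  assumes v: "v \<in> verts G" "nb G v = {u}" and u: "nb G u = {v}"
  shows "verts G = {u, v}" "edges G = {{u, v}}" "cov G {} (budget G)"
proof -
  have uv: "u \<in> verts G" "u \<noteq> v" using nbV[of u v] nb_ne[of u v] v by auto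
  show V: "verts G = {u, v}"
    by (rule conn[symmetric]) (use v u uv in auto)
  have e: "{u, v} \<in> edges G" using v by (auto simp: nb_def)
  have "f \<in> {{u, v}}" if "f \<in> edges G" for f
  proof -
    from edgeE[OF simple that] obtain a b where "f = {a, b}" "a \<noteq> b" "a \<in> verts G" "b \<in> verts G" by metis
    with V show ?thesis by auto
  qed
  with e show E: "edges G = {{u, v}}" by blast
  have "maximal_matching G {{u, v}}"
    unfolding maximal_matching_iff[OF simple] using E by auto
  then have "cov G {} 6" by (auto simp: cov_def ach_def intro!: exI[of _ "Suc 0"] exI[of _ "{{u, v}}"])
  moreover have "pendant G = {{u, v}}" using E v by (auto simp: pendant_def)
  moreover have "isolated G = {}" using V v u by (auto simp: isolated_def)
  ultimately show "cov G {} (budget G)"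
    using V E uv by (simp add: budget_def beta_def)
qed

text \<open>Matching \<open>u\<close> to another neighbour \<open>a\<close> covers the only
  neighbour of \<open>v\<close>, so \<open>v\<close> is skipped and \<open>uv\<close> is avoided
  automatically. The work lies in controlling the pendant edges that disappear.\<close>

lemma leaf_avoid:
  assumes v: "v \<in> verts G" "nb G v = {u}" and a: "a \<in> nb G u" "a \<noteq> v"
  shows "\<exists>M. maximal_matching G M \<and> {u, v} \<notin> M \<and> 6 * int (card M) \<le> budget G"
proof -
  let ?S = "{u, a, v}" let ?H = "del G ?S"
  have vu: "v \<in> nb G u" using v by (simp add: nb_sym[of v])
  have ne: "u \<noteq> v" "a \<noteq> u" "u \<in> verts G" "a \<in> verts G"
    using nb_ne[of u v] nb_ne[of a u] nbV[of u v] nbV[of a u] v a by auto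
  have H: "subcubic_graph ?H" by (rule subcubic_graph_del[OF subcubic_graph])
  note SH = subcubic_graph_simple[OF H]
  from cov_del[of ?S] v obtain M where M: "maximal_matching ?H M" "6 * int (card M) \<le> budget ?H"
    by (auto simp: cov_def ach_def)
  have "del (del G {v}) {u, a} = ?H" by (simp add: del_del insert_commute)
  moreover have "{u, a} \<in> edges (del G {v})"
    using a ne by (auto simp: edges_del nb_edge(2))
  ultimately have "maximal_matching (del G {v}) (insert {u, a} M)"
    using maximal_matching_match[OF simple_del[OF simple], of u a "{v}" M] M(1) by simp
  then have mm: "maximal_matching G (insert {u, a} M)"
    by (rule maximal_matching_skip[OF simple, rotated]) (use v in auto)
  have sub: "M \<subseteq> edges ?H" using M(1) by (auto simp: maximal_matching_def matching_def)
  then have uv: "{u, v} \<notin> insert {u, a} M" using a by (auto simp: edges_del doubleton_eq_iff)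
  have card: "card (insert {u, a} M) \<le> Suc (card M)"
    using finite_mm[OF SH M(1)] by (simp add: card_insert_if)
  from nb_sub3'[OF subcubic_graph vu a(1) a(2)[symmetric]] obtain b where b: "nb G u \<subseteq> {v, a, b}" by metis
  from nb_sub3[OF subcubic_graph, of u a] a obtain c d where cd: "nb G a \<subseteq> {u, c, d}"
    by (auto simp: nb_sym[of u])
  let ?A = "{{u, v}, {u, a}}"
  \<comment> \<open>A pendant edge outside \<open>?A\<close> is lost only if its leaf becomes
    isolated, and then the 4 units charged for an isolated vertex outweigh the lost unit.\<close>
  have pen: "pendant G \<subseteq> pendant ?H \<union> ((pendant G \<inter> ?A) \<union> (\<lambda>z. insert z (nb G z)) ` isolated ?H)"
  proof
    fix e assume e: "e \<in> pendant G"
    then obtain z where z: "e \<in> edges G" "z \<in> e" "card (nb G z) = 1" by (auto simp: pendant_def)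
    then obtain y where y: "nb G z = {y}" by (auto simp: card_1_singleton_iff)
    with z have ey: "e = {z, y}" using edgeE[OF simple z(1)]
      by (metis insertE singletonD insert_commute)
    show "e \<in> pendant ?H \<union> ((pendant G \<inter> ?A) \<union> (\<lambda>z. insert z (nb G z)) ` isolated ?H)"
    proof (cases "z \<in> ?S")
      case True
      have "z \<noteq> u" using vu a y by auto
      then have "e \<in> ?A" using True y v(2) a(1) ey nb_sym[of u G a] by (auto simp: insert_commute)
      with e show ?thesis by simp
    next
      case False
      have zV: "z \<in> verts G" using simpleD(2)[OF simple z(1)] z(2) by auto
      show ?thesis
      proof (cases "y \<in> ?S")
        case True
        with False y zV have "z \<in> isolated ?H" by (auto simp: isolated_def nb_del)
        with ey y show ?thesis by auto
      next
        case F: False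
        with False y z(1) ey have "e \<in> pendant ?H" by (auto simp: pendant_def edges_del nb_del)
        then show ?thesis by simp
      qed
    qed
  qed
  have fi: "finite (isolated ?H)" "finite (pendant ?H)"
    using finite_isolated[OF SH] finite_pendant[OF SH] by auto
  have "card (pendant G) \<le> card (pendant ?H) + (card (pendant G \<inter> ?A) + card (isolated ?H))"
  proof -
    have "card (pendant G) \<le> card (pendant ?H \<union> ((pendant G \<inter> ?A) \<union> (\<lambda>z. insert z (nb G z)) ` isolated ?H))"
      by (rule card_mono[OF _ pen]) (use fi in auto)
    also have "\<dots> \<le> card (pendant ?H) + (card (pendant G \<inter> ?A) + card (isolated ?H))"
      by (meson card_Un_le card_image_le[OF fi(1)] add_left_mono order_trans)
    finally show ?thesis .
  qed
  \<comment> \<open>The three vertices give 12 units. Generally at most 5 edges and one pendant edge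
    are lost; if \<open>a\<close> is a leaf too, at most 3 edges and two pendant edges.\<close>
  moreover have "beta ?H + int (card (pendant G \<inter> ?A)) \<le> beta G - 6"
  proof (cases "nb G a = {u}")
    case True
    have "beta (del G (set [u, a, v])) \<le> beta G - 4 * int (length [u, a, v]) + int (length [{u, v}, {u, a}, {u, b}])"
      by (rule beta_del_list[OF simple]; (simp only: list.pred_inject)?, (intro conjI TrueI)?;
          (rule touchedI, rule v(2)[THEN equalityD1] b True[THEN equalityD1])?; use v ne a in \<open>simp add: doubleton_eq_iff\<close>)
    moreover have "card (pendant G \<inter> ?A) \<le> 2"
      by (rule order_trans[OF card_mono[of ?A]]) (auto simp: card_insert_if)
    ultimately show ?thesis using ne a by simp
  next
    case False
    have "card (nb G a) \<noteq> 1"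
    proof
      assume "card (nb G a) = 1"
      then obtain y where "nb G a = {y}" by (auto simp: card_1_singleton_iff)
      moreover have "u \<in> nb G a" using a by (simp add: nb_sym[of u])
      ultimately show False using False by auto
    qed
    moreover have "card (nb G u) \<noteq> 1"
      using vu a by (auto simp: card_1_singleton_iff)
    ultimately have "{u, a} \<notin> pendant G" by (auto simp: pendant_def)
    then have "pendant G \<inter> ?A \<subseteq> {{u, v}}" by auto
    then have "card (pendant G \<inter> ?A) \<le> card {{u, v}}"
      by (rule card_mono[rotated]) simp
    moreover have "beta (del G (set [u, a, v])) \<le> beta G - 4 * int (length [u, a, v]) + int (length [{u, v}, {u, a}, {u, b}, {a, c}, {a, d}])"
      by (rule beta_del_list[OF simple]; (simp only: list.pred_inject)?, (intro conjI TrueI)?;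
          (rule touchedI, rule v(2)[THEN equalityD1] b cd)?; use v ne a in \<open>simp add: doubleton_eq_iff\<close>)
    ultimately show ?thesis using ne a by simp
  qed
  moreover have "isolated G = {}"
  proof -
    have False if "z \<in> verts G" "nb G z = {}" for z
    proof -
      have "{z} = verts G" by (rule conn) (use that in auto)
      with v ne show False by auto
    qed
    then show ?thesis by (auto simp: isolated_def)
  qed
  ultimately have "budget ?H \<le> budget G - 6"
    by (simp add: budget_def)
  with M(2) card have "6 * int (card (insert {u, a} M)) \<le> budget G" by linarith
  with mm uv show ?thesis by blast
qed

lemma leaf_cov:
  assumes v: "v \<in> verts G" "nb G v = {u}"
  shows "cov G {} (budget G)"
proof (cases "nb G u = {v}")
  case True
  from leaf_K2(3)[OF v this] show ?thesis .
next
  case False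
  have "v \<in> nb G u" using v by (simp add: nb_sym[of v])
  with False obtain a where "a \<in> nb G u" "a \<noteq> v" by auto
  from leaf_avoid[OF v this] show ?thesis by (auto simp: cov_def ach_def)
qed

end

section \<open>Bridges in graphs of minimum degree two\<close>

locale leafless = descent +
  assumes deg2: "\<And>v. v \<in> verts G \<Longrightarrow> 2 \<le> card (nb G v)"
begin

lemma deg_cases:
  assumes "v \<in> verts G"
  obtains "card (nb G v) = 2" | "card (nb G v) = 3"
  using deg2[OF assms] subcubic_graph_card[OF subcubic_graph, of v] by linarith

lemma nb_other:
  assumes "v \<in> verts G"
  obtains u where "u \<in> nb G v" "u \<noteq> x"
proof -
  have "\<not> nb G v \<subseteq> {x}"
    using deg2[OF assms] card_mono[of "{x}" "nb G v"] by auto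
  with that show ?thesis by auto
qed

text \<open>The two sides may be treated independently, and in each of them rounding applies; it depends on
  the residues modulo 6 whether \<open>v\<close> is better left uncovered or matched to \<open>s\<close>.\<close>

lemma cut_vertex:
  assumes v: "v \<in> verts G" "nb G v = {s, t}" and B: "B \<subseteq> verts G" "v \<notin> B" "s \<in> B" "t \<notin> B"
    "\<And>u. u \<in> B \<Longrightarrow> nb G u \<subseteq> insert v B"
  shows "cov G {} (beta G)"
proof -
  let ?R = "verts G - B" and ?Q = "insert v B"
  have V: "s \<in> verts G" "t \<in> verts G" "s \<noteq> v" "t \<noteq> v" using v nbV[of _ v] nb_ne[of _ v] by auto
  have vin: "v \<in> nb G s" "v \<in> nb G t" using v by (auto simp: nb_sym[of v])
  have clo: "u \<notin> B" if "u \<in> nb G w" "w \<notin> ?Q" for u w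
    using B(5)[of u] that by (auto simp: nb_sym[of u])
  have less: "card (nb G w - {v}) \<le> 2" if "v \<in> nb G w" for w
    using subcubic_graph_card[OF subcubic_graph, of w] that finite_nb[OF simple] by (simp add: card_Diff_singleton)
  have cs: "card (nb (del G ?R) s) \<le> 2"
    by (rule order_trans[OF card_mono less[OF vin(1)]])
      (use finite_nb[OF simple] v B in \<open>auto simp: nb_del\<close>)
  have ct: "card (nb (del G ?Q) t) \<le> 2"
    by (rule order_trans[OF card_mono less[OF vin(2)]])
      (use finite_nb[OF simple] v B in \<open>auto simp: nb_del\<close>)
  from nb_other[OF V(1), of v] obtain s' where s': "s' \<in> nb G s" "s' \<noteq> v" by auto
  with B(3,5) have ns: "nb (del G ?R) s \<noteq> {}" by (auto simp: nb_del)
  from nb_other[OF V(2), of v] obtain t' where t': "t' \<in> nb G t" "t' \<noteq> v" by auto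
  with clo[of t' t] B(4) V have nt: "nb (del G ?Q) t \<noteq> {}" by (auto simp: nb_del)
  have R: "?R \<inter> verts G \<noteq> {}" "s \<in> verts G - ?R" and Q: "?Q \<inter> verts G \<noteq> {}" "t \<in> verts G - ?Q"
    using v B V by auto
  from cov_del_beta[OF R(1)] obtain s0 where s0: "ach (del G ?R) {} s0" "6 * int s0 \<le> beta (del G ?R)"
    by (auto simp: cov_def)
  from side(1)[OF R cs] obtain s1 where s1: "ach (del G (insert s ?R)) {} s1" "6 * int s1 \<le> beta (del G ?R) - 2"
    by (auto simp: cov_def)
  from side(2)[OF R cs ns] obtain s2 where s2: "ach (del G ?R) {s} s2" "6 * int s2 \<le> beta (del G ?R) + 2"
    by (auto simp: cov_def)
  from cov_del_beta[OF Q(1)] obtain t0 where t0: "ach (del G ?Q) {} t0" "6 * int t0 \<le> beta (del G ?Q)"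
    by (auto simp: cov_def)
  from side(1)[OF Q ct] obtain t1 where t1: "ach (del G (insert t ?Q)) {} t1" "6 * int t1 \<le> beta (del G ?Q) - 2"
    by (auto simp: cov_def)
  from side(2)[OF Q ct nt] obtain t2 where t2: "ach (del G ?Q) {t} t2" "6 * int t2 \<le> beta (del G ?Q) + 2"
    by (auto simp: cov_def)
  let ?H = "del G {v}"
  have SH: "simple_graph ?H" by (rule simple_del[OF simple])
  have BH: "B \<subseteq> verts ?H" using B by auto
  have eq: "del ?H (verts ?H - B) = del G ?R" "del ?H B = del G ?Q"
      unfolding del_del verts_del by (rule arg_cong[of _ _ "del G"]; use B v in blast)+
  have noc: "False" if "u \<in> B" "w \<in> nb ?H u" "w \<notin> B" for u w
    using B(5)[OF that(1)] that by (auto simp: nb_del split: if_splits)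
  have "beta (del ?H (verts ?H - B)) + beta (del ?H B) \<le> beta ?H + int (length ([] :: 'a set list))"
    by (rule beta_split[OF SH BH]) (metis noc)
  moreover have "beta ?H \<le> beta G - 4 * int (card {v}) + int (length [{v, s}, {v, t}])"
    by (rule beta_del[OF simple]) (use v in auto)
  \<comment> \<open>The 2 units gained by deleting \<open>v\<close> with its two edges are the
    summand 2 in \<open>bridge_arith_2\<close>.\<close>
  ultimately have bb: "beta (del G ?R) + beta (del G ?Q) + 2 \<le> beta G"
    unfolding eq by simp
  from bridge_arith_2[OF s0(2) s1(2) s2(2) t0(2) t1(2) t2(2)]
  show ?thesis
  proof
    assume a: "6 * (int s2 + int t2) \<le> beta (del G ?R) + beta (del G ?Q) + 2"
    have "cov ?H ({s} \<union> {t}) (6 * int s2 + 6 * int t2)"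
      by (rule cov_union[OF SH BH, where ba = "6 * int s2" and bb = "6 * int t2"]) (use s2 t2 eq noc in \<open>auto simp: cov_def\<close>)
    then have "cov G ({s, t} \<union> set (ends [])) (beta G)"
      by (intro cov_reduce[OF simple, where b = "6 * int s2 + 6 * int t2" and U = "{v}"]) (use v bb a in \<open>auto simp: insert_commute\<close>)
    then show ?thesis by (rule cov_mono) auto
  next
    assume a: "6 * (1 + int s1 + int t0) \<le> beta (del G ?R) + beta (del G ?Q) + 2"
    let ?K = "del G {v, s}"
    have SK: "simple_graph ?K" by (rule simple_del[OF simple])
    have BK: "B - {s} \<subseteq> verts ?K" using B by auto
    have eq: "del ?K (verts ?K - (B - {s})) = del G (insert s ?R)" "del ?K (B - {s}) = del G ?Q"
      unfolding del_del verts_del by (rule arg_cong[of _ _ "del G"]; use B v in blast)+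
    have noc: "False" if "u \<in> B - {s}" "w \<in> nb ?K u" "w \<notin> B - {s}" for u w
      using B(5)[of u] that by (auto simp: nb_del split: if_splits)
    have "cov ?K ({} \<union> {}) (6 * int s1 + 6 * int t0)"
      by (rule cov_union[OF SK BK, where ba = "6 * int s1" and bb = "6 * int t0"]) (use s1 t0 eq noc in \<open>auto simp: cov_def\<close>)
    then have "cov G ({} \<union> set (ends [(v, s)])) (beta G)"
      by (intro cov_reduce[OF simple, where b = "6 * int s1 + 6 * int t0" and U = "{}"]) (use v bb a V in auto)
    then show ?thesis by (rule cov_mono) auto
  qed
qed

text \<open>The bridge \<open>qx\<close> is dominated by being matched itself or by covering one end
  inside its own side. These are the three options of \<open>bridge_arith_3\<close>, whose -1 is the
  bridge, present in neither side.\<close>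

lemma bridge_3:
  assumes q: "q \<in> B" "card (nb G q) = 3" and x: "x \<notin> B" "x \<in> nb G q" "card (nb G x) = 3"
    and B: "B \<subseteq> verts G" "\<And>u. u \<in> B \<Longrightarrow> nb G u \<subseteq> insert x B" "\<And>u. u \<in> B \<Longrightarrow> x \<in> nb G u \<Longrightarrow> u = q"
  shows "cov G {} (beta G)"
proof -
  let ?R = "verts G - B"
  have V: "q \<in> verts G" "x \<in> verts G" "q \<in> nb G x" "q \<noteq> x"
    using q(1) x(2) B(1) nbV[OF x(2)] nb_ne[OF x(2)] nb_sym[of q G x] by auto
  have out: "u \<notin> B \<or> w = x \<and> u = q" if "u \<in> nb G w" "w \<notin> B" for u w
    using B(2)[of u] B(3)[of u] that by (auto simp: nb_sym[of u])
  have nq: "nb (del G ?R) q = nb G q - {x}"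
    using B(2)[OF q(1)] q x V by (auto simp: nb_del dest: nbV)
  have nx: "nb (del G B) x = nb G x - {q}"
    using out x q by (auto simp: nb_del)
  have cq: "card (nb (del G ?R) q) = 2" using q x nq finite_nb[OF simple] by simp
  have cx: "card (nb (del G B) x) = 2" using V x nx finite_nb[OF simple] by simp
  have R: "?R \<inter> verts G \<noteq> {}" "q \<in> verts G - ?R" and Q: "B \<inter> verts G \<noteq> {}" "x \<in> verts G - B"
    using q x(1) B(1) V by auto
  from cov_del_beta[OF R(1)] obtain s0 where s0: "ach (del G ?R) {} s0" "6 * int s0 \<le> beta (del G ?R)"
    by (auto simp: cov_def)
  from side(1)[OF R] cq obtain s1 where s1: "ach (del G (insert q ?R)) {} s1" "6 * int s1 \<le> beta (del G ?R) - 2"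
    by (auto simp: cov_def)
  from side(2)[OF R] cq obtain s2 where s2: "ach (del G ?R) {q} s2" "6 * int s2 \<le> beta (del G ?R) + 2"
    by (fastforce simp: cov_def)
  from cov_del_beta[OF Q(1)] obtain t0 where t0: "ach (del G B) {} t0" "6 * int t0 \<le> beta (del G B)"
    by (auto simp: cov_def)
  from side(1)[OF Q] cx obtain t1 where t1: "ach (del G (insert x B)) {} t1" "6 * int t1 \<le> beta (del G B) - 2"
    by (auto simp: cov_def)
  from side(2)[OF Q] cx obtain t2 where t2: "ach (del G B) {x} t2" "6 * int t2 \<le> beta (del G B) + 2"
    by (fastforce simp: cov_def)
  have cr: "u = q \<and> w = x" if "u \<in> B" "w \<in> nb G u" "w \<notin> B" for u w
    using B(2)[of u] B(3)[of u] that by auto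
  have "beta (del G ?R) + beta (del G B) \<le> beta G + int (length [{q, x}])"
    by (rule beta_split[OF simple B(1)]) (use cr in fastforce)
  then have bb: "beta (del G ?R) + beta (del G B) - 1 \<le> beta G" by simp
  from bridge_arith_3[OF s0(2) s1(2) s2(2) t0(2) t1(2) t2(2)]
  consider (a) "6 * (1 + int s1 + int t1) \<le> beta (del G ?R) + beta (del G B) - 1"
    | (b) "6 * (int s2 + int t0) \<le> beta (del G ?R) + beta (del G B) - 1"
    | (c) "6 * (int s0 + int t2) \<le> beta (del G ?R) + beta (del G B) - 1" by blast
  then show ?thesis
  proof cases
    case a
    let ?K = "del G {q, x}"
    have SK: "simple_graph ?K" by (rule simple_del[OF simple])
    have BK: "B - {q} \<subseteq> verts ?K" using B x by auto
    have eq: "del ?K (verts ?K - (B - {q})) = del G (insert q ?R)" "del ?K (B - {q}) = del G (insert x B)"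
      unfolding del_del verts_del by (rule arg_cong[of _ _ "del G"]; use B V q x in blast)+
    have noc: "False" if "u \<in> B - {q}" "w \<in> nb ?K u" "w \<notin> B - {q}" for u w
      using cr[of u w] that by (auto simp: nb_del split: if_splits)
    have "cov ?K ({} \<union> {}) (6 * int s1 + 6 * int t1)"
      by (rule cov_union[OF SK BK, where ba = "6 * int s1" and bb = "6 * int t1"]) (use s1 t1 eq noc in \<open>auto simp: cov_def\<close>)
    then have "cov G ({} \<union> set (ends [(q, x)])) (beta G)"
      by (intro cov_reduce[OF simple, where b = "6 * int s1 + 6 * int t1" and U = "{}"]) (use bb a V x in auto)
    then show ?thesis by (rule cov_mono) auto
  next
    case b
    have "cov G ({q} \<union> {}) (6 * int s2 + 6 * int t0)"
      by (rule cov_union[OF simple B(1), where ba = "6 * int s2" and bb = "6 * int t0"]) (use s2 t0 cr in \<open>auto simp: cov_def\<close>)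
    then show ?thesis by (rule cov_mono) (use b bb in auto)
  next
    case c
    have "cov G ({} \<union> {x}) (6 * int s0 + 6 * int t2)"
      by (rule cov_union[OF simple B(1), where ba = "6 * int s0" and bb = "6 * int t2"]) (use s0 t2 cr in \<open>auto simp: cov_def\<close>)
    then show ?thesis by (rule cov_mono) (use c bb in auto)
  qed
qed

text \<open>An end of degree two separates its other neighbour from the far end, so it can serve as
  the cut vertex; only two ends of degree three need the rounding for the bridge itself.\<close>

lemma bridge:
  assumes q: "q \<in> B" and x: "x \<notin> B" "x \<in> nb G q"
    and B: "B \<subseteq> verts G" "\<And>u. u \<in> B \<Longrightarrow> nb G u \<subseteq> insert x B" "\<And>u. u \<in> B \<Longrightarrow> x \<in> nb G u \<Longrightarrow> u = q"
  shows "cov G {} (beta G)"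
proof -
  have V: "q \<in> verts G" "x \<in> verts G" "q \<in> nb G x" "q \<noteq> x"
    using q x(2) B(1) nbV[OF x(2)] nb_ne[OF x(2)] nb_sym[of q G x] by auto
  from V(1) show ?thesis
  proof (cases rule: deg_cases)
    case 1
    from card_2_elem[OF 1 x(2)] obtain s where s: "nb G q = {x, s}" "s \<noteq> x" by metis
    show ?thesis
    proof (rule cut_vertex[of q s x "B - {q}"])
      show "nb G q = {s, x}" using s by auto
      show "s \<in> B - {q}" using s B(2)[OF q] nb_ne[of s q] by auto
      show "nb G u \<subseteq> insert q (B - {q})" if "u \<in> B - {q}" for u
        using B(2)[of u] B(3)[of u] that by auto
    qed (use V B(1) x in auto)
  next
    case q3: 2
    from V(2) show ?thesis
    proof (cases rule: deg_cases)
      case 1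
      from card_2_elem[OF 1 V(3)] obtain t where t: "nb G x = {q, t}" "t \<noteq> q" by metis
      have "t \<notin> B" using B(3)[of t] t by (auto simp: nb_sym[of x])
      show ?thesis
        by (rule cut_vertex[of x q t B]) (use V B(1,2) x q t \<open>t \<notin> B\<close> in auto)
    next
      case 2
      from bridge_3[OF q q3 x 2 B] show ?thesis .
    qed
  qed
qed

end

context leafless
begin

text \<open>\<open>a\<close> and \<open>b\<close> coincide at a vertex of degree two. The edge lists
  built from them then contain a repetition, which does no harm.\<close>

lemma nb_eq3:
  assumes "x \<in> nb G v"
  obtains a b where "nb G v = {x, a, b}" "a \<noteq> x" "b \<noteq> x"
proof -
  have "v \<in> verts G" using nbV[of v x] assms by (simp add: nb_sym[of v])
  then show ?thesis
  proof (cases rule: deg_cases)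
    case 1
    then show ?thesis using card_2_elem[OF 1 assms] that by (metis insert_absorb2)
  next
    case 2
    then show ?thesis using card_3_elem[OF 2 assms] that by metis
  qed
qed

lemma nb_eq3':
  assumes "x \<in> nb G v" "y \<in> nb G v" "x \<noteq> y"
  obtains "nb G v = {x, y}" | a where "nb G v = {x, y, a}" "a \<noteq> x" "a \<noteq> y"
proof -
  have "v \<in> verts G" using nbV[of v x] assms by (simp add: nb_sym[of v])
  then show ?thesis
  proof (cases rule: deg_cases)
    case 1
    from card_2_elem[OF 1 assms(1)] obtain a where "nb G v = {x, a}" by metis
    then show ?thesis using assms(2,3) that(1) by auto
  next
    case 2
    from card_3_elem2[OF 2 assms] show ?thesis using that(2) by metis
  qed
qed

lemma nb_pair:
  assumes "x \<in> nb G v" "y \<in> nb G v" "x \<noteq> y"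
  obtains a where "nb G v = {x, y, a}"
  by (rule nb_eq3'[OF assms]) (use that[of y] that in auto)

lemma nb_three:
  assumes "x \<in> nb G v" "y \<in> nb G v" "z \<in> nb G v" "x \<noteq> y" "x \<noteq> z" "y \<noteq> z"
  shows "nb G v = {x, y, z}"
  by (rule nb_full[OF subcubic_graph, symmetric]) (use assms in auto)

end

section \<open>Complete bipartite subgraphs\<close>

text \<open>A bridge is encoded by the side \<open>B\<close> that it cuts off: edges leaving
  \<open>B\<close> end in \<open>x\<close>, and only \<open>q\<close> sends one.\<close>

locale bridgeless = leafless +
  assumes nobridge: "\<And>q x B. q \<in> B \<Longrightarrow> x \<notin> B \<Longrightarrow> x \<in> nb G q \<Longrightarrow> B \<subseteq> verts G \<Longrightarrow>
    (\<And>u. u \<in> B \<Longrightarrow> nb G u \<subseteq> insert x B) \<Longrightarrow> (\<And>u. u \<in> B \<Longrightarrow> x \<in> nb G u \<Longrightarrow> u = q) \<Longrightarrow> False"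
begin

lemma K23_adjacent:
  assumes p: "nb G p = {a, b, c}" and q: "nb G q = {a, b, c}"
    and d: "p \<noteq> q" "a \<noteq> b" "a \<noteq> c" "b \<noteq> c" and ab: "b \<in> nb G a"
  shows "cov G {} (beta G)"
proof -
  have in_nb: "p \<in> nb G a" "q \<in> nb G a" "p \<in> nb G b" "q \<in> nb G b" "p \<in> nb G c" "q \<in> nb G c" "a \<in> nb G b"
    using p q ab by (auto simp: nb_sym[of p] nb_sym[of q] nb_sym[of a G b])
  note V = in_nb[THEN nbV] in_nb[THEN nb_ne]
  have "b \<in> verts G" "c \<in> verts G" using p nbV[of b p] nbV[of c p] by simp_all
  have pb: "p \<noteq> b" "q \<noteq> b" "p \<noteq> c" "q \<noteq> c" "p \<noteq> a" "q \<noteq> a" using V by auto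
  have a: "nb G a = {p, q, b}"
    by (rule nb_three) (use in_nb ab d(1) pb in auto)
  have b: "nb G b = {p, q, a}"
    by (rule nb_three) (use in_nb d(1) pb in auto)
  obtain r where c: "nb G c = {p, q, r}" by (rule nb_pair[OF in_nb(5,6) d(1)])
  show ?thesis
    by (rule reduce[where ms = "[(p, c), (q, a)]" and us = "[b]" and
        Es = "[{p, a}, {p, b}, {p, c}, {q, a}, {q, b}, {q, c}, {a, b}, {c, r}]"])
      (use d pb V \<open>b \<in> verts G\<close> \<open>c \<in> verts G\<close> in \<open>simp_all add: touched_def doubleton_eq_iff a b c p q\<close>)
qed

lemma K23_deg2:
  assumes p: "nb G p = {a, b, c}" and q: "nb G q = {a, b, c}"
    and d: "p \<noteq> q" "a \<noteq> b" "a \<noteq> c" "b \<noteq> c" and c: "nb G c = {p, q}"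
  shows "cov G {} (beta G)"
proof -
  have in_nb: "p \<in> nb G a" "q \<in> nb G a" "p \<in> nb G b" "q \<in> nb G b" "p \<in> nb G c" "q \<in> nb G c"
    using p q by (auto simp: nb_sym[of p] nb_sym[of q])
  note V = in_nb[THEN nbV] in_nb[THEN nb_ne] nbV[of a p] nbV[of b p] nbV[of c p]
  obtain r where a: "nb G a = {p, q, r}"
    by (rule nb_pair[OF in_nb(1,2) d(1)])
  obtain s where b: "nb G b = {p, q, s}"
    by (rule nb_pair[OF in_nb(3,4) d(1)])
  show ?thesis
    by (rule reduce[where ms = "[(p, a), (q, b)]" and us = "[c]" and
        Es = "[{p, a}, {p, b}, {p, c}, {q, a}, {q, b}, {q, c}, {a, r}, {b, s}]"])
      (use d V in \<open>simp_all add: touched_def doubleton_eq_iff a b c p q\<close>)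
qed

lemma K23_join:
  assumes p: "nb G p = {a, b, c}" and q: "nb G q = {a, b, c}"
    and d: "p \<noteq> q" "a \<noteq> b" "a \<noteq> c" "b \<noteq> c"
    and a: "nb G a = {p, q, r}" and b: "nb G b = {p, q, s}" and c: "nb G c = {p, q, t}"
    and r: "r \<notin> {p, q, a, b, c}" "s \<notin> {p, q, a, b, c}" "t \<notin> {p, q, a, b, c}" "r \<noteq> s" "r \<notin> nb G s"
  shows "cov G {} (beta G)"
proof -
  let ?S = "{p, a, q, b, c}" let ?K = "del G ?S"
  have V: "p \<in> verts G" "q \<in> verts G" "a \<in> verts G" "b \<in> verts G" "c \<in> verts G" "r \<in> verts G" "s \<in> verts G" "t \<in> verts G"
    using a p b c nbV[of _ a] nbV[of _ b] nbV[of _ c] nbV[of _ p] by auto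
  have pq: "p \<noteq> a" "p \<noteq> b" "p \<noteq> c" "q \<noteq> a" "q \<noteq> b" "q \<noteq> c"
    using nb_ne[of _ p] nb_ne[of _ q] p q by auto
  have in_nb: "a \<in> nb G r" "b \<in> nb G s" "c \<in> nb G t" using a b c by (auto simp: nb_sym[of a] nb_sym[of b] nb_sym[of c])
  have SK: "simple_graph ?K" by (rule simple_del[OF simple])
  have RK: "r \<in> verts ?K" "s \<in> verts ?K" using V r by auto
  have S1: "simple_graph (add ?K r s)" by (rule simple_add[OF SK r(4) RK])
  have nb1: "nb (add ?K r s) u = (if u = r then insert s (nb ?K u) else if u = s then insert r (nb ?K u) else nb ?K u)" for u
    by (rule nb_add[OF r(4)])
  have nbK: "nb ?K u = nb G u - {a, b, c}" if "u \<notin> ?S" for u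
  proof -
    have "p \<notin> nb G u" "q \<notin> nb G u" using that p q nb_sym[of p G u] nb_sym[of q G u] by auto
    then show ?thesis using that by (auto simp: nb_del)
  qed
  have cK: "card (nb ?K u) < card (nb G u)" if "u \<notin> ?S" "nb G u \<inter> {a, b, c} \<noteq> {}" for u
    by (rule psubset_card_mono[OF finite_nb[OF simple]]) (use that nbK in auto)
  have "subcubic_graph (add ?K r s)"
    unfolding subcubic_graph_def
  proof (intro conjI allI S1)
    fix u
    have "card (nb ?K u) \<le> card (nb G u)"
      by (rule card_mono[OF finite_nb[OF simple]]) (auto simp: nb_del)
    moreover have "card (nb ?K r) < card (nb G r)" "card (nb ?K s) < card (nb G s)"
      using cK[of r] cK[of s] r in_nb by auto
    ultimately show "card (nb (add ?K r s) u) \<le> 3"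
      using subcubic_graph_card[OF subcubic_graph, of u] finite_nb[OF SK, of u] by (auto simp: nb1 card_insert_if)
  qed
  moreover have "no_cubic_part (add ?K r s)"
  proof (rule ccontr)
    assume n: "\<not> no_cubic_part (add ?K r s)"
    have "no_cubic_part ?K" by (rule no_cubic_part_delete) (use V in auto)
    from no_cubic_part_add[OF this r(4) n] obtain U where U: "U \<subseteq> verts G - ?S" "r \<in> U" "s \<in> U"
      "\<And>u. u \<in> U \<Longrightarrow> nb (add ?K r s) u \<subseteq> U" "\<And>u. u \<in> U \<Longrightarrow> card (nb (add ?K r s) u) = 3"
      by auto
    \<comment> \<open>\<open>t\<close> has lost \<open>c\<close>. If it coincides with
      \<open>r\<close> or \<open>s\<close>, it has lost two neighbours and gained one. In either
      case its degree is below three.\<close>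
    have tU: "t \<notin> U"
    proof
      assume t: "t \<in> U"
      have three: "card (nb (add ?K r s) t) = 3" using U(5)[OF t] .
      have "card (nb ?K t) \<le> 2" using cK[of t] r(3) in_nb subcubic_graph_card[OF subcubic_graph, of t] by auto
      with three have "t = r \<or> t = s" by (auto simp: nb1 split: if_splits)
      then have two: "{c, if t = r then a else b} \<subseteq> nb G t" using in_nb by auto
      have "nb ?K t \<subseteq> nb G t - {c, if t = r then a else b}" using r(3) nbK[of t] by auto
      then have "card (nb ?K t) \<le> card (nb G t - {c, if t = r then a else b})"
        by (rule card_mono[rotated]) (simp add: finite_nb[OF simple])
      also have "\<dots> = card (nb G t) - 2"
        using two d by (subst card_Diff_subset) auto
      finally have "card (nb ?K t) \<le> 1" using subcubic_graph_card[OF subcubic_graph, of t] by simp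
      then have "card (nb (add ?K r s) t) \<le> 2"
        using finite_nb[OF SK, of t] by (auto simp: nb1 card_insert_if)
      with three show False by simp
    qed
    \<comment> \<open>In \<open>G\<close> the part \<open>U\<close> is attached to the rest only
      through \<open>a\<close> and \<open>b\<close>, so what remains outside \<open>U\<close> and
      the five vertices hangs on the edge \<open>ct\<close> alone.\<close>
    let ?B = "verts G - U - ?S"
    have out: "nb G u \<subseteq> insert c ?B" if u: "u \<in> ?B" for u
    proof
      fix w assume w: "w \<in> nb G u"
      then have uw: "u \<in> nb G w" by (simp add: nb_sym)
      have "w \<noteq> p" "w \<noteq> q" using uw u p q by auto
      have "w \<noteq> a" "w \<noteq> b" using uw u a b U by auto
      have "w \<notin> U"
      proof
        assume wU: "w \<in> U"
        with U(1) have "w \<notin> ?S" by auto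
        then have "u \<in> nb ?K w" using uw u by (auto simp: nb_del)
        then have "u \<in> nb (add ?K r s) w" by (auto simp: nb1)
        with U(4)[OF wU] u show False by auto
      qed
      with w \<open>w \<noteq> p\<close> \<open>w \<noteq> q\<close> \<open>w \<noteq> a\<close> \<open>w \<noteq> b\<close> show "w \<in> insert c ?B"
        by (auto dest: nbV)
    qed
    show False
    proof (rule nobridge[of t ?B c])
      show "u = t" if "u \<in> ?B" "c \<in> nb G u" for u
        using that c by (auto simp: nb_sym[of c])
    qed (use V r tU in_nb out in auto)
  qed
  moreover have "verts (add ?K r s) \<subset> verts G" using V by auto
  ultimately have "cov (add ?K r s) {} (budget (add ?K r s))" by (intro cov_IH)
  then have c1: "cov (add ?K r s) {} (beta (add ?K r s))" by (rule cov_mono[OF _ order_refl budget_le])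
  have "beta (del G (set [p, a, q, b, c])) \<le> beta G - 4 * int (length [p, a, q, b, c]) +
      int (length [{p, a}, {p, b}, {p, c}, {q, a}, {q, b}, {q, c}, {a, r}, {b, s}, {c, t}])"
    by (rule beta_del_list[OF simple])
      (use d pq V in \<open>simp_all add: touched_def doubleton_eq_iff a b c p q\<close>)
  moreover have "beta (add ?K r s) = beta ?K - 1"
    by (rule beta_add[OF SK]) (use r in \<open>auto simp: nb_del nb_sym[of s]\<close>)
  ultimately have bb: "beta (add ?K r s) \<le> beta G - 12" by simp
  show ?thesis
  proof (rule cov_add[OF SK r(4) RK c1])
    \<comment> \<open>The edge \<open>rs\<close> is traded for \<open>ar\<close>, \<open>bs\<close>
      and \<open>pc\<close>, a net increase of two edges. The neighbours \<open>a\<close>,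
      \<open>b\<close>, \<open>c\<close> of \<open>q\<close> are covered, so \<open>q\<close> is
      skipped.\<close>
    assume "cov (del ?K {r, s}) ({} - {r, s}) (beta (add ?K r s) - 6)"
    then have "cov (del G (set (ends [(a, r), (b, s), (p, c)]) \<union> {q})) {} (beta (add ?K r s) - 6)"
      by (simp add: del_del insert_commute)
    then have "cov G ({} \<union> set (ends [(a, r), (b, s), (p, c)])) (beta G)"
      by (rule cov_reduce[OF simple, rotated 4])
        (use d pq r bb in \<open>auto simp: a b p q\<close>)
    then show ?thesis by (rule cov_mono) auto
  next
    \<comment> \<open>With \<open>r\<close> covered, \<open>a\<close> may be skipped after matching
      \<open>p\<close> and \<open>q\<close> to \<open>b\<close> and \<open>c\<close>; with
      \<open>s\<close> covered, the roles of \<open>a\<close> and \<open>b\<close> are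
      exchanged.\<close>
    fix i assume i: "i \<in> {r, s}" "cov ?K {i} (beta (add ?K r s))"
    then consider "i = r" | "i = s" by auto
    then show ?thesis
    proof cases
      case 1
      with i have "cov (del G (set (ends [(p, b), (q, c)]) \<union> {a})) {r} (beta (add ?K r s))"
        by (simp add: insert_commute)
      then have "cov G ({r} \<union> set (ends [(p, b), (q, c)])) (beta G)"
        by (rule cov_reduce[OF simple, rotated 4]) (use d pq r bb in \<open>auto simp: a p q\<close>)
      then show ?thesis by (rule cov_mono) auto
    next
      case 2
      with i have "cov (del G (set (ends [(p, a), (q, c)]) \<union> {b})) {s} (beta (add ?K r s))"
        by (simp add: insert_commute)
      then have "cov G ({s} \<union> set (ends [(p, a), (q, c)])) (beta G)"
        by (rule cov_reduce[OF simple, rotated 4]) (use d pq r bb in \<open>auto simp: b p q\<close>)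
      then show ?thesis by (rule cov_mono) auto
    qed
  qed
qed

text \<open>All neighbours of \<open>r\<close> are known, so the seven vertices can be left only
  through \<open>t\<close>. Either \<open>t\<close> has no further neighbour and the set is closed,
  or its third edge is a bridge.\<close>

lemma K23_two_equal:
  assumes p: "nb G p = {a, b, c}" and q: "nb G q = {a, b, c}"
    and d: "p \<noteq> q" "a \<noteq> b" "a \<noteq> c" "b \<noteq> c"
    and a: "nb G a = {p, q, r}" and b: "nb G b = {p, q, r}" and c: "nb G c = {p, q, t}"
    and r: "r \<notin> {p, q, a, b, c}" "t \<notin> {p, q, a, b, c}" "r \<noteq> t" "r \<in> nb G t"
  shows "cov G {} (beta G)"
proof -
  have V: "p \<in> verts G" "q \<in> verts G" "a \<in> verts G" "b \<in> verts G" "c \<in> verts G" "r \<in> verts G" "t \<in> verts G"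
    using a p b c nbV[of _ a] nbV[of _ b] nbV[of _ c] nbV[of _ p] by auto
  have pq: "p \<noteq> a" "p \<noteq> b" "p \<noteq> c" "q \<noteq> a" "q \<noteq> b" "q \<noteq> c"
    using nb_ne[of _ p] nb_ne[of _ q] p q by auto
  have in_nb: "a \<in> nb G r" "b \<in> nb G r" "c \<in> nb G t" "t \<in> nb G r"
    using a b c r(4) by (auto simp: nb_sym[of a] nb_sym[of b] nb_sym[of c] nb_sym[of t])
  have nr: "nb G r = {a, b, t}"
    by (rule nb_three) (use in_nb d r in auto)
  have "c \<noteq> r" using r by auto
  from nb_eq3'[OF in_nb(3) r(4) this] show ?thesis
  proof cases
    case 1
    show ?thesis
      by (rule reduce[where ms = "[(p, a), (q, b), (r, t)]" and us = "[c]" and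
          Es = "[{p, a}, {p, b}, {p, c}, {q, a}, {q, b}, {q, c}, {a, r}, {b, r}, {c, t}, {r, t}]"])
        (use d pq V r in \<open>auto simp: touched_def doubleton_eq_iff a b c p q nr 1\<close>)
  next
    case (2 u)
    have tu: "t \<in> nb G u" using 2 by (auto simp: nb_sym[of t])
    have u: "u \<notin> {p, q, a, b, c, r, t}"
      using tu a b c p q nr r 2 d pq nb_ne[OF tu] by auto
    let ?B = "{p, q, a, b, c, r, t}"
    have B: "\<forall>w\<in>?B. nb G w \<subseteq> insert u ?B \<and> (u \<in> nb G w \<longrightarrow> w = t)"
      using u by (simp add: a b c p q nr 2(1))
    have False
    proof (rule nobridge[of t ?B u])
      show "u \<notin> ?B" by (rule u)
      show "u \<in> nb G t" using 2(1) by simp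
      show "?B \<subseteq> verts G" using V by simp
      show "nb G w \<subseteq> insert u ?B" if "w \<in> ?B" for w using B that by blast
      show "w = t" if "w \<in> ?B" "u \<in> nb G w" for w using B that by blast
    qed simp
    then show ?thesis ..
  qed
qed

text \<open>The eight vertices are closed, with twelve edges, and three matching edges dominate them
  all.\<close>

lemma K23_triangle:
  assumes p: "nb G p = {a, b, c}" and q: "nb G q = {a, b, c}"
    and d: "p \<noteq> q" "a \<noteq> b" "a \<noteq> c" "b \<noteq> c"
    and a: "nb G a = {p, q, r}" and b: "nb G b = {p, q, s}" and c: "nb G c = {p, q, t}"
    and r: "r \<notin> {p, q, a, b, c}" "s \<notin> {p, q, a, b, c}" "t \<notin> {p, q, a, b, c}" "r \<noteq> s" "r \<noteq> t" "s \<noteq> t"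
      "r \<in> nb G s" "r \<in> nb G t" "s \<in> nb G t"
  shows "cov G {} (beta G)"
proof -
  have V: "p \<in> verts G" "q \<in> verts G" "a \<in> verts G" "b \<in> verts G" "c \<in> verts G" "r \<in> verts G" "s \<in> verts G" "t \<in> verts G"
    using a p b c nbV[of _ a] nbV[of _ b] nbV[of _ c] nbV[of _ p] by auto
  have pq: "p \<noteq> a" "p \<noteq> b" "p \<noteq> c" "q \<noteq> a" "q \<noteq> b" "q \<noteq> c"
    using nb_ne[of _ p] nb_ne[of _ q] p q by auto
  have in_nb: "a \<in> nb G r" "b \<in> nb G s" "c \<in> nb G t" "s \<in> nb G r" "t \<in> nb G r" "t \<in> nb G s"
    using a b c r by (auto simp: nb_sym[of a] nb_sym[of b] nb_sym[of c] nb_sym[of t] nb_sym[of s G r])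
  have nr: "nb G r = {a, s, t}"
    by (rule nb_three) (use in_nb r in auto)
  have ns: "nb G s = {b, r, t}"
    by (rule nb_three) (use in_nb r in auto)
  have nt: "nb G t = {c, r, s}"
    by (rule nb_three) (use in_nb r in auto)
  show ?thesis
    by (rule reduce[where ms = "[(p, b), (q, c), (r, t)]" and us = "[a, s]" and
        Es = "[{p, a}, {p, b}, {p, c}, {q, a}, {q, b}, {q, c}, {a, r}, {b, s}, {c, t}, {r, s}, {r, t}, {s, t}]"])
      (use d pq V r in \<open>auto simp: touched_def doubleton_eq_iff a b c p q nr ns nt\<close>)
qed

lemma K23:
  assumes pq: "p \<noteq> q" "nb G p = nb G q" "card (nb G p) = 3"
    and K33: "\<And>r. nb G r = nb G p \<Longrightarrow> r = p \<or> r = q"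
  shows "cov G {} (beta G)"
proof -
  from pq(3) obtain a b c where p: "nb G p = {a, b, c}" and d: "a \<noteq> b" "a \<noteq> c" "b \<noteq> c"
    by (auto simp: card_3_iff)
  have q: "nb G q = {a, b, c}" using p pq by simp
  have in_nb: "p \<in> nb G a" "q \<in> nb G a" "p \<in> nb G b" "q \<in> nb G b" "p \<in> nb G c" "q \<in> nb G c"
    using p q by (auto simp: nb_sym[of p] nb_sym[of q])
  have perm: "{a, b, c} = {a, c, b}" "{a, b, c} = {b, c, a}" by auto
  show ?thesis
  proof (cases "b \<in> nb G a \<or> c \<in> nb G a \<or> c \<in> nb G b")
    case True
    then show ?thesis
      using K23_adjacent[OF p q pq(1)] K23_adjacent[OF p[unfolded perm(1)] q[unfolded perm(1)] pq(1)]
        K23_adjacent[OF p[unfolded perm(2)] q[unfolded perm(2)] pq(1)] d by metis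
  next
    case nadj: False
    show ?thesis
    proof (cases "nb G a = {p, q} \<or> nb G b = {p, q} \<or> nb G c = {p, q}")
      case True
      have perm3: "{a, b, c} = {c, b, a}" by auto
      from True show ?thesis
        using K23_deg2[OF p q pq(1)] K23_deg2[OF p[unfolded perm(1)] q[unfolded perm(1)] pq(1)]
          K23_deg2[OF p[unfolded perm3] q[unfolded perm3] pq(1)] d by metis
    next
      case False
      obtain r where a: "nb G a = {p, q, r}" "r \<noteq> p" "r \<noteq> q"
        by (rule nb_eq3'[OF in_nb(1,2) pq(1)]) (use False in auto)
      obtain s where b: "nb G b = {p, q, s}" "s \<noteq> p" "s \<noteq> q"
        by (rule nb_eq3'[OF in_nb(3,4) pq(1)]) (use False in auto)
      obtain t where c: "nb G c = {p, q, t}" "t \<noteq> p" "t \<noteq> q"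
        by (rule nb_eq3'[OF in_nb(5,6) pq(1)]) (use False in auto)
      have r: "r \<notin> {p, q, a, b, c}" "s \<notin> {p, q, a, b, c}" "t \<notin> {p, q, a, b, c}"
        using a b c nadj nb_ne[of _ a] nb_ne[of _ b] nb_ne[of _ c]
          nb_sym[of a G b] nb_sym[of a G c] nb_sym[of b G c] by auto
      have in2: "a \<in> nb G r" "b \<in> nb G s" "c \<in> nb G t"
        using a b c by (auto simp: nb_sym[of a] nb_sym[of b] nb_sym[of c])
      show ?thesis
      proof (cases "r \<noteq> s \<and> r \<notin> nb G s \<or> r \<noteq> t \<and> r \<notin> nb G t \<or> s \<noteq> t \<and> s \<notin> nb G t")
        case True
        then consider "r \<noteq> s" "r \<notin> nb G s" | "r \<noteq> t" "r \<notin> nb G t" | "s \<noteq> t" "s \<notin> nb G t" by blast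
        then show ?thesis
        proof cases
          case 1
          show ?thesis by (rule K23_join[OF p q pq(1) d a(1) b(1) c(1) r 1])
        next
          case 2
          show ?thesis
            by (rule K23_join[OF p[unfolded perm(1)] q[unfolded perm(1)] pq(1) d(2,1) d(3)[symmetric] a(1) c(1) b(1)])
              (use r 2 in auto)
        next
          case 3
          show ?thesis
            by (rule K23_join[OF p[unfolded perm(2)] q[unfolded perm(2)] pq(1) d(3) d(1,2)[symmetric] b(1) c(1) a(1)])
              (use r 3 in auto)
        qed
      next
        case False
        \<comment> \<open>Otherwise \<open>r\<close> would be a third vertex with neighbourhood
          \<open>{a, b, c}\<close>, which is the excluded graph with parts of size three.\<close>
        have notall: "\<not> (r = s \<and> s = t)"
        proof
          assume "r = s \<and> s = t"
          then have "{a, b, c} \<subseteq> nb G r" using in2 by auto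
          then have "{a, b, c} = nb G r" by (rule nb_full[OF subcubic_graph]) (use d in simp)
          with K33[of r] p a show False by auto
        qed
        consider "r = s" "r \<noteq> t" | "r = t" "r \<noteq> s" | "s = t" "r \<noteq> s" | "r \<noteq> s" "r \<noteq> t" "s \<noteq> t"
          using notall by blast
        then show ?thesis
        proof cases
          case 1
          show ?thesis
            by (rule K23_two_equal[OF p q pq(1) d a(1) _ c(1)]) (use r 1 False b in auto)
        next
          case 2
          show ?thesis
            by (rule K23_two_equal[OF p[unfolded perm(1)] q[unfolded perm(1)] pq(1) d(2,1) d(3)[symmetric] a(1) _ b(1)])
              (use r 2 False c in auto)
        next
          case 3
          show ?thesis
            by (rule K23_two_equal[OF p[unfolded perm(2)] q[unfolded perm(2)] pq(1) d(3) d(1,2)[symmetric] b(1) _ a(1)])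
              (use r 3 False c nb_sym[of r G s] in auto)
        next
          case 4
          show ?thesis
            by (rule K23_triangle[OF p q pq(1) d a(1) b(1) c(1) r 4]) (use 4 False in auto)
        qed
      qed
    qed
  qed
qed

end

section \<open>Covering a vertex of degree two\<close>

text \<open>The gadget only exchanges neighbours: \<open>q\<close> loses \<open>s\<close> for
  \<open>j\<close>, and \<open>j\<close> loses \<open>p\<close> for \<open>q\<close>.\<close>

lemma card_nb_gadget:
  assumes G: "simple_graph G" and e: "p \<in> nb G s" "q \<in> nb G s" "j \<in> nb G p"
    and d: "q \<noteq> j" "q \<noteq> p" "j \<noteq> s"
  shows "card (nb (add (del G {s, p}) q j) z) \<le> card (nb G z)"
proof -
  have fin: "finite (nb G u)" for u by (rule finite_nb[OF G])
  have less: "card (insert i (nb G u - {s, p})) \<le> card (nb G u)" if "s \<in> nb G u \<or> p \<in> nb G u" for i u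
  proof -
    have "card (nb G u - {s, p}) < card (nb G u)"
      by (rule psubset_card_mono[OF fin]) (use that in auto)
    then show ?thesis using fin by (simp add: card_insert_if)
  qed
  have "s \<in> nb G q" "p \<in> nb G j" using e by (simp_all add: nb_sym[of s] nb_sym[of p G j])
  moreover have "q \<noteq> s" "j \<noteq> p" using e nb_irrefl[OF G] by auto
  moreover have "card (nb G z - {s, p}) \<le> card (nb G z)" by (rule card_mono[OF fin]) auto
  ultimately show ?thesis
    using less[of q j] less[of j q] d by (cases "z = q"; cases "z = j") (simp_all add: nb_add nb_del)
qed

text \<open>The second alternative of the last conjunct is the triangle case: one unit is missing, but
  \<open>q\<close> has become a leaf, for which the budget gives that unit back.\<close>

definition reduces :: "'a ugraph \<Rightarrow> 'a \<Rightarrow> 'a \<Rightarrow> 'a \<Rightarrow> 'a ugraph \<Rightarrow> bool" where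
  "reduces H x p q H' \<longleftrightarrow> subcubic_graph H' \<and> no_cubic_part H' \<and> verts H' = verts H - {x, p} \<and>
    (\<forall>z. card (nb H' z) \<le> card (nb H z)) \<and>
    (\<forall>X b. cov H' X b \<longrightarrow> cov H (insert x (insert p X)) (b + 6)) \<and>
    (beta H' \<le> beta H - 5 \<or> q \<in> nb H p \<and> card (nb H' q) \<le> 1 \<and> beta H' \<le> beta H - 4)"

lemma reduces_del:
  assumes H: "subcubic_graph H" "no_cubic_part H" and x: "p \<in> nb H x"
    and b: "beta (del H {x, p}) \<le> beta H - 5 \<or>
      q \<in> nb H p \<and> card (nb (del H {x, p}) q) \<le> 1 \<and> beta (del H {x, p}) \<le> beta H - 4"
  shows "reduces H x p q (del H {x, p})"
  unfolding reduces_def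
proof (intro conjI allI impI subcubic_graph_del[OF H(1)] no_cubic_part_del[OF H] b)
  note S = subcubic_graph_simple[OF H(1)]
  show "card (nb (del H {x, p}) z) \<le> card (nb H z)" for z
    by (rule card_mono[OF finite_nb[OF S]]) (auto simp: nb_del)
  show "cov H (insert x (insert p X)) (b + 6)" if c: "cov (del H {x, p}) X b" for X b
  proof -
    have "cov H (X \<union> set (ends [(x, p)])) (b + 6)"
      by (rule cov_reduce[OF S, where b = b and U = "{}"]) (use x c nb_irrefl[OF S] in auto)
    then show ?thesis by (rule cov_mono) auto
  qed
qed simp

lemma card2_pair:
  assumes "finite A" "card A \<le> 2" "x \<in> A"
  obtains a where "A \<subseteq> {x, a}"
proof -
  have "finite (A - {x})" "card (A - {x}) \<le> 1" using assms by simp_all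
  then show thesis by (rule card_le_1_cases) (use that in blast)+
qed

text \<open>If \<open>p\<close> or \<open>q\<close> has degree at most two, deleting
  \<open>x\<close> and that neighbour loses 3 edges: -8 + 3 = -5. If \<open>p\<close> and
  \<open>q\<close> are adjacent, it is -8 + 4, with \<open>q\<close> left as a leaf. Otherwise the
  gadget gives -8 + 4 - 1. The gadget needs a neighbour of \<open>p\<close> not adjacent to
  \<open>q\<close>, and only equal neighbourhoods prevent that.\<close>

lemma step_or_bridge:
  assumes H: "subcubic_graph H" "no_cubic_part H" and x: "nb H x = {p, q}" "p \<noteq> q"
    and nK: "nb H p = nb H q \<longrightarrow> card (nb H p) \<noteq> 3"
  obtains (step) p' q' H' where "{p', q'} = {p, q}" "reduces H x p' q' H'"
  | (bridge) B where "q \<in> B" "B \<subseteq> verts H - {x, p}" "\<And>u. u \<in> B \<Longrightarrow> nb H u \<subseteq> insert x B"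
    "\<And>u. u \<in> B \<Longrightarrow> card (nb H u) = 3"
proof -
  note S = subcubic_graph_simple[OF H(1)]
  have xin: "p \<in> nb H x" "q \<in> nb H x" "x \<in> nb H p" "x \<in> nb H q"
    using x by (auto simp: nb_sym[of x])
  note V = xin[THEN nb_verts[OF S]]
  have ne: "p \<noteq> x" "q \<noteq> x" using xin nb_irrefl[OF S] by auto
  have small: "reduces H x a b (del H {x, a})" if ab: "{a, b} = {p, q}" and c: "card (nb H a) \<le> 2" for a b
  proof -
    have a: "x \<in> nb H a" "a \<in> nb H x" "nb H x = {a, b}" "a \<noteq> x" using ab x xin ne by (auto simp: doubleton_eq_iff)
    obtain c where c: "nb H a \<subseteq> {x, c}" by (rule card2_pair[OF finite_nb[OF S] c a(1)])
    have "beta (del H (set [x, a])) \<le> beta H - 4 * int (length [x, a]) + int (length [{x, a}, {x, b}, {a, c}])"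
      by (rule beta_del_list[OF S]) (use a V nb_verts[OF S a(1)] c in \<open>auto simp: touched_def doubleton_eq_iff\<close>)
    then show ?thesis by (intro reduces_del[OF H a(2)]) simp
  qed
  show thesis
  proof (cases "card (nb H p) \<le> 2 \<or> card (nb H q) \<le> 2")
    case True
    then show thesis using small[of p q] small[of q p] step by (metis insert_commute)
  next
    case False
    then have c3: "card (nb H p) = 3" "card (nb H q) = 3"
      using subcubic_graph_card[OF H(1), of p] subcubic_graph_card[OF H(1), of q] by linarith+
    show thesis
    proof (cases "q \<in> nb H p")
      case True
      from card_3_elem2[OF c3(1) xin(3) True ne(2)[symmetric]] obtain c where c: "nb H p = {x, q, c}" by metis
      have "beta (del H (set [x, p])) \<le> beta H - 4 * int (length [x, p]) + int (length [{x, p}, {x, q}, {p, q}, {p, c}])"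
        by (rule beta_del_list[OF S]) (use x ne V c in \<open>auto simp: touched_def doubleton_eq_iff\<close>)
      moreover have "card (nb (del H {x, p}) q) \<le> 1"
      proof -
        have "{x, p} \<subseteq> nb H q" using xin True by (auto simp: nb_sym[of p])
        then have "card (nb H q - {x, p}) = 1" using c3 ne by (subst card_Diff_subset) auto
        then show ?thesis using x(2) ne by (simp add: nb_del)
      qed
      ultimately show thesis
        by (intro step[of p q "del H {x, p}"] reduces_del[OF H xin(1)]) (use True in auto)
    next
      case nadj: False
      from card_3_elem[OF c3(1) xin(3)] obtain p1 p2 where p: "nb H p = {x, p1, p2}" "p1 \<noteq> p2" "p1 \<noteq> x" "p2 \<noteq> x" by metis
      have q: "q \<noteq> p1" "q \<noteq> p2" using nadj p by auto
      have nq: "\<not> (q \<in> nb H p1 \<and> q \<in> nb H p2)"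
      proof
        assume "q \<in> nb H p1 \<and> q \<in> nb H p2"
        then have "nb H p \<subseteq> nb H q" using p xin by (auto simp: nb_sym[of q])
        then have "nb H p = nb H q" by (rule nb_full[OF H(1) _ c3(1)])
        with nK c3 show False by simp
      qed
      show thesis
      proof (cases rule: gadget_or_bridge[OF H x(1) p(1) x(2) p(2-4) q nq, case_names gadget bridge])
        case (gadget i)
        let ?K = "add (del H {x, p}) q i"
        have i: "i \<in> nb H p" "q \<noteq> i" "i \<noteq> x" "p \<in> nb H i" "i \<noteq> p"
          using gadget(1) p q nb_irrefl[OF S, of p] by (auto simp: nb_sym[of p H])
        have SK: "simple_graph ?K"
          by (rule simple_add[OF simple_del[OF S] i(2)]) (use i V x(2) ne nb_verts[OF S i(1)] in auto)
        have le: "card (nb ?K z) \<le> card (nb H z)" for z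
          by (rule card_nb_gadget[OF S xin(1,2) i(1,2) x(2)[symmetric] i(3)])
        have "beta (del H (set [x, p])) \<le> beta H - 4 * int (length [x, p]) + int (length [{x, p}, {x, q}, {p, p1}, {p, p2}])"
          by (rule beta_del_list[OF S]) (use x ne V p in \<open>auto simp: touched_def doubleton_eq_iff\<close>)
        moreover have "beta ?K = beta (del H {x, p}) - 1"
          by (rule beta_add[OF simple_del[OF S]]) (use gadget(2) in \<open>auto simp: nb_del nb_sym[of i]\<close>)
        ultimately have "beta ?K \<le> beta H - 5" by simp
        moreover have "subcubic_graph ?K"
          unfolding subcubic_graph_def using SK order_trans[OF le subcubic_graph_card[OF H(1)]] by blast
        moreover have "cov H (insert x (insert p X)) (b + 6)" if "cov ?K X b" for X b
          by (rule cov_gadget[OF S xin(1,2) i(1,2) x(2)[symmetric] i(3) that]) simp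
        ultimately have "reduces H x p q ?K"
          unfolding reduces_def using gadget(3) le by simp
        then show thesis by (intro step[of p q]) auto
      next
        case (bridge B)
        then show thesis by (rule that(2))
      qed
    qed
  qed
qed

locale k23_free = bridgeless +
  assumes no_K23: "\<And>p q. p \<noteq> q \<Longrightarrow> nb G p = nb G q \<Longrightarrow> card (nb G p) = 3 \<Longrightarrow> False"
begin

lemma step:
  assumes R: "R \<inter> verts G \<noteq> {}" and x: "nb (del G R) x = {p, q}" "p \<noteq> q"
  obtains p' q' H' where "{p', q'} = {p, q}" "reduces (del G R) x p' q' H'"
proof -
  let ?H = "del G R"
  have H: "subcubic_graph ?H" "no_cubic_part ?H" by (rule subcubic_graph_del[OF subcubic_graph], rule no_cubic_part_delete[OF R])
  have full: "nb ?H u = nb G u" if "card (nb ?H u) = 3" for u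
    by (rule nb_full[OF subcubic_graph _ that]) (auto simp: nb_del)
  have nK: "nb ?H p = nb ?H q \<longrightarrow> card (nb ?H p) \<noteq> 3"
    using no_K23[OF x(2)] full[of p] full[of q] by auto
  have xR: "x \<notin> R" using x by (auto simp: nb_del)
  show thesis
  proof (cases rule: step_or_bridge[OF H x nK, case_names step bridge])
    case (step p' q' H')
    then show thesis by (rule that)
  next
    case (bridge B)
    have xq: "x \<in> nb G q" "q \<in> nb G x" using x(1) by (auto simp: nb_sym[of x] nb_del split: if_splits)
    have BG: "nb ?H u = nb G u" if "u \<in> B" for u by (rule full[OF bridge(4)[OF that]])
    have False
    proof (rule nobridge[of q B x])
      show "nb G u \<subseteq> insert x B" if "u \<in> B" for u using BG[OF that] bridge(3)[OF that] by simp
      show "u = q" if u: "u \<in> B" "x \<in> nb G u" for u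
      proof -
        have "u \<in> nb G x" using u(2) by (simp add: nb_sym)
        moreover have "u \<notin> R" "u \<noteq> p" using bridge(2) u(1) by auto
        ultimately show ?thesis using x(1) xR by (auto simp: nb_del)
      qed
    qed (use bridge xq in auto)
    then show thesis ..
  qed
qed

text \<open>The saving of 5 units against the price 6 of an edge: one unit for covering
  \<open>x\<close> instead of the two in \<open>side\<close>.\<close>

lemma cov_step:
  assumes R: "R \<inter> verts G \<noteq> {}" and x: "nb (del G R) x = {p, q}" "p \<noteq> q"
  shows "cov (del G R) {x} (beta (del G R) + 1)"
proof -
  from step[OF assms] obtain p' q' H' where pq: "{p', q'} = {p, q}" and r: "reduces (del G R) x p' q' H'" by metis
  note r' = r[unfolded reduces_def]
  have S: "simple_graph (del G R)" by (rule simple_del[OF simple])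
  have "cov H' {} (budget H')"
    by (rule cov_IH) (use r' R in auto)
  moreover have "budget H' \<le> beta (del G R) - 5"
  proof (cases "beta H' \<le> beta (del G R) - 5")
    case True
    with budget_le[of H'] show ?thesis by simp
  next
    case False
    then have q: "card (nb H' q') \<le> 1" "beta H' \<le> beta (del G R) - 4" "q' \<in> nb (del G R) p'" using r' by auto
    have "q' \<in> nb (del G R) x" using x pq by auto
    then have "q' \<noteq> p'" "q' \<noteq> x" "q' \<in> verts (del G R)"
      using q(3) nb_irrefl[OF S] nb_verts[OF S] by auto
    then have "q' \<in> verts H'" using r' by auto
    then have "budget H' \<le> beta H' - 1" by (intro budget_leaf) (use r' q in \<open>auto intro: subcubic_graph_simple\<close>)
    with q show ?thesis by simp
  qed
  ultimately have "cov H' {} (beta (del G R) - 5)" by (rule cov_mono[OF _ order_refl])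
  then have "cov (del G R) (insert x (insert p' {})) (beta (del G R) - 5 + 6)" using r' by blast
  then show ?thesis by (rule cov_mono) auto
qed

text \<open>Compared with \<open>reduce\<close>, skipped vertices may also be adjacent to
  \<open>w\<close>, which stays in the graph and is covered there for one unit.\<close>

lemma reduce_step:
  assumes d: "distinct (ends ms @ us)" and V: "set (ends ms @ us) \<subseteq> verts G"
    and e: "list_all (\<lambda>(a, b). b \<in> nb G a) ms"
    and u: "list_all (\<lambda>u. nb G u \<subseteq> {w} \<union> set (ends ms)) us"
    and Es: "list_all (touched G Es) (ends ms @ us)"
    and w: "w \<notin> set (ends ms @ us)" "nb G w - set (ends ms @ us) = {p, q}" "p \<noteq> q"
    and n: "length Es + 1 \<le> 2 * length ms + 4 * length us" "ms \<noteq> []"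
  shows "cov G {} (beta G)"
proof (rule reduce_cov[OF d V e u Es])
  obtain a b ms' where "ms = (a, b) # ms'" using n(2) by (cases ms) auto
  with V have "set (ends ms @ us) \<inter> verts G \<noteq> {}" by auto
  then show "cov (del G (set (ends ms @ us))) {w} (beta (del G (set (ends ms @ us))) + 1)"
    by (rule cov_step) (use w in \<open>auto simp: nb_del\<close>)
qed (use n in auto)

lemma deg2_triangle:
  assumes v: "nb G v = {x, y}" and xy: "y \<in> nb G x"
  shows "cov G {} (beta G)"
proof -
  have in_nb: "v \<in> nb G x" "v \<in> nb G y" "x \<in> nb G y" "x \<in> nb G v" "y \<in> nb G v"
    using v xy by (auto simp: nb_sym[of v] nb_sym[of x G y])
  note V = in_nb[THEN nbV] in_nb[THEN nb_ne] nb_ne[OF xy]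
  obtain a where x: "nb G x = {v, y, a}" by (rule nb_pair[OF in_nb(1) xy]) (use V in auto)
  obtain b where y: "nb G y = {v, x, b}" by (rule nb_pair[OF in_nb(2,3)]) (use V in auto)
  show ?thesis
    by (rule reduce[where ms = "[(x, y)]" and us = "[v]" and Es = "[{v, x}, {v, y}, {x, y}, {x, a}, {y, b}]"])
      (use V in \<open>auto simp: touched_def doubleton_eq_iff v x y\<close>)
qed

text \<open>On the path \<open>x\<close>, \<open>v\<close>, \<open>w\<close>, \<open>z\<close> one
  matches \<open>wz\<close>, covers \<open>x\<close> and skips \<open>v\<close>. This breaks down
  only if the path closes to a triangle or a four-cycle.\<close>

lemma deg2_adjacent:
  assumes v: "nb G v = {x, w}" "x \<noteq> w" and w: "nb G w = {v, z}" "v \<noteq> z"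
  shows "cov G {} (beta G)"
proof (cases "x = z")
  case True
  then have "w \<in> nb G x" using w by (auto simp: nb_sym[of w])
  with v show ?thesis by (intro deg2_triangle)
next
  case xz: False
  have in_nb: "v \<in> nb G x" "w \<in> nb G z" "v \<in> nb G w" "w \<in> nb G v" "x \<in> nb G v" "z \<in> nb G w"
    using v w by (auto simp: nb_sym[of v] nb_sym[of w])
  note V = in_nb[THEN nbV] in_nb[THEN nb_ne]
  show ?thesis
  proof (cases "z \<in> nb G x")
    case True
    then have xz': "x \<in> nb G z" by (simp add: nb_sym)
    obtain x' where x: "nb G x = {v, z, x'}" by (rule nb_pair[OF in_nb(1) True]) (use w in auto)
    from nb_eq3'[OF in_nb(2) xz' v(2)[symmetric]] show ?thesis
    proof cases
      case z: 1
      from nb_eq3'[OF in_nb(1) True w(2)] show ?thesis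
      proof cases
        case 1
        show ?thesis
          by (rule reduce[where ms = "[(v, x), (w, z)]" and us = "[]" and Es = "[{v, x}, {v, w}, {w, z}, {x, z}]"])
            (use V v w xz in \<open>simp_all add: touched_def doubleton_eq_iff z 1\<close>)
      next
        case (2 y)
        have xy: "x \<in> nb G y" "y \<in> nb G x" using 2 by (auto simp: nb_sym[of x])
        have y: "y \<noteq> v" "y \<noteq> w" "y \<noteq> x" "y \<noteq> z" using xy v w z 2 nb_ne[OF xy(1)] xz by auto
        from nb_eq3[OF xy(1)] obtain e f where ef: "nb G y = {x, e, f}" by metis
        show ?thesis
          by (rule reduce[where ms = "[(x, y), (v, w)]" and us = "[z]" and
              Es = "[{v, x}, {v, w}, {w, z}, {x, z}, {x, y}, {y, e}, {y, f}]"])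
            (use V v w xz y nbV[OF xy(2)] in \<open>simp_all add: touched_def doubleton_eq_iff z 2(1) ef\<close>)
      qed
    next
      case (2 y)
      have zy: "z \<in> nb G y" "y \<in> nb G z" using 2 by (auto simp: nb_sym[of z])
      have y: "y \<noteq> v" "y \<noteq> w" "y \<noteq> x" "y \<noteq> z" using zy v w 2 nb_ne[OF zy(1)] xz by auto
      from nb_eq3[OF zy(1)] obtain e f where ef: "nb G y = {z, e, f}" by metis
      show ?thesis
        by (rule reduce[where ms = "[(v, x), (z, y)]" and us = "[w]" and
            Es = "[{v, x}, {v, w}, {w, z}, {x, z}, {x, x'}, {z, y}, {y, e}, {y, f}]"])
          (use V v w xz y nbV[OF zy(2)] in \<open>simp_all add: touched_def doubleton_eq_iff x 2(1) ef\<close>)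
    qed
  next
    case False
    from nb_eq3[OF in_nb(2)] obtain c d where z: "nb G z = {w, c, d}" by metis
    from V(5) have "x \<in> verts G" .
    then show ?thesis
    proof (cases rule: deg_cases)
      case 1
      from card_2_elem[OF 1 in_nb(1)] obtain p where x: "nb G x = {v, p}" "p \<noteq> v" by metis
      have px: "x \<in> nb G p" "p \<in> nb G x" using x by (auto simp: nb_sym[of x])
      have p: "p \<noteq> v" "p \<noteq> w" "p \<noteq> x" "p \<noteq> z" 
      proof -
        have "w \<notin> nb G x" using w(1) V xz by (auto simp: nb_sym[of w])
        with px(2) False x(2) nb_ne[OF px(2)] show "p \<noteq> v" "p \<noteq> w" "p \<noteq> x" "p \<noteq> z" by auto
      qed
      from nb_eq3[OF px(1)] obtain e f where ef: "nb G p = {x, e, f}" by metis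
      show ?thesis
        by (rule reduce[where ms = "[(w, z), (x, p)]" and us = "[v]" and
            Es = "[{v, x}, {v, w}, {w, z}, {z, c}, {z, d}, {x, p}, {p, e}, {p, f}]"])
          (use V v w xz p nbV[OF px(2)] in \<open>simp_all add: touched_def doubleton_eq_iff x(1) z ef\<close>)
    next
      case 2
      from card_3_elem[OF 2 in_nb(1)] obtain p q where x: "nb G x = {v, p, q}" "p \<noteq> q" "p \<noteq> v" "q \<noteq> v" by metis
      have "w \<notin> nb G x" using w V xz by (auto simp: nb_sym[of w])
      with x False have pq: "p \<noteq> w" "q \<noteq> w" "p \<noteq> z" "q \<noteq> z" by auto
      show ?thesis
        by (rule reduce_step[where ms = "[(w, z)]" and us = "[v]" and w = x and p = p and q = q and
            Es = "[{v, x}, {v, w}, {w, z}, {z, c}, {z, d}]"])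
          (use V v w xz pq x(2-4) in \<open>simp_all add: touched_def doubleton_eq_iff x(1) z\<close>)
    qed
  qed
qed

end

section \<open>The neighbourhood of a vertex of degree two\<close>

context k23_free
begin

lemma common_triangle:
  assumes v: "nb G v = {x, y}" and x: "nb G x = {v, w, q}" and y: "nb G y = {v, w, b}" and w: "nb G w = {x, y, q}"
    and d: "x \<noteq> y" "q \<noteq> v" "q \<noteq> w" "b \<noteq> v" "b \<noteq> w" "q \<noteq> y" "b \<noteq> x" "q \<noteq> b" "w \<noteq> v"
  shows "cov G {} (beta G)"
proof -
  have in_nb: "x \<in> nb G v" "y \<in> nb G v" "v \<in> nb G x" "w \<in> nb G x" "q \<in> nb G x" "b \<in> nb G y" "w \<in> nb G y" "x \<in> nb G q" "w \<in> nb G q"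
    using v x y w by (auto simp: nb_sym[of x G q] nb_sym[of w G q])
  note V = in_nb[THEN nbV] in_nb[THEN nb_ne]
  obtain e where q: "nb G q = {x, w, e}" by (rule nb_pair[OF in_nb(8,9)]) (use V in auto)
  show ?thesis
    by (rule reduce[where ms = "[(x, q), (y, w)]" and us = "[v]" and
        Es = "[{v, x}, {v, y}, {x, w}, {y, w}, {x, q}, {w, q}, {y, b}, {q, e}]"])
      (use d V in \<open>simp_all add: touched_def doubleton_eq_iff v x y w q\<close>)
qed

lemma common_one:
  assumes v: "nb G v = {x, y}" and x: "nb G x = {v, w, q}" and y: "nb G y = {v, w, b}" and w: "nb G w = {x, y, z}"
    and d: "x \<noteq> y" "q \<noteq> v" "q \<noteq> w" "b \<noteq> v" "b \<noteq> w" "q \<noteq> y" "b \<noteq> x" "q \<noteq> b" "w \<noteq> v"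
      "z \<noteq> x" "z \<noteq> y" "z \<noteq> v" "z \<noteq> q" "z \<noteq> b"
    and z: "q \<in> nb G z" "b \<notin> nb G z"
  shows "cov G {} (beta G)"
proof -
  have in_nb: "x \<in> nb G v" "y \<in> nb G v" "w \<in> nb G x" "q \<in> nb G x" "b \<in> nb G y" "w \<in> nb G y" "x \<in> nb G q" "z \<in> nb G q" "w \<in> nb G z" "y \<in> nb G b" "z \<in> nb G w" "v \<in> nb G x"
    using v x y w z by (auto simp: nb_sym[of x G q] nb_sym[of z G q] nb_sym[of w G z] nb_sym[of y G b])
  note V = in_nb[THEN nbV] in_nb[THEN nb_ne]
  obtain e where q: "nb G q = {x, z, e}" by (rule nb_pair[OF in_nb(7,8) d(10)[symmetric]])
  obtain g h where b: "nb G b = {y, g, h}" by (rule nb_eq3[OF in_nb(10)])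
  from nb_eq3'[OF in_nb(9) z(1) d(3)[symmetric]] show ?thesis
  proof cases
    case 1
    show ?thesis
      by (rule reduce[where ms = "[(x, q), (y, w)]" and us = "[v, z]" and
          Es = "[{v, x}, {v, y}, {x, w}, {y, w}, {x, q}, {y, b}, {w, z}, {q, z}, {q, e}]"])
        (use d V in \<open>simp_all add: touched_def doubleton_eq_iff v x y w q 1\<close>)
  next
    case (2 t)
    have tz: "t \<in> nb G z" "z \<in> nb G t" using 2(1) by (auto simp: nb_sym[of z])
    have "v \<notin> nb G z" "x \<notin> nb G z" "y \<notin> nb G z"
      using v x y V d by (auto simp: nb_sym[of v] nb_sym[of x] nb_sym[of y])
    with tz(1) z(2) have t: "t \<noteq> v" "t \<noteq> x" "t \<noteq> y" "t \<noteq> b" by auto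
    obtain i j where ij: "nb G t = {z, i, j}" by (rule nb_eq3[OF tz(2)])
    show ?thesis
      by (rule reduce[where ms = "[(x, q), (y, b), (z, t)]" and us = "[v, w]" and
          Es = "[{v, x}, {v, y}, {x, w}, {y, w}, {x, q}, {y, b}, {w, z}, {q, z}, {q, e}, {b, g}, {b, h}, {z, t}, {t, i}, {t, j}]"])
        (use d V t 2(2,3) nbV[OF tz(1)] nb_ne[OF tz(1)] in \<open>simp_all add: touched_def doubleton_eq_iff v x y w q b ij 2(1)\<close>)
  qed
qed

lemma common_two:
  assumes v: "nb G v = {x, y}" and x: "nb G x = {v, w, q}" and y: "nb G y = {v, w, b}" and w: "nb G w = {x, y, z}"
    and d: "x \<noteq> y" "q \<noteq> v" "q \<noteq> w" "b \<noteq> v" "b \<noteq> w" "q \<noteq> y" "b \<noteq> x" "q \<noteq> b" "w \<noteq> v"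
      "z \<noteq> x" "z \<noteq> y" "z \<noteq> v" "z \<noteq> q" "z \<noteq> b"
    and zn: "q \<in> nb G z" "b \<in> nb G z"
  shows "cov G {} (beta G)"
proof -
  have in_nb: "x \<in> nb G v" "y \<in> nb G v" "w \<in> nb G x" "q \<in> nb G x" "b \<in> nb G y" "w \<in> nb G y" "x \<in> nb G q" "z \<in> nb G q" "w \<in> nb G z" "y \<in> nb G b" "z \<in> nb G b" "z \<in> nb G w" "v \<in> nb G x"
    using v x y w zn by (auto simp: nb_sym[of x G q] nb_sym[of z G q] nb_sym[of w G z] nb_sym[of y G b] nb_sym[of z G b])
  note V = in_nb[THEN nbV] in_nb[THEN nb_ne]
  have z: "nb G z = {w, q, b}" by (rule nb_three) (use in_nb(9) zn d in auto)
  obtain e where q: "nb G q = {x, z, e}" by (rule nb_pair[OF in_nb(7,8) d(10)[symmetric]])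
  from nb_eq3'[OF in_nb(10,11) d(11)[symmetric]] show ?thesis
  proof cases
    case 1
    show ?thesis
      by (rule reduce[where ms = "[(x, q), (y, w), (z, b)]" and us = "[v]" and
          Es = "[{v, x}, {v, y}, {x, w}, {y, w}, {x, q}, {y, b}, {w, z}, {q, z}, {b, z}, {q, e}]"])
        (use d V in \<open>simp_all add: touched_def doubleton_eq_iff v x y w q z 1\<close>)
  next
    case (2 c)
    have cb: "c \<in> nb G b" "b \<in> nb G c" using 2(1) by (auto simp: nb_sym[of b])
    show ?thesis
    proof (cases "c = q")
      case True
      have "nb G q = {x, z, b}" by (rule nb_three) (use in_nb(7,8) cb True d in auto)
      then show ?thesis
        by (intro reduce[where ms = "[(x, q), (y, w), (z, b)]" and us = "[v]" and
            Es = "[{v, x}, {v, y}, {x, w}, {y, w}, {x, q}, {y, b}, {w, z}, {q, z}, {b, z}, {q, b}]"])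
          (use d V in \<open>simp_all add: touched_def doubleton_eq_iff v x y w z 2(1) True\<close>)
    next
      case False
      have "v \<notin> nb G b" "x \<notin> nb G b" "w \<notin> nb G b"
        using v x w V d by (auto simp: nb_sym[of v] nb_sym[of x] nb_sym[of w])
      with cb(1) have c: "c \<noteq> v" "c \<noteq> x" "c \<noteq> w" by auto
      obtain i j where ij: "nb G c = {b, i, j}" by (rule nb_eq3[OF cb(2)])
      show ?thesis
        by (rule reduce[where ms = "[(x, q), (y, w), (b, c)]" and us = "[v, z]" and
            Es = "[{v, x}, {v, y}, {x, w}, {y, w}, {x, q}, {y, b}, {w, z}, {q, z}, {b, z}, {q, e}, {b, c}, {c, i}, {c, j}]"])
          (use d V c False 2(2,3) nbV[OF cb(1)] nb_ne[OF cb(1)] in \<open>simp_all add: touched_def doubleton_eq_iff v x y w q z ij 2(1)\<close>)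
    qed
  qed
qed

text \<open>Covering \<open>z\<close> makes both \<open>v\<close> and \<open>w\<close> skippable.
  Eleven lost edges and one unit for \<open>z\<close> meet the allowance 4 + 8 exactly.\<close>

lemma common_none:
  assumes v: "nb G v = {x, y}" and x: "nb G x = {v, w, q}" and y: "nb G y = {v, w, b}" and w: "nb G w = {x, y, z}"
    and d: "x \<noteq> y" "q \<noteq> v" "q \<noteq> w" "b \<noteq> v" "b \<noteq> w" "q \<noteq> y" "b \<noteq> x" "q \<noteq> b" "w \<noteq> v"
      "z \<noteq> x" "z \<noteq> y" "z \<noteq> v" "z \<noteq> q" "z \<noteq> b"
    and zn: "q \<notin> nb G z" "b \<notin> nb G z"
  shows "cov G {} (beta G)"
proof -
  have in_nb: "x \<in> nb G v" "y \<in> nb G v" "w \<in> nb G x" "q \<in> nb G x" "b \<in> nb G y" "w \<in> nb G y" "x \<in> nb G q" "w \<in> nb G z" "y \<in> nb G b" "z \<in> nb G w" "v \<in> nb G x"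
    using v x y w by (auto simp: nb_sym[of x G q] nb_sym[of w G z] nb_sym[of y G b])
  note V = in_nb[THEN nbV] in_nb[THEN nb_ne]
  have out: "v \<notin> nb G z" "x \<notin> nb G z" "y \<notin> nb G z"
    using v x y V d by (auto simp: nb_sym[of v] nb_sym[of x] nb_sym[of y])
  obtain e f where q: "nb G q = {x, e, f}" by (rule nb_eq3[OF in_nb(7)])
  obtain g h where b: "nb G b = {y, g, h}" by (rule nb_eq3[OF in_nb(9)])
  from V(10) show ?thesis
  proof (cases rule: deg_cases)
    case 1
    from card_2_elem[OF 1 in_nb(8)] obtain t where t: "nb G z = {w, t}" "t \<noteq> w" by metis
    have tz: "t \<in> nb G z" "z \<in> nb G t" using t(1) by (auto simp: nb_sym[of z])
    have t': "t \<noteq> v" "t \<noteq> x" "t \<noteq> y" "t \<noteq> b" "t \<noteq> q" using tz(1) zn out by auto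
    obtain i j where ij: "nb G t = {z, i, j}" by (rule nb_eq3[OF tz(2)])
    show ?thesis
      by (rule reduce[where ms = "[(x, q), (y, b), (z, t)]" and us = "[v, w]" and
          Es = "[{v, x}, {v, y}, {x, w}, {y, w}, {x, q}, {y, b}, {w, z}, {q, e}, {q, f}, {b, g}, {b, h}, {z, t}, {t, i}, {t, j}]"])
        (use d V t' t(2) nbV[OF tz(1)] nb_ne[OF tz(1)] in \<open>simp_all add: touched_def doubleton_eq_iff v x y w q b ij t(1)\<close>)
  next
    case 2
    from card_3_elem[OF 2 in_nb(8)] obtain s t where st: "nb G z = {w, s, t}" "s \<noteq> t" "s \<noteq> w" "t \<noteq> w" by metis
    have st': "s \<noteq> v" "s \<noteq> x" "s \<noteq> y" "s \<noteq> b" "s \<noteq> q" "t \<noteq> v" "t \<noteq> x" "t \<noteq> y" "t \<noteq> b" "t \<noteq> q"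
      using st(1) zn out by auto
    have diff: "nb G z - {x, q, y, b, v, w} = {s, t}" using st st' by auto
    show ?thesis
      by (rule reduce_step[where ms = "[(x, q), (y, b)]" and us = "[v, w]" and w = z and p = s and q = t and
          Es = "[{v, x}, {v, y}, {x, w}, {y, w}, {x, q}, {y, b}, {w, z}, {q, e}, {q, f}, {b, g}, {b, h}]"])
        (use d V st(2) diff in \<open>simp_all add: touched_def doubleton_eq_iff v x y w q b\<close>)
  qed
qed

text \<open>The common neighbour \<open>w\<close> is a second candidate for skipping besides
  \<open>v\<close>: it needs only its third neighbour \<open>z\<close> in addition to
  \<open>x\<close> and \<open>y\<close>. The cases record how \<open>z\<close> is tied to
  \<open>q\<close> and \<open>b\<close>, the partners of \<open>x\<close> and
  \<open>y\<close>.\<close>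

lemma common_neighbour:
  assumes v: "nb G v = {x, y}" and x: "nb G x = {v, w, q}" and y: "nb G y = {v, w, b}"
    and d: "x \<noteq> y" "q \<noteq> v" "q \<noteq> w" "b \<noteq> v" "b \<noteq> w" "w \<noteq> v" and xy: "y \<notin> nb G x"
  shows "cov G {} (beta G)"
proof -
  have in_nb: "x \<in> nb G v" "y \<in> nb G v" "w \<in> nb G x" "q \<in> nb G x" "b \<in> nb G y" "w \<in> nb G y" "x \<in> nb G w" "y \<in> nb G w" "x \<in> nb G q" "y \<in> nb G b" "v \<in> nb G x"
    using v x y by (auto simp: nb_sym[of x G q] nb_sym[of x G w] nb_sym[of y G b] nb_sym[of y G w])
  note V = in_nb[THEN nbV] in_nb[THEN nb_ne]
  have v': "nb G v = {y, x}" using v by auto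
  have d2: "q \<noteq> y" "b \<noteq> x" using xy x in_nb(5) by (auto simp: nb_sym[of b])
  have qb: "q \<noteq> b"
  proof
    assume "q = b"
    then have "nb G x = nb G y" using x y by simp
    moreover have "card (nb G x) = 3" using x d by simp
    ultimately show False using no_K23[OF d(1)] by simp
  qed
  from nb_eq3'[OF in_nb(7,8) d(1)] show ?thesis
  proof cases
    case 1
    obtain e f where q: "nb G q = {x, e, f}" by (rule nb_eq3[OF in_nb(9)])
    obtain g h where b: "nb G b = {y, g, h}" by (rule nb_eq3[OF in_nb(10)])
    show ?thesis
      by (rule reduce[where ms = "[(x, q), (y, b)]" and us = "[v, w]" and
          Es = "[{v, x}, {v, y}, {x, w}, {y, w}, {x, q}, {y, b}, {q, e}, {q, f}, {b, g}, {b, h}]"])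
        (use d d2 qb V in \<open>simp_all add: touched_def doubleton_eq_iff v x y q b 1\<close>)
  next
    case (2 z)
    have w: "nb G w = {x, y, z}" "nb G w = {y, x, z}" using 2(1) by auto
    have "w \<noteq> x" "w \<noteq> y" using V by auto
    then have "v \<notin> nb G w" using v by (auto simp: nb_sym[of v])
    with 2 have zv: "z \<noteq> v" by auto
    consider "z = q" | "z = b" | "z \<noteq> q" "z \<noteq> b" by blast
    then show ?thesis
    proof cases
      assume "z = q"
      with w show ?thesis by (intro common_triangle[OF v x y]) (use d d2 qb in auto)
    next
      assume "z = b"
      with w show ?thesis by (intro common_triangle[OF v' y x]) (use d d2 qb in auto)
    next
      assume z: "z \<noteq> q" "z \<noteq> b"
      consider "q \<in> nb G z" "b \<notin> nb G z" | "q \<notin> nb G z" "b \<in> nb G z" | "q \<in> nb G z" "b \<in> nb G z" | "q \<notin> nb G z" "b \<notin> nb G z" by blast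
      then show ?thesis
      proof cases
        case 1
        then show ?thesis by (intro common_one[OF v x y w(1)]) (use d d2 qb 2 z zv in simp_all)
      next
        case zb: 2
        then show ?thesis by (intro common_one[OF v' y x w(2)]) (use d d2 qb 2 z zv in simp_all)
      next
        case 3
        then show ?thesis by (intro common_two[OF v x y w(1)]) (use d d2 qb 2 z zv in simp_all)
      next
        case 4
        then show ?thesis by (intro common_none[OF v x y w(1)]) (use d d2 qb 2 z zv in simp_all)
      qed
    qed
  qed
qed

end

section \<open>Degree two with disjoint second neighbourhoods\<close>

locale deg2_vertex = k23_free +
  fixes v x y p q a b
  assumes v: "nb G v = {x, y}" and x: "nb G x = {v, p, q}" and y: "nb G y = {v, a, b}"
    and dist: "distinct [v, x, y, p, q, a, b]"
begin

lemma neq: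
  "v \<noteq> x" "v \<noteq> y" "v \<noteq> p" "v \<noteq> q" "v \<noteq> a" "v \<noteq> b" "x \<noteq> y" "x \<noteq> p" "x \<noteq> q" "x \<noteq> a" "x \<noteq> b"
  "y \<noteq> p" "y \<noteq> q" "y \<noteq> a" "y \<noteq> b" "p \<noteq> q" "p \<noteq> a" "p \<noteq> b" "q \<noteq> a" "q \<noteq> b" "a \<noteq> b"
  using dist by auto

lemma V: "v \<in> verts G" "x \<in> verts G" "y \<in> verts G" "p \<in> verts G" "q \<in> verts G" "a \<in> verts G" "b \<in> verts G"
  using nbV[of _ v] nbV[of _ x] nbV[of _ y] v x y by auto

lemma in_nb: "v \<in> nb G x" "v \<in> nb G y" "x \<in> nb G p" "x \<in> nb G q" "y \<in> nb G a" "y \<in> nb G b"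
  using v x y by (auto simp: nb_sym[of v] nb_sym[of x] nb_sym[of y])

lemma vxy_iff: "v \<in> nb G u \<longleftrightarrow> u = x \<or> u = y" "x \<in> nb G u \<longleftrightarrow> u = v \<or> u = p \<or> u = q"
  "y \<in> nb G u \<longleftrightarrow> u = v \<or> u = a \<or> u = b"
  using v x y by (auto simp: nb_sym[of v] nb_sym[of x] nb_sym[of y])

lemma deg2_second_neighbour:
  assumes "card (nb G p) = 2"
  shows "cov G {} (beta G)"
proof -
  from card_2_elem[OF assms in_nb(3)] obtain p1 where p: "nb G p = {x, p1}" by metis
  show ?thesis
    by (rule reduce_step[where ms = "[(x, p)]" and us = "[v]" and w = y and p = a and q = b and
        Es = "[{v, x}, {v, y}, {x, p}, {x, q}, {p, p1}]"])
      (use neq V in \<open>simp_all add: touched_def doubleton_eq_iff v x y p insert_Diff_if\<close>)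
qed

text \<open>Ten lost edges exceed the allowance 4 + 4 by two. Nonadjacent \<open>q\<close> and
  \<open>b\<close>, now of degree at most one, return exactly two units. If they are adjacent, all
  neighbours of \<open>b\<close> are known and it can be skipped as well.\<close>

lemma two_triangles:
  assumes pq: "q \<in> nb G p" and ab: "b \<in> nb G a"
  shows "cov G {} (beta G)"
proof -
  have qp: "p \<in> nb G q" "a \<in> nb G b" using pq ab by (simp_all add: nb_sym)
  obtain p' where p: "nb G p = {x, q, p'}" by (rule nb_pair[OF in_nb(3) pq]) (use neq in simp)
  obtain a' where a: "nb G a = {y, b, a'}" by (rule nb_pair[OF in_nb(5) ab]) (use neq in simp)
  show ?thesis
  proof (cases "q \<in> nb G b")
    case True
    then have bq: "b \<in> nb G q" by (simp add: nb_sym)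
    have q: "nb G q = {x, p, b}" by (rule nb_three[OF in_nb(4) qp(1) bq]) (use neq in simp_all)
    have b: "nb G b = {y, a, q}" by (rule nb_three[OF in_nb(6) qp(2) True]) (use neq in simp_all)
    show ?thesis
      by (rule reduce[where ms = "[(x, q), (y, a)]" and us = "[v, b]" and
          Es = "[{v, x}, {v, y}, {x, p}, {x, q}, {y, a}, {y, b}, {p, q}, {q, b}, {a, b}, {a, a'}]"])
        (use neq V in \<open>simp_all add: touched_def doubleton_eq_iff v x y q a b\<close>)
  next
    case False
    let ?H = "del G (set (ends [(x, p), (y, a)] @ [v]))"
    have H: "simple_graph ?H" by (rule simple_del[OF simple])
    have "card (nb G q - {x, p}) \<le> 1"
      using subcubic_graph_card[OF subcubic_graph, of q] in_nb qp neq by (subst card_Diff_subset) auto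
    moreover have "card (nb G b - {y, a}) \<le> 1"
      using subcubic_graph_card[OF subcubic_graph, of b] in_nb qp neq by (subst card_Diff_subset) auto
    moreover have "card (nb ?H q) \<le> card (nb G q - {x, p})" "card (nb ?H b) \<le> card (nb G b - {y, a})"
      by (intro card_mono finite_Diff finite_nb[OF simple]; auto simp: nb_del)+
    ultimately have "budget ?H \<le> beta ?H - 2"
      by (intro budget_leaves[OF H, of q b]) (use neq V False in \<open>auto simp: nb_del\<close>)
    moreover have "cov ?H {} (budget ?H)" by (rule cov_del) (use V in auto)
    ultimately show ?thesis
      by (intro reduce_cov[where ms = "[(x, p), (y, a)]" and us = "[v]" and X = "{}" and b = "budget ?H" and d = "-2" and
          Es = "[{v, x}, {v, y}, {x, p}, {x, q}, {p, q}, {p, p'}, {y, a}, {y, b}, {a, b}, {a, a'}]"])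
        (use neq V in \<open>simp_all add: touched_def doubleton_eq_iff v x y p a\<close>)
  qed
qed

text \<open>Matching \<open>xp\<close> and skipping \<open>v\<close> is balanced, and covering
  \<open>y\<close> costs one unit. Since \<open>a\<close> and \<open>b\<close> are not adjacent,
  \<open>reduces\<close> saves its 5 units at \<open>y\<close> without drawing on a leaf; the unit
  is paid by \<open>q\<close>, which has degree at most one after its triangle is destroyed.\<close>

lemma one_triangle:
  assumes pq: "q \<in> nb G p"
  shows "cov G {} (beta G)"
proof (cases "b \<in> nb G a")
  case True
  with pq show ?thesis by (rule two_triangles)
next
  case False
  have qp: "p \<in> nb G q" using pq by (simp add: nb_sym)
  obtain p' where p: "nb G p = {x, q, p'}" by (rule nb_pair[OF in_nb(3) pq]) (use neq in simp)
  let ?S = "set (ends [(x, p)] @ [v])" let ?H = "del G ?S"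
  have S: "simple_graph ?H" by (rule simple_del[OF simple])
  have R: "?S \<inter> verts G \<noteq> {}" using V by auto
  have ny: "nb ?H y = {a, b}" using neq by (auto simp: nb_del y)
  from step[OF R ny neq(21)] obtain p2 q2 H2 where pq2: "{p2, q2} = {a, b}" and r: "reduces ?H y p2 q2 H2" by metis
  note r' = r[unfolded reduces_def]
  have "\<not> q2 \<in> nb ?H p2"
    using pq2 False neq by (auto simp: nb_del doubleton_eq_iff nb_sym[of a])
  with r' have b5: "beta H2 \<le> beta ?H - 5" by auto
  have "q \<in> verts H2" using r' V neq pq2 by (auto simp: doubleton_eq_iff)
  moreover have "card (nb H2 q) \<le> 1"
  proof -
    have "card (nb H2 q) \<le> card (nb ?H q)" using r' by blast
    also have "\<dots> \<le> card (nb G q - {x, p})"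
      by (intro card_mono finite_Diff finite_nb[OF simple]) (auto simp: nb_del)
    also have "\<dots> \<le> 1"
      using subcubic_graph_card[OF subcubic_graph, of q] in_nb qp neq by (subst card_Diff_subset) auto
    finally show ?thesis .
  qed
  ultimately have "budget H2 \<le> beta H2 - 1" using r' by (intro budget_leaf) (auto intro: subcubic_graph_simple)
  moreover have "cov H2 {} (budget H2)" by (rule cov_IH) (use r' R in auto)
  ultimately have "cov H2 {} (beta ?H - 6)" using b5 by (elim cov_mono) auto
  then have "cov ?H (insert y (insert p2 {})) (beta ?H - 6 + 6)" using r' by blast
  then have "cov ?H {y} (beta ?H)" by (rule cov_mono) auto
  then show ?thesis
    by (rule reduce_cov[where ms = "[(x, p)]" and us = "[v]" and X = "{y}" and d = 0 and
        Es = "[{v, x}, {v, y}, {x, p}, {x, q}, {p, q}, {p, p'}]", rotated 5])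
      (use neq V in \<open>simp_all add: touched_def doubleton_eq_iff v x p\<close>)
qed

text \<open>Two gadgets in a row: first at \<open>x\<close> (deleting \<open>x\<close>, \<open>p\<close> and joining \<open>q\<close> to \<open>j\<close>), then at \<open>y\<close>.\<close>

lemma two_gadgets:
  assumes p: "nb G p = {x, j, p2}" and j: "j \<noteq> x" "j \<noteq> q" "q \<notin> nb G j" "j \<noteq> a" "j \<noteq> b"
    and ab: "b \<notin> nb G a" and no_cubic_part: "no_cubic_part (add (del (del G {v}) {x, p}) q j)"
  shows "cov G {} (beta G)"
proof -
  let ?H = "del G {v}" let ?K = "del ?H {x, p}" let ?G = "add ?K q j"
  have SH: "simple_graph ?H" and SK: "simple_graph ?K" by (intro simple_del simple)+
  have jp: "j \<in> nb G p" "p \<in> nb G j" using p by (auto simp: nb_sym[of p])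
  have jV: "j \<in> verts G" "j \<noteq> p" using nbV[OF jp(1)] nb_ne[OF jp(1)] by auto
  have jne: "j \<noteq> v" "j \<noteq> y" using jp vxy_iff[of p] neq by auto
  have g: "p \<in> nb ?H x" "q \<in> nb ?H x" "j \<in> nb ?H p" "q \<noteq> j" "q \<noteq> p" "j \<noteq> x"
    using x jp jne j neq by (auto simp: nb_del)
  have SG: "simple_graph ?G" by (rule simple_add[OF SK g(4)]) (use V jV jne j neq in auto)
  have sgG: "subcubic_graph ?G"
    unfolding subcubic_graph_def
    using SG order_trans[OF card_nb_gadget[OF SH g] subcubic_graph_card[OF subcubic_graph_del[OF subcubic_graph]]] by blast
  have nbG: "nb ?G u = (if u = q then insert j (nb G u - {v, x, p}) else if u = j then insert q (nb G u - {v, x, p})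
      else if u \<in> {v, x, p} then {} else nb G u - {v, x, p})" for u
    using g jne jV neq by (auto simp: nb_add nb_del)
  have ny: "nb ?G y = {a, b}" using neq jne by (auto simp: nbG y)
  \<comment> \<open>Three vertices, six edges and the added edge: -12 + 6 - 1.\<close>
  have bG: "beta ?G \<le> beta G - 7"
  proof -
    have "beta (del G (set [v, x, p])) \<le> beta G - 4 * int (length [v, x, p]) +
        int (length [{v, x}, {v, y}, {x, p}, {x, q}, {p, j}, {p, p2}])"
      by (rule beta_del_list[OF simple]) (use neq V in \<open>simp_all add: touched_def doubleton_eq_iff v x p\<close>)
    moreover have "beta ?G = beta ?K - 1"
      by (rule beta_add[OF SK]) (use j in \<open>auto simp: nb_del nb_sym[of j]\<close>)
    ultimately show ?thesis by (simp add: del_del insert_commute)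
  qed
  have full: "nb ?G u = nb G u" if "card (nb ?G u) = 3" "u \<noteq> q" "u \<noteq> j" for u
    by (rule nb_full[OF subcubic_graph _ that(1)]) (use that(2,3) in \<open>auto simp: nbG split: if_splits\<close>)
  have nK: "nb ?G a = nb ?G b \<longrightarrow> card (nb ?G a) \<noteq> 3" "nb ?G b = nb ?G a \<longrightarrow> card (nb ?G b) \<noteq> 3"
    using no_K23[OF neq(21)] full[of a] full[of b] neq j by auto
  have nab: "b \<notin> nb ?G a" "a \<notin> nb ?G b"
    using ab neq j by (auto simp: nbG nb_sym[of a G b])
  \<comment> \<open>The reduction at \<open>y\<close> saves 5 more. The total of 12 pays for the two
    lifts, and \<open>v\<close> is skipped with both neighbours covered.\<close>
  have finish: ?thesis if c: "{c, d} = {a, b}" and r: "reduces ?G y c d H2" for c d H2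
  proof -
    note r' = r[unfolded reduces_def]
    have "d \<notin> nb ?G c" using c nab by (auto simp: doubleton_eq_iff)
    with r' have "beta H2 \<le> beta ?G - 5" by auto
    moreover have "cov H2 {} (budget H2)" by (rule cov_IH) (use r' V in auto)
    ultimately have "cov H2 {} (beta G - 12)" using bG budget_le[of H2] by (elim cov_mono) auto
    then have "cov ?G (insert y (insert c {})) (beta G - 12 + 6)" using r' by blast
    then have "cov ?H (insert x (insert p (insert y (insert c {})))) (beta G)"
      by (rule cov_gadget[OF SH g]) simp
    then have "cov ?H {x, y} (beta G)" by (rule cov_mono) auto
    then have "cov G ({x, y} \<union> set (ends [])) (beta G)"
      by (intro cov_reduce[OF simple, where U = "{v}" and b = "beta G"]) (use v in auto)
    then show ?thesis by (rule cov_mono) auto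
  qed
  \<comment> \<open>A far side avoiding \<open>q\<close> also avoids \<open>j\<close>; then the
    first gadget has not touched it, and it would be cut off by a bridge already in
    \<open>G\<close>.\<close>
  have join_in: "q \<in> B" if B: "d \<in> B" "B \<subseteq> verts ?G - {y, c}" "\<And>u. u \<in> B \<Longrightarrow> nb ?G u \<subseteq> insert y B"
    "\<And>u. u \<in> B \<Longrightarrow> card (nb ?G u) = 3" and c: "{c, d} = {a, b}" for c d B
  proof (rule ccontr)
    assume qB: "q \<notin> B"
    have "j \<notin> B" using B(3)[of j] qB neq g by (auto simp: nbG)
    then have eq: "nb ?G u = nb G u" if "u \<in> B" for u
      using full[OF B(4)[OF that]] that qB by auto
    have dy: "y \<in> nb G d" using c vxy_iff(3)[of d] by (auto simp: doubleton_eq_iff)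
    show False
    proof (rule nobridge[of d B y])
      show "y \<notin> B" "B \<subseteq> verts G" using B(2) by auto
      show "nb G u \<subseteq> insert y B" if "u \<in> B" for u using B(3)[OF that] eq[OF that] by simp
      show "u = d" if "u \<in> B" "y \<in> nb G u" for u
        using that B(2) c vxy_iff(3)[of u] by (auto simp: doubleton_eq_iff)
    qed (use B(1) dy in auto)
  qed
  show ?thesis
  proof (cases rule: step_or_bridge[OF sgG no_cubic_part ny neq(21) nK(1), case_names step bridge])
    case (step c d H2)
    then show ?thesis by (rule finish)
  next
    case B: (bridge B)
    have ny': "nb ?G y = {b, a}" using ny by auto
    show ?thesis
    proof (cases rule: step_or_bridge[OF sgG no_cubic_part ny' neq(21)[symmetric] nK(2), case_names step bridge])
      case (step c d H2)
      then show ?thesis by (intro finish[of c d]) auto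
    next
      case B': (bridge B')
      \<comment> \<open>The far sides obtained for \<open>a\<close> and for \<open>b\<close> meet in
        \<open>q\<close>. Their intersection contains neither \<open>a\<close> nor \<open>b\<close>,
        so it has no edge to \<open>y\<close> and is a closed cubic set.\<close>
      have "q \<in> B" by (rule join_in[OF B refl])
      moreover have "q \<in> B'" by (rule join_in[OF B']) auto
      ultimately have "B \<inter> B' \<noteq> {}" by blast
      moreover have "nb ?G u \<subseteq> B \<inter> B'" if u: "u \<in> B \<inter> B'" for u
      proof -
        have "u \<notin> nb ?G y" using u B(2) B'(2) ny by auto
        then have "y \<notin> nb ?G u" by (simp add: nb_sym)
        then show ?thesis using B(3)[of u] B'(3)[of u] u by auto
      qed
      ultimately have False
        by (intro no_cubic_partD[OF no_cubic_part, of "B \<inter> B'"]) (use B B' in auto)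
      then show ?thesis ..
    qed
  qed
qed

text \<open>Neither further neighbour of \<open>p\<close> is \<open>a\<close> or \<open>b\<close>,
  so both are admissible for the first gadget without disturbing \<open>y\<close>. If neither works,
  the obstruction is a bridge.\<close>

lemma no_cross_edge:
  assumes p3: "card (nb G p) = 3" and pq: "q \<notin> nb G p" and ab: "b \<notin> nb G a"
    and cross: "a \<notin> nb G p" "b \<notin> nb G p"
  shows "cov G {} (beta G)"
proof -
  let ?H = "del G {v}"
  from card_3_elem[OF p3 in_nb(3)] obtain p1 p2 where p: "nb G p = {x, p1, p2}" "p1 \<noteq> p2" "p1 \<noteq> x" "p2 \<noteq> x" by metis
  have p': "nb G p = {x, p2, p1}" using p(1) by auto
  have H: "subcubic_graph ?H" "no_cubic_part ?H" by (rule subcubic_graph_del[OF subcubic_graph], rule no_cubic_part_delete) (use V in auto)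
  have "v \<notin> nb G p" using vxy_iff neq by auto
  then have nbH: "nb ?H x = {p, q}" "nb ?H p = {x, p1, p2}" using x p neq by (auto simp: nb_del)
  have qp: "q \<noteq> p1" "q \<noteq> p2" using pq p by auto
  have qin: "q \<in> nb ?H i \<longleftrightarrow> i \<in> nb G q" if "i \<noteq> v" for i
    using that neq by (auto simp: nb_del nb_sym[of q])
  have pv: "p1 \<noteq> v" "p2 \<noteq> v" using \<open>v \<notin> nb G p\<close> p by auto
  have nK: "\<not> (q \<in> nb ?H p1 \<and> q \<in> nb ?H p2)"
  proof
    assume "q \<in> nb ?H p1 \<and> q \<in> nb ?H p2"
    then have "nb G p \<subseteq> nb G q" using p(1) in_nb(4) qin pv by auto
    then have "nb G p = nb G q" by (rule nb_full[OF subcubic_graph _ p3])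
    with no_K23[OF neq(16)] p3 show False by simp
  qed
  show ?thesis
  proof (cases rule: gadget_or_bridge[OF H nbH neq(16) p(2-4) qp nK, case_names gadget bridge])
    case (gadget i)
    have "i \<noteq> v" using gadget(1) pv by auto
    have iq: "q \<notin> nb G i" using gadget(2) qin[OF \<open>i \<noteq> v\<close>] by (simp add: nb_sym)
    from gadget(1) consider "i = p1" | "i = p2" by auto
    then show ?thesis
    proof cases
      case 1
      show ?thesis
        by (rule two_gadgets[OF p(1) _ _ _ _ _ ab]) (use 1 iq gadget(3) qp p cross in auto)
    next
      case 2
      show ?thesis
        by (rule two_gadgets[OF p' _ _ _ _ _ ab]) (use 2 iq gadget(3) qp p cross in auto)
    qed
  next
    case (bridge B)
    have eq: "nb ?H u = nb G u" if "u \<in> B" for u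
      by (rule nb_full[OF subcubic_graph _ bridge(4)[OF that]]) (auto simp: nb_del)
    have False
    proof (rule nobridge[of q B x])
      show "nb G u \<subseteq> insert x B" if "u \<in> B" for u using bridge(3)[OF that] eq[OF that] by simp
      show "u = q" if "u \<in> B" "x \<in> nb G u" for u
        using that bridge(2) vxy_iff(2)[of u] by auto
    qed (use bridge in_nb in auto)
    then show ?thesis ..
  qed
qed

text \<open>The first gadget cannot create a cubic part here: such a part contains \<open>q\<close>,
  hence \<open>b\<close>, hence \<open>y\<close>, and \<open>y\<close> has only two neighbours
  left.\<close>

lemma cross_gadget:
  assumes p: "nb G p = {x, j, p2}" and j: "j \<noteq> x" "j \<noteq> q" "q \<notin> nb G j" "j \<noteq> a" "j \<noteq> b"
    and ab: "b \<notin> nb G a" and cross: "b \<in> nb G q"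
  shows "cov G {} (beta G)"
proof (rule two_gadgets[OF assms(1-7)])
  let ?K = "del (del G {v}) {x, p}"
  have K: "?K = del G {v, x, p}" by (simp add: del_del insert_commute)
  show "no_cubic_part (add ?K q j)"
  proof (rule ccontr)
    assume n: "\<not> no_cubic_part (add ?K q j)"
    have "j \<noteq> y" using p vxy_iff(3)[of p] neq by auto
    have nccK: "no_cubic_part ?K" unfolding K by (rule no_cubic_part_delete) (use V in auto)
    from no_cubic_part_add[OF nccK j(2)[symmetric] n] obtain U where U: "q \<in> U"
      "\<And>u. u \<in> U \<Longrightarrow> nb (add ?K q j) u \<subseteq> U" "\<And>u. u \<in> U \<Longrightarrow> card (nb (add ?K q j) u) = 3" by metis
    have "b \<in> U" using U(2)[OF U(1)] cross neq j by (auto simp: nb_add nb_del)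
    then have "y \<in> U" using U(2)[of b] in_nb neq j by (auto simp: nb_add nb_del)
    have "nb (add ?K q j) y \<subseteq> {a, b}" using y neq \<open>j \<noteq> y\<close> j by (auto simp: nb_add nb_del)
    then have "card (nb (add ?K q j) y) \<le> card {a, b}" by (rule card_mono[rotated]) simp
    with U(3)[OF \<open>y \<in> U\<close>] neq show False by simp
  qed
qed

end

lemma (in deg2_vertex) swap_xy: "deg2_vertex G v y x a b p q"
  using v x y dist by unfold_locales auto

lemma (in deg2_vertex) swap_pq: "deg2_vertex G v x y q p a b"
  using v x y dist by unfold_locales auto

lemma (in deg2_vertex) swap_ab: "deg2_vertex G v x y p q b a"
  using v x y dist by unfold_locales auto

text \<open>The final configuration: besides \<open>v\<close>, \<open>x\<close>, \<open>y\<close> there are two four-cycles \<open>xpdq\<close> and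
  \<open>yacb\<close> connected by the edges \<open>pa\<close> and \<open>qb\<close>.\<close>

locale two_squares = deg2_vertex +
  fixes c d
  assumes p: "nb G p = {x, a, d}" and q: "nb G q = {x, b, d}" and a: "nb G a = {y, p, c}" and b: "nb G b = {y, q, c}"
    and cd: "c \<notin> {v, x, y, p, q, a, b}" "d \<notin> {v, x, y, p, q, a, b}" "c \<noteq> d"
begin

lemma cd_neq:
  "c \<noteq> v" "c \<noteq> x" "c \<noteq> y" "c \<noteq> p" "c \<noteq> q" "c \<noteq> a" "c \<noteq> b"
  "d \<noteq> v" "d \<noteq> x" "d \<noteq> y" "d \<noteq> p" "d \<noteq> q" "d \<noteq> a" "d \<noteq> b"
  using cd by auto

lemma cd_nb: "p \<in> nb G d" "q \<in> nb G d" "a \<in> nb G c" "b \<in> nb G c" "c \<in> verts G" "d \<in> verts G"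
  using p q a b nbV[of c a] nbV[of d p] by (auto simp: nb_sym[of p] nb_sym[of q] nb_sym[of a] nb_sym[of b])

text \<open>The edge leaving the squares at \<open>d\<close> allows matching \<open>dd'\<close>,
  which makes \<open>q\<close> skippable along with \<open>v\<close>. Sixteen edges against 8 + 8
  leave no slack.\<close>

lemma tail:
  assumes d': "nb G d = {p, q, d'}" "d' \<noteq> p" "d' \<noteq> q" "d' \<noteq> c"
  shows "cov G {} (beta G)"
proof -
  have dd: "d \<in> nb G d'" "d' \<in> nb G d" using d' by (auto simp: nb_sym[of d])
  have ne: "d' \<noteq> v" "d' \<noteq> x" "d' \<noteq> y" "d' \<noteq> a" "d' \<noteq> b" "d' \<noteq> d"
  proof -
    have "d \<notin> nb G v" "d \<notin> nb G x" "d \<notin> nb G y" "d \<notin> nb G a" "d \<notin> nb G b"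
      using cd(3) by (simp_all add: v x y a b neq cd_neq)
    with dd(1) nb_ne[OF dd(2)] show "d' \<noteq> v" "d' \<noteq> x" "d' \<noteq> y" "d' \<noteq> a" "d' \<noteq> b" "d' \<noteq> d" by auto
  qed
  obtain c' where c: "nb G c = {a, b, c'}" by (rule nb_pair[OF cd_nb(3,4) neq(21)])
  obtain e f where ef: "nb G d' = {d, e, f}" by (rule nb_eq3[OF dd(1)])
  show ?thesis
    by (rule reduce[where ms = "[(x, p), (y, a), (b, c), (d, d')]" and us = "[v, q]" and
        Es = "[{v, x}, {v, y}, {x, p}, {x, q}, {y, a}, {y, b}, {p, a}, {q, b}, {p, d}, {q, d}, {a, c}, {b, c},
          {c, c'}, {d, d'}, {d', e}, {d', f}]"])
      (use neq V cd_neq cd(3) cd_nb(5,6) ne d'(2-4) nbV[OF dd(2)] in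
        \<open>simp_all add: touched_def doubleton_eq_iff v x y p q a b c ef d'(1)\<close>)
qed

end

lemma (in two_squares) swap: "two_squares G v y x a b p q d c"
proof -
  interpret s: deg2_vertex G v y x a b p q by (rule swap_xy)
  show ?thesis by unfold_locales (use p q a b cd in auto)
qed

lemma (in two_squares) two_squares_cov: "cov G {} (beta G)"
proof (cases "c \<in> nb G d")
  case True
  then have cd': "d \<in> nb G c" by (simp add: nb_sym)
  have d: "nb G d = {p, q, c}" by (rule nb_three) (use True cd_nb neq cd_neq in auto)
  have c: "nb G c = {a, b, d}" by (rule nb_three) (use cd' cd_nb neq cd_neq in auto)
  show ?thesis
    by (rule reduce[where ms = "[(x, p), (y, b), (c, d)]" and us = "[v, a, q]" and
        Es = "[{v, x}, {v, y}, {x, p}, {x, q}, {y, a}, {y, b}, {p, a}, {q, b}, {p, d}, {q, d}, {a, c}, {b, c}, {c, d}]"])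
      (use neq V cd_neq cd(3) cd_nb(5,6) in \<open>simp_all add: touched_def doubleton_eq_iff v x y p q a b c d\<close>)
next
  case False
  then have dc: "d \<notin> nb G c" by (simp add: nb_sym)
  from nb_eq3'[OF cd_nb(1,2) neq(16)] show ?thesis
  proof cases
    case d: 1
    from nb_eq3'[OF cd_nb(3,4) neq(21)] show ?thesis
    proof cases
      case c: 1
      show ?thesis
        by (rule reduce[where ms = "[(x, p), (q, d), (y, a), (b, c)]" and us = "[v]" and
            Es = "[{v, x}, {v, y}, {x, p}, {x, q}, {y, a}, {y, b}, {p, a}, {q, b}, {p, d}, {q, d}, {a, c}, {b, c}]"])
          (use neq V cd_neq cd(3) cd_nb(5,6) in \<open>simp_all add: touched_def doubleton_eq_iff v x y p q a b c d\<close>)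
    next
      case (2 c')
      interpret s: two_squares G v y x a b p q d c by (rule swap)
      show ?thesis by (rule s.tail[of c']) (use 2 dc in auto)
    qed
  next
    case (2 d')
    show ?thesis by (rule tail[of d']) (use 2 False in auto)
  qed
qed

text \<open>The gadget at \<open>x\<close> joins \<open>q\<close> to the third neighbour of
  \<open>p\<close>, the one at \<open>y\<close> joins \<open>b\<close> to the third neighbour of
  \<open>a\<close>. Apart from degenerate coincidences, both are blocked only if these neighbours
  close the two four-cycles.\<close>

lemma (in deg2_vertex) matching_cross:
  assumes cards: "card (nb G p) = 3" "card (nb G q) = 3" "card (nb G a) = 3" "card (nb G b) = 3"
    and pq: "q \<notin> nb G p" and ab: "b \<notin> nb G a" and cross: "a \<in> nb G p" "b \<in> nb G q"
  shows "cov G {} (beta G)"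
proof -
  interpret yx: deg2_vertex G v y x a b p q by (rule swap_xy)
  have cross': "p \<in> nb G a" "q \<in> nb G b" using cross by (simp_all add: nb_sym)
  from card_3_elem2[OF cards(1) in_nb(3) cross(1) neq(10)] obtain d where p: "nb G p = {x, a, d}" "d \<noteq> x" "d \<noteq> a" by metis
  from card_3_elem2[OF cards(2) in_nb(4) cross(2) neq(11)] obtain d' where q: "nb G q = {x, b, d'}" "d' \<noteq> x" "d' \<noteq> b" by metis
  from card_3_elem2[OF cards(3) in_nb(5) cross'(1) neq(12)] obtain c where a: "nb G a = {y, p, c}" "c \<noteq> y" "c \<noteq> p" by metis
  from card_3_elem2[OF cards(4) in_nb(6) cross'(2) neq(13)] obtain c' where b: "nb G b = {y, q, c'}" "c' \<noteq> y" "c' \<noteq> q" by metis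
  have p_d: "nb G p = {x, d, a}" and a_c: "nb G a = {y, c, p}" using p a by auto
  have dq: "d \<noteq> q" using pq p by auto
  have cb: "c \<noteq> b" using ab a by auto
  show ?thesis
  proof (cases "d = b")
    \<comment> \<open>Now \<open>p\<close> is adjacent to \<open>a\<close> and \<open>b\<close>. The
      third neighbour of \<open>q\<close> is not \<open>a\<close>, as \<open>p\<close> and
      \<open>q\<close> would have equal neighbourhoods; so the gadget works with \<open>p\<close>
      and \<open>q\<close> exchanged.\<close>
    case True
    then have "p \<in> nb G b" using p by (auto simp: nb_sym[of p])
    then have "c' = p" using b neq by auto
    have "q \<noteq> d" "d' \<noteq> q" using dq nb_ne[of d' q] q by auto
    show ?thesis
    proof (cases "d' = a")
      case True
      then have "nb G p = nb G q" using p q \<open>d = b\<close> by auto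
      with no_K23[OF neq(16)] cards show ?thesis by simp
    next
      case False
      interpret qp: deg2_vertex G v x y q p a b by (rule swap_pq)
      interpret qpba: deg2_vertex G v x y q p b a by (rule qp.swap_ab)
      have "p \<notin> nb G d'"
        using p(1) True q(2,3) False by (auto simp: nb_sym[of p])
      moreover have "d' \<noteq> p" using q(1) pq by (auto simp: nb_sym[of q])
      moreover have "a \<notin> nb G b" using ab by (simp add: nb_sym)
      moreover have "nb G q = {x, d', b}" using q by auto
      ultimately show ?thesis
        using qpba.cross_gadget[of d' b] q(2,3) False cross by simp
    qed
  next
    case db: False
    show ?thesis
    proof (cases "q \<in> nb G d")
      case False
      then show ?thesis by (intro cross_gadget[OF p_d _ _ _ _ _ ab]) (use p dq db cross in auto)
    next
      case True
      then have "d \<in> nb G q" by (simp add: nb_sym)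
      with q p db have d': "d' = d" by auto
      have "c \<noteq> q"
      proof
        assume "c = q"
        then have "a \<in> nb G q" using a by (auto simp: nb_sym[of a])
        with q d' p neq show False by auto
      qed
      show ?thesis
      proof (cases "b \<in> nb G c")
        case False
        then show ?thesis
          by (intro yx.cross_gadget[OF a_c _ _ _ _ _ pq]) (use a cb \<open>c \<noteq> q\<close> cross' in auto)
      next
        case True
        then have "c \<in> nb G b" by (simp add: nb_sym)
        with b a \<open>c \<noteq> q\<close> have c': "c' = c" by auto
        have dn: "p \<in> nb G d" "q \<in> nb G d" "a \<in> nb G c" "b \<in> nb G c"
          using p q a b d' c' by (auto simp: nb_sym[of p] nb_sym[of q] nb_sym[of a] nb_sym[of b])
        have "c \<noteq> d"
        proof
          assume "c = d"
          then have "{p, q, a, b} \<subseteq> nb G d" using dn by auto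
          then have "card {p, q, a, b} \<le> card (nb G d)" by (rule card_mono[OF finite_nb[OF simple]])
          with subcubic_graph_card[OF subcubic_graph, of d] neq show False by simp
        qed
        moreover have "c \<notin> {v, x, y, p, q, a, b}" "d \<notin> {v, x, y, p, q, a, b}"
          using dn v x y a b p q c' d' neq \<open>c \<noteq> q\<close> cb dq db nb_ne[of c a] nb_ne[of d p] by auto
        ultimately interpret two_squares G v x y p q a b c d
          by unfold_locales (use p q a b c' d' in auto)
        show ?thesis by (rule two_squares_cov)
      qed
    qed
  qed
qed

lemma (in deg2_vertex) deg2_vertex_cov: "cov G {} (beta G)"
proof -
  interpret yx: deg2_vertex G v y x a b p q by (rule swap_xy)
  interpret qp: deg2_vertex G v x y q p a b by (rule swap_pq)
  interpret ba: deg2_vertex G v x y p q b a by (rule swap_ab)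
  interpret yxba: deg2_vertex G v y x b a p q by (rule yx.swap_pq)
  have sym: "q \<in> nb G p \<longleftrightarrow> p \<in> nb G q" "a \<in> nb G b \<longleftrightarrow> b \<in> nb G a" "a \<in> nb G p \<longleftrightarrow> p \<in> nb G a"
    "b \<in> nb G p \<longleftrightarrow> p \<in> nb G b" "a \<in> nb G q \<longleftrightarrow> q \<in> nb G a" "b \<in> nb G q \<longleftrightarrow> q \<in> nb G b"
    by (rule nb_sym)+
  show ?thesis
  proof (cases "card (nb G p) = 3 \<and> card (nb G q) = 3 \<and> card (nb G a) = 3 \<and> card (nb G b) = 3")
    case False
    then consider "card (nb G p) = 2" | "card (nb G q) = 2" | "card (nb G a) = 2" | "card (nb G b) = 2"
      using deg_cases V by metis
    then show ?thesis
      by cases (rule deg2_second_neighbour qp.deg2_second_neighbour yx.deg2_second_neighbour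
          yxba.deg2_second_neighbour; assumption)+
  next
    case cards: True
    show ?thesis
    proof (cases "q \<in> nb G p \<or> b \<in> nb G a")
      case True
      then show ?thesis using one_triangle yx.one_triangle by blast
    next
      case False
      \<comment> \<open>The edges between \<open>{p, q}\<close> and \<open>{a, b}\<close> form a
        bipartite graph with parts of size two: without an isolated vertex it has a perfect
        matching.\<close>
      consider "a \<notin> nb G p" "b \<notin> nb G p" | "a \<notin> nb G q" "b \<notin> nb G q" | "p \<notin> nb G a" "q \<notin> nb G a"
        | "p \<notin> nb G b" "q \<notin> nb G b" | "a \<in> nb G p" "b \<in> nb G q" | "b \<in> nb G p" "a \<in> nb G q"
        using sym by blast
      then show ?thesis
      proof cases
        case 1
        then show ?thesis by (intro no_cross_edge) (use cards False in simp_all)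
      next
        case 2
        then show ?thesis by (intro qp.no_cross_edge) (use cards False sym in simp_all)
      next
        case 3
        then show ?thesis by (intro yx.no_cross_edge) (use cards False in simp_all)
      next
        case 4
        then show ?thesis by (intro yxba.no_cross_edge) (use cards False sym in simp_all)
      next
        case 5
        then show ?thesis by (intro matching_cross) (use cards False in simp_all)
      next
        case 6
        then show ?thesis by (intro ba.matching_cross) (use cards False sym in simp_all)
      qed
    qed
  qed
qed

context k23_free
begin

lemma deg2_cov:
  assumes v: "v \<in> verts G" "card (nb G v) = 2"
  shows "cov G {} (beta G)"
proof -
  from v(2) obtain x y where nv: "nb G v = {x, y}" "x \<noteq> y" by (auto simp: card_2_iff)
  have vn: "v \<in> nb G x" "v \<in> nb G y" using nv by (auto simp: nb_sym[of v])
  have V: "x \<in> verts G" "y \<in> verts G" "x \<noteq> v" "y \<noteq> v" using nv nbV[of _ v] nb_ne[of _ v] by auto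
  show ?thesis
  proof (cases "y \<in> nb G x")
    case True
    with nv show ?thesis by (intro deg2_triangle)
  next
    case xy: False
    from V(1) show ?thesis
    proof (cases rule: deg_cases)
      case 1
      from card_2_elem[OF 1 vn(1)] obtain z where "nb G x = {v, z}" "z \<noteq> v" by metis
      with nv show ?thesis by (intro deg2_adjacent[of v y x z]) auto
    next
      case x3: 2
      from V(2) show ?thesis
      proof (cases rule: deg_cases)
        case 1
        from card_2_elem[OF 1 vn(2)] obtain z where "nb G y = {v, z}" "z \<noteq> v" by metis
        with nv show ?thesis by (intro deg2_adjacent[of v x y z]) auto
      next
        case y3: 2
        from card_3_elem[OF x3 vn(1)] obtain p q where x: "nb G x = {v, p, q}" "p \<noteq> q" "p \<noteq> v" "q \<noteq> v" by metis
        from card_3_elem[OF y3 vn(2)] obtain a b where y: "nb G y = {v, a, b}" "a \<noteq> b" "a \<noteq> v" "b \<noteq> v" by metis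
        have x': "nb G x = {v, q, p}" and y': "nb G y = {v, b, a}" using x y by auto
        consider "p = a" | "p = b" | "q = a" | "q = b" | "p \<noteq> a" "p \<noteq> b" "q \<noteq> a" "q \<noteq> b" by blast
        then show ?thesis
        proof cases
          case 1
          then have "nb G y = {v, p, b}" using y by auto
          from common_neighbour[OF nv(1) x(1) this] show ?thesis using x(2-4) y(2-4) nv(2) xy 1 by auto
        next
          case 2
          then have "nb G y = {v, p, a}" using y by auto
          from common_neighbour[OF nv(1) x(1) this] show ?thesis using x(2-4) y(2-4) nv(2) xy 2 by auto
        next
          case 3
          then have "nb G y = {v, q, b}" using y by auto
          from common_neighbour[OF nv(1) x' this] show ?thesis using x(2-4) y(2-4) nv(2) xy 3 by auto
        next
          case 4
          then have "nb G y = {v, q, a}" using y by auto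
          from common_neighbour[OF nv(1) x' this] show ?thesis using x(2-4) y(2-4) nv(2) xy 4 by auto
        next
          case 5
          have "x \<noteq> a" "x \<noteq> b" "y \<noteq> p" "y \<noteq> q" using xy x(1) y(1) nb_sym[of x G y] by auto
          moreover have "x \<noteq> p" "x \<noteq> q" "y \<noteq> a" "y \<noteq> b" using nb_ne[of _ x] nb_ne[of _ y] x(1) y(1) by blast+
          ultimately have "distinct [v, x, y, p, q, a, b]"
            using nv(2) x(2-4) y(2-4) V(3,4) 5 by simp
          with nv(1) x(1) y(1) interpret deg2_vertex G v x y p q a b
            by unfold_locales
          show ?thesis by (rule deg2_vertex_cov)
        qed
      qed
    qed
  qed
qed

text \<open>One gadget: -8 + 5 - 1 = -4, and with the price 6 of an edge exactly the surplus 2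
  granted to cubic graphs.\<close>

lemma cubic_cov:
  assumes cubic: "\<And>v. v \<in> verts G \<Longrightarrow> card (nb G v) = 3" and x: "x \<in> verts G"
  shows "cov G {} (beta G + 2)"
proof -
  from cubic[OF x] obtain t p q where nx: "nb G x = {t, p, q}" "t \<noteq> p" "t \<noteq> q" "p \<noteq> q"
    by (auto simp: card_3_iff)
  have nx': "x \<in> nb G p" "x \<in> nb G q" "x \<in> nb G t" using nx by (auto simp: nb_sym[of x])
  have V: "p \<in> verts G" "q \<in> verts G" "t \<in> verts G" "p \<noteq> x" "q \<noteq> x" "t \<noteq> x"
    using nx nbV[of _ x] nb_ne[of _ x] by auto
  from card_3_elem[OF cubic[OF V(1)] nx'(1)] obtain p1 p2 where p: "nb G p = {x, p1, p2}" "p1 \<noteq> p2" "p1 \<noteq> x" "p2 \<noteq> x" by metis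
  let ?K = "del G {x, p}"
  have SK: "simple_graph ?K" by (rule simple_del[OF simple])
  have bK: "beta ?K \<le> beta G - 3"
  proof -
    have "beta (del G (set [x, p])) \<le> beta G - 4 * int (length [x, p]) +
        int (length [{x, t}, {x, p}, {x, q}, {p, p1}, {p, p2}])"
      by (rule beta_del_list[OF simple]) (use V x in \<open>simp_all add: touched_def doubleton_eq_iff nx(1) p(1)\<close>)
    then show ?thesis by simp
  qed
  show ?thesis
  proof (cases "q \<in> nb G p")
    case True
    then have "{x, p} \<subseteq> nb G q" using nx' by (auto simp: nb_sym[of p])
    then have "card (nb G q - {x, p}) \<le> 1"
      using cubic[OF V(2)] V by (subst card_Diff_subset) auto
    moreover have "nb ?K q = nb G q - {x, p}" using V nx by (auto simp: nb_del)
    ultimately have "budget ?K \<le> beta ?K - 1"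
      by (intro budget_leaf[OF SK, of q]) (use V nx in auto)
    moreover have "cov ?K {} (budget ?K)" by (rule cov_del) (use x in auto)
    ultimately have "cov (del G (set (ends [(x, p)]) \<union> {})) {} (beta G - 4)" using bK by (auto elim: cov_mono)
    then have "cov G ({} \<union> set (ends [(x, p)])) (beta G + 2)"
      by (rule cov_reduce[OF simple, rotated 4]) (use nx V in auto)
    then show ?thesis by (rule cov_mono) auto
  next
    case False
    text \<open>The edge \<open>xt\<close> is removed so that the gadget lemma applies to \<open>x\<close>.\<close>
    let ?D = "(verts G, edges G - {{x, t}}) :: 'a ugraph"
    have nbD: "nb ?D u = (if u = x then nb G u - {t} else if u = t then nb G u - {x} else nb G u)" for u
      using V by (auto simp: nb_def doubleton_eq_iff)
    have SD: "simple_graph ?D" using simple by (auto simp: simple_graph_def)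
    have D: "subcubic_graph ?D"
      unfolding subcubic_graph_def
      by (intro conjI SD allI order_trans[OF card_mono subcubic_graph_card[OF subcubic_graph]])
        (auto simp: nbD finite_nb[OF simple])
    have low: "card (nb G u - {w}) = 2" if "w \<in> nb G u" "u \<in> verts G" for u w
      using cubic[OF that(2)] that(1) finite_nb[OF simple] by simp
    have "no_cubic_part ?D"
    proof (rule no_cubic_partI)
      fix U assume U: "U \<subseteq> verts ?D" "U \<noteq> {}" "\<And>u. u \<in> U \<Longrightarrow> nb ?D u \<subseteq> U" "\<And>u. u \<in> U \<Longrightarrow> card (nb ?D u) = 3"
      have "x \<notin> U" using U(4)[of x] low[of t x] nx x by (auto simp: nbD)
      moreover have "t \<notin> U" using U(4)[of t] low[of x t] nx' V by (auto simp: nbD)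
      ultimately have "nb G u \<subseteq> U" if "u \<in> U" for u
        using U(3)[OF that] that by (auto simp: nbD split: if_splits)
      then have "U = verts G" by (intro conn) (use U(1,2) in auto)
      with \<open>x \<notin> U\<close> x show False by simp
    qed
    note D = D this
    have tp: "t \<noteq> p" "p \<noteq> t" using nx by auto
    have nDx: "nb ?D x = {p, q}" using nx V by (auto simp: nbD)
    have nDp: "nb ?D p = {x, p1, p2}" using p V tp by (simp add: nbD)
    have qp: "q \<noteq> p1" "q \<noteq> p2" using False p by auto
    have qin: "q \<in> nb ?D i \<longleftrightarrow> i \<in> nb G q" for i
      using V nx nb_sym[of q G i] nx' by (cases "i = x"; cases "i = t"; simp add: nbD)
    have nK: "\<not> (q \<in> nb ?D p1 \<and> q \<in> nb ?D p2)"
    proof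
      assume "q \<in> nb ?D p1 \<and> q \<in> nb ?D p2"
      then have "nb G p \<subseteq> nb G q" using p(1) nx' qin by auto
      then have "nb G p = nb G q" by (rule nb_full[OF subcubic_graph _ cubic[OF V(1)]])
      with no_K23[OF nx(4)] cubic[OF V(1)] show False by simp
    qed
    show ?thesis
    proof (cases rule: gadget_or_bridge[OF D nDx nDp nx(4) p(2-4) qp nK, case_names gadget bridge])
      case (gadget i)
      have DK: "del ?D {x, p} = ?K" by (auto simp: del_def)
      have i: "i \<in> nb G p" "q \<noteq> i" "i \<noteq> x" using gadget(1) p qp by auto
      have ip: "i \<noteq> p" "i \<in> verts G" using nb_ne[OF i(1)] nbV[OF i(1)] by auto
      have nq: "q \<notin> nb G i" using gadget(2) qin[of i] by (simp add: nb_sym)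
      have g: "p \<in> nb G x" "q \<in> nb G x" using nx by auto
      have "simple_graph (add ?K q i)"
        by (rule simple_add[OF SK i(2)]) (use V nx i ip in auto)
      then have "subcubic_graph (add ?K q i)"
        unfolding subcubic_graph_def
        using order_trans[OF card_nb_gadget[OF simple g i(1,2) nx(4)[symmetric] i(3)] subcubic_graph_card[OF subcubic_graph]] by blast
      then have "cov (add ?K q i) {} (budget (add ?K q i))"
        by (rule cov_IH) (use gadget(3) DK x in auto)
      moreover have "beta (add ?K q i) = beta ?K - 1"
        by (rule beta_add[OF SK]) (use nq in \<open>auto simp: nb_del nb_sym[of i]\<close>)
      ultimately have "cov (add ?K q i) {} (beta G - 4)"
        using bK budget_le[of "add ?K q i"] by (elim cov_mono) auto
      then have "cov G (insert x (insert p {})) (beta G + 2)"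
        by (rule cov_gadget[OF simple g i(1,2) nx(4)[symmetric] i(3)]) simp
      then show ?thesis by (rule cov_mono) auto
    next
      case (bridge B)
      \<comment> \<open>In \<open>?D\<close> the vertex \<open>t\<close> has degree two, so it is
        not in the cubic far side. Hence restoring \<open>xt\<close> adds no edge leaving
        \<open>B\<close>, and the bridge persists in \<open>G\<close>.\<close>
      have tB: "t \<notin> B" using bridge(4)[of t] low[OF nx'(3) V(3)] V by (auto simp: nbD)
      have xB: "x \<notin> B" using bridge(2) by auto
      have eq: "nb ?D u = nb G u" if "u \<in> B" for u using that tB xB by (auto simp: nbD)
      have False
      proof (rule nobridge[of q B x])
        show "nb G u \<subseteq> insert x B" if "u \<in> B" for u using bridge(3)[OF that] eq[OF that] by simp
        show "u = q" if "u \<in> B" "x \<in> nb G u" for u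
        proof -
          have "u \<in> nb G x" using that(2) by (simp add: nb_sym)
          with that(1) tB bridge(2) nx show ?thesis by auto
        qed
      qed (use bridge nx nx' in auto)
      then show ?thesis ..
    qed
  qed
qed

end

text \<open>If the bound without surplus fails, the previous results exclude bridges, pairs with
  equal neighbourhoods and vertices of degree two, which is what the successive locales ask for;
  only a cubic graph is left.\<close>

lemma (in leafless) leafless_cov:
  assumes K33: "\<And>p q r. p \<noteq> q \<Longrightarrow> p \<noteq> r \<Longrightarrow> q \<noteq> r \<Longrightarrow> nb G p = nb G q \<Longrightarrow> nb G q = nb G r \<Longrightarrow> card (nb G r) \<noteq> 3"
    and ne: "verts G \<noteq> {}"
  shows "cov G {} (beta G + (if \<forall>v\<in>verts G. card (nb G v) = 3 then 2 else 0))"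
proof (cases "cov G {} (beta G)")
  case True
  then show ?thesis by (rule cov_mono) auto
next
  case False
  interpret bridgeless G
  proof unfold_locales
    fix q x B
    assume "q \<in> B" "x \<notin> B" "x \<in> nb G q" "B \<subseteq> verts G" "\<And>u. u \<in> B \<Longrightarrow> nb G u \<subseteq> insert x B"
      "\<And>u. u \<in> B \<Longrightarrow> x \<in> nb G u \<Longrightarrow> u = q"
    from bridge[OF this] False show False by simp
  qed
  interpret k23_free G
  proof unfold_locales
    fix p q
    assume pq: "p \<noteq> q" "nb G p = nb G q" "card (nb G p) = 3"
    have "r = p \<or> r = q" if "nb G r = nb G p" for r
      using K33 pq that by metis
    from K23[OF pq this] False show False by simp
  qed
  have no2: "card (nb G v) = 3" if "v \<in> verts G" for v
    using deg_cases[OF that] deg2_cov[OF that] False by blast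
  from ne obtain x where "x \<in> verts G" by auto
  from cubic_cov[OF no2 this] no2 show ?thesis by simp
qed

section \<open>The bound\<close>

lemma edgeless_cov:
  assumes "simple_graph G" "edges G = {}"
  shows "cov G {} 0"
proof -
  have "maximal_matching G {}" using assms by (simp add: maximal_matching_iff)
  then show ?thesis by (auto simp: cov_def ach_def intro!: exI[of _ 0])
qed

text \<open>Disconnected graphs are included because the reductions disconnect. Proper unions of
  components are split off by additivity, so the locales apply to a connected graph.\<close>

lemma cov_budget:
  fixes G :: "'a ugraph"
  assumes "subcubic_graph G" "no_cubic_part G"
  shows "cov G {} (budget G)"
  using assms
proof (induction "card (verts G)" arbitrary: G rule: less_induct)
  case less
  note G = less.prems and IH = less.hyps
  note S = subcubic_graph_simple[OF G(1)]
  have fin: "finite (verts G)" by (rule simpleD(1)[OF S])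
  show ?case
  proof (cases "\<exists>U. U \<subseteq> verts G \<and> U \<noteq> {} \<and> (\<forall>u\<in>U. nb G u \<subseteq> U) \<and> U \<noteq> verts G")
    case True
    then obtain U where U: "U \<subseteq> verts G" "U \<noteq> {}" "\<And>u. u \<in> U \<Longrightarrow> nb G u \<subseteq> U" "U \<noteq> verts G" by blast
    have IH': "cov (del G R) {} (budget (del G R))" if "R \<inter> verts G \<noteq> {}" for R
    proof (rule IH)
      show "card (verts (del G R)) < card (verts G)"
        by (rule psubset_card_mono[OF fin]) (use that in auto)
    qed (rule subcubic_graph_del[OF G(1)], rule no_cubic_part_del[OF G])
    have "(verts G - U) \<inter> verts G \<noteq> {}" "U \<inter> verts G \<noteq> {}"
      using U(1,2,4) by auto
    from this[THEN IH'] have "cov G ({} \<union> {}) (budget G)"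
      by (rule cov_union[OF S U(1)]) (use U(3) in blast, simp add: budget_closed[OF S U(1,3)])
    then show ?thesis by simp
  next
    case False
    interpret descent G
    proof (rule descent.intro)
      show "U = verts G" if "U \<subseteq> verts G" "U \<noteq> {}" "\<And>u. u \<in> U \<Longrightarrow> nb G u \<subseteq> U" for U
        using False that by blast
      show "cov H {} (budget H)" if "subcubic_graph H" "no_cubic_part H" "card (verts H) < card (verts G)" for H :: "'a ugraph"
        using IH[OF that(3,1,2)] .
    qed (rule G(1))
    consider (empty) "verts G = {}" | (isolated) v where "v \<in> verts G" "nb G v = {}"
      | (leaf) v u where "v \<in> verts G" "nb G v = {u}" | (min2) "verts G \<noteq> {}" "\<And>v. v \<in> verts G \<Longrightarrow> 2 \<le> card (nb G v)"
    proof -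
      have "nb G v = {} \<or> (\<exists>u. nb G v = {u}) \<or> 2 \<le> card (nb G v)" for v
        using card_le_1_cases[OF finite_nb[OF S]] by (metis not_less_eq_eq numeral_2_eq_2 One_nat_def)
      with that show thesis by metis
    qed
    then show ?thesis
    proof cases
      case empty
      then have E: "edges G = {}" using simpleD(2,3)[OF S] by fastforce
      with empty have "budget G = 0" by (simp add: budget_def beta_def pendant_def isolated_def)
      with edgeless_cov[OF S E] show ?thesis by simp
    next
      case (isolated v)
      have "{v} = verts G" by (rule conn) (use isolated in auto)
      then have V: "verts G = {v}" by simp
      have E: "edges G = {}"
      proof (rule equals0I)
        fix e assume "e \<in> edges G"
        from edgeE[OF S this] obtain a c where "a \<noteq> c" "a \<in> verts G" "c \<in> verts G" by metis
        with V show False by simp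
      qed
      have "isolated G = {v}" using V isolated by (auto simp: isolated_def)
      with V E have "budget G = 0" by (simp add: budget_def beta_def pendant_def)
      with edgeless_cov[OF S E] show ?thesis by simp
    next
      case (leaf v u)
      then show ?thesis by (rule leaf_cov)
    next
      case min2
      interpret leafless G by unfold_locales (rule min2(2))
      \<comment> \<open>Three vertices with the same three neighbours form a closed cubic set with
        them.\<close>
      have noK33: "card (nb G r) \<noteq> 3" if pqr: "p \<noteq> q" "p \<noteq> r" "q \<noteq> r" "nb G p = nb G q" "nb G q = nb G r" for p q r
      proof
        assume c: "card (nb G r) = 3"
        let ?U = "{p, q, r} \<union> nb G r"
        have z: "nb G z = {p, q, r}" if "z \<in> nb G r" for z
          by (rule nb_three) (use that pqr nb_sym[of p G z] nb_sym[of q G z] nb_sym[of r G z] in auto)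
        have "p \<in> verts G" "q \<in> verts G" "r \<in> verts G"
        proof -
          from c obtain z where "z \<in> nb G r" by fastforce
          with z have "p \<in> nb G z" "q \<in> nb G z" "r \<in> nb G z" by auto
          then show "p \<in> verts G" "q \<in> verts G" "r \<in> verts G" by (auto dest: nbV)
        qed
        then show False
          by (intro no_cubic_partD[OF G(2), of ?U]) (use c pqr z nb_subset[OF S] in auto)
      qed
      have "\<not> (\<forall>v\<in>verts G. card (nb G v) = 3)"
        using no_cubic_partD[OF G(2) order_refl min2(1) nb_subset[OF S]] by blast
      moreover have "cov G {} (beta G + (if \<forall>v\<in>verts G. card (nb G v) = 3 then 2 else 0))"
        by (rule leafless_cov, rule noK33, assumption+, rule min2(1))
      ultimately have "cov G {} (beta G)" by (simp only: if_False add_0_right)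
      moreover have "isolated G = {}"
        using min2(2) by (fastforce simp: isolated_def)
      moreover have "pendant G = {}"
        using min2(2) simpleD(2)[OF S] by (fastforce simp: pendant_def)
      ultimately show ?thesis by (simp add: budget_def)
    qed
  qed
qed

section \<open>From budgets to the bound for connected graphs\<close>

lemma connected_closed:
  assumes "connected_graph G" "U \<subseteq> verts G" "U \<noteq> {}" "\<And>u. u \<in> U \<Longrightarrow> nb G u \<subseteq> U"
  shows "U = verts G"
proof
  show "verts G \<subseteq> U"
  proof
    fix w assume w: "w \<in> verts G"
    from assms(3) obtain u where u: "u \<in> U" by auto
    with assms(1,2) w have "(u, w) \<in> {(x, y). {x, y} \<in> edges G}\<^sup>*"
      by (auto simp: connected_graph_def)
    then show "w \<in> U"
    proof induction
      case (step y z)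
      then have "z \<in> nb G y" by (simp add: nb_edge(2))
      with step.IH assms(4) show ?case by blast
    qed (rule u)
  qed
qed (rule assms(2))

lemma K2_isomorphic:
  assumes "verts G = {u, v}" "edges G = {{u, v}}" "u \<noteq> v"
  shows "isomorphic G (complete_graph 2)"
  unfolding isomorphic_def
proof (intro exI conjI)
  let ?f = "\<lambda>w. if w = u then 0 else 1 :: nat"
  show "bij_betw ?f (verts G) (verts (complete_graph 2))"
    using assms by (auto simp: bij_betw_def inj_on_def complete_graph_def)
  have "{{i, j} | i j :: nat. i < 2 \<and> j < 2 \<and> i \<noteq> j} = {{0, 1}}"
    by (auto simp: less_2_cases_iff doubleton_eq_iff)
  then show "\<forall>a\<in>verts G. \<forall>b\<in>verts G. {a, b} \<in> edges G \<longleftrightarrow> {?f a, ?f b} \<in> edges (complete_graph 2)"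
    using assms by (auto simp: complete_graph_def doubleton_eq_iff)
qed

lemma K33_isomorphic:
  assumes V: "verts G = P \<union> Z" "P \<inter> Z = {}" and P: "card P = 3" "\<And>p. p \<in> P \<Longrightarrow> nb G p = Z"
    and Z: "card Z = 3" "\<And>z. z \<in> Z \<Longrightarrow> nb G z = P"
  shows "isomorphic G (complete_bipartite_graph 3 3)"
proof -
  have fin: "finite P" "finite Z" using P Z by (auto intro: card_ge_0_finite)
  obtain g h :: "'a \<Rightarrow> nat" where g: "bij_betw g P {..<3}" and h: "bij_betw h Z {..<3}"
    using fin P(1) Z(1) by (metis atLeast0LessThan ex_bij_betw_finite_nat)
  let ?f = "\<lambda>w. if w \<in> P then Inl (g w) else Inr (h w)"
  let ?K = "complete_bipartite_graph 3 3"
  have fP: "?f ` P = Inl ` {..<3}" and fZ: "?f ` Z = Inr ` {..<3}"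
  proof -
    have "?f ` P = (\<lambda>w. Inl (g w)) ` P" "?f ` Z = (\<lambda>w. Inr (h w)) ` Z"
      by (rule image_cong; use V(2) in auto)+
    then show "?f ` P = Inl ` {..<3}" "?f ` Z = Inr ` {..<3}"
      using bij_betw_imp_surj_on[OF g] bij_betw_imp_surj_on[OF h] by (simp_all add: image_image[symmetric])
  qed
  have inj: "inj_on ?f (verts G)"
    using bij_betw_imp_inj_on[OF g] bij_betw_imp_inj_on[OF h] V by (auto simp: inj_on_def)
  have "?f ` verts G = verts ?K"
    unfolding V(1) image_Un fP fZ by (auto simp: complete_bipartite_graph_def Plus_def)
  with inj have bij: "bij_betw ?f (verts G) (verts ?K)" by (simp add: bij_betw_def)
  have edge: "{a, b} \<in> edges G \<longleftrightarrow> a \<in> P \<and> b \<in> Z \<or> a \<in> Z \<and> b \<in> P" if "a \<in> verts G" "b \<in> verts G" for a b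
    using that V P(2)[of a] Z(2)[of a] by (auto simp: nb_edge(2)[symmetric])
  have edgeK: "{?f a, ?f b} \<in> edges ?K \<longleftrightarrow> a \<in> P \<and> b \<in> Z \<or> a \<in> Z \<and> b \<in> P" if "a \<in> verts G" "b \<in> verts G" for a b
    using that V bij_betw_apply[OF g] bij_betw_apply[OF h]
    by (auto simp: complete_bipartite_graph_def doubleton_eq_iff)
  show ?thesis
    unfolding isomorphic_def using bij edge edgeK by (intro exI[of _ ?f]) simp
qed

lemma gamma_le:
  assumes "simple_graph G" "maximal_matching G M"
  shows "gamma G \<le> card M"
  unfolding gamma_def by (rule Min_le) (use assms(2) finite_maximal_matchings[OF assms(1)] in auto)

text \<open>Each leaf is sent to its edge. Two leaves with the same edge are adjacent, and by
  connectedness there is nothing else.\<close>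

lemma leaves_le_pendant:
  assumes G: "descent G" and nK: "\<not> isomorphic G (complete_graph 2)"
  shows "card {v \<in> verts G. degree G v = 1} \<le> card (pendant G)"
proof -
  interpret descent G by (rule G)
  let ?L = "{v \<in> verts G. degree G v = 1}"
  have leaf: "\<exists>u. nb G v = {u}" if "v \<in> ?L" for v
    using that by (auto simp: degree_nb[OF simple] card_1_singleton_iff)
  have "inj_on (\<lambda>v. insert v (nb G v)) ?L"
  proof (rule inj_onI, rule ccontr)
    fix v w assume vw: "v \<in> ?L" "w \<in> ?L" "insert v (nb G v) = insert w (nb G w)" "v \<noteq> w"
    from leaf[OF vw(1)] leaf[OF vw(2)] obtain a b where "nb G v = {a}" "nb G w = {b}" by auto
    with vw(3,4) have n: "nb G v = {w}" "nb G w = {v}" by (auto simp: doubleton_eq_iff)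
    with vw leaf_K2(1,2)[of v w] K2_isomorphic[of G w v] nK show False by auto
  qed
  moreover have "(\<lambda>v. insert v (nb G v)) ` ?L \<subseteq> pendant G"
  proof
    fix e assume "e \<in> (\<lambda>v. insert v (nb G v)) ` ?L"
    then obtain v where v: "v \<in> ?L" "e = insert v (nb G v)" by auto
    from leaf[OF v(1)] obtain u where u: "nb G v = {u}" by auto
    then have "{v, u} \<in> edges G" using nb_edge(2)[of u G v] by simp
    with v u show "e \<in> pendant G" by (auto simp: pendant_def)
  qed
  ultimately show ?thesis
    by (rule card_inj_on_le) (rule finite_pendant[OF simple])
qed

text \<open>The term \<open>K\<close> compensates for the one case in which two leaves share a
  pendant edge; isolated vertices only lower the budget.\<close>

lemma budget_le_mu:
  assumes G: "descent G" and nc: "\<not> cubic G"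
  shows "real_of_int (budget G) \<le> 6 * mu G"
proof -
  interpret descent G by (rule G)
  let ?L = "{v \<in> verts G. degree G v = 1}"
  let ?K = "if isomorphic G (complete_graph 2) then 1 else 0 :: real"
  have "real (card ?L) \<le> real (card (pendant G)) + ?K"
  proof (cases "isomorphic G (complete_graph 2)")
    case False
    with leaves_le_pendant[OF G] show ?thesis by simp
  next
    case True
    then have "card (verts G) = 2"
      by (auto simp: isomorphic_def complete_graph_def dest: bij_betw_same_card)
    moreover have "card ?L \<le> card (verts G)"
      by (rule card_mono) (use simpleD(1)[OF simple] in auto)
    moreover have "card (pendant G) \<ge> 1" if "?L \<noteq> {}"
    proof -
      from that obtain v where v: "v \<in> verts G" "card (nb G v) = 1" by (auto simp: degree_nb[OF simple])
      then obtain u where "nb G v = {u}" by (auto simp: card_1_singleton_iff)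
      then have "{v, u} \<in> pendant G" using v nb_edge(2)[of u G v] by (auto simp: pendant_def)
      then have "pendant G \<noteq> {}" by auto
      then show ?thesis using finite_pendant[OF simple] by (simp add: Suc_le_eq card_gt_0_iff)
    qed
    moreover have "card ?L = 0" if "?L = {}" using that by (simp only: card.empty)
    ultimately have "card ?L \<le> card (pendant G) + 1" by linarith
    with True show ?thesis by simp
  qed
  then show ?thesis
    using nc by (simp add: mu_def Let_def budget_def beta_def field_simps)
qed

theorem theorem1p4:
  fixes G :: "'a ugraph"
  assumes "simple_graph G"
    and "connected_graph G"
    and "subcubic G"
    and "\<not> isomorphic G (complete_bipartite_graph 3 3)"
  shows "real (gamma G) \<le> mu G \<and>
    (\<not> isomorphic G (complete_graph 2) \<longrightarrow>
      (\<forall>u v. v \<in> verts G \<and> degree G v = 1 \<and> {u, v} \<in> edges G \<longrightarrow>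
        (\<exists>M. maximal_matching G M \<and> real (card M) \<le> mu G \<and> {u, v} \<notin> M)))"
proof -
  \<comment> \<open>The requirement on smaller graphs now holds outright by
    \<open>cov_budget\<close>, so the lemmas become available for \<open>G\<close> even if it is
    cubic.\<close>
  interpret descent G
    by (rule descent.intro) (use assms(1,3) connected_closed[OF assms(2)] cov_budget in \<open>auto simp: subcubic_graph_iff\<close>)
  have ne: "verts G \<noteq> {}" using assms(2) by (simp add: connected_graph_def)
  have deg: "degree G v = card (nb G v)" for v by (rule degree_nb[OF simple])
  show ?thesis
  proof (cases "cubic G")
    case True
    then have three: "card (nb G v) = 3" if "v \<in> verts G" for v
      using that by (simp add: cubic_def deg)
    interpret leafless G by unfold_locales (simp add: three)
    have noK33: "card (nb G r) \<noteq> 3" if pqr: "p \<noteq> q" "p \<noteq> r" "q \<noteq> r" "nb G p = nb G q" "nb G q = nb G r" for p q r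
    proof
      assume c: "card (nb G r) = 3"
      have z: "nb G z = {p, q, r}" if "z \<in> nb G r" for z
        by (rule nb_three) (use that pqr nb_sym[of p G z] nb_sym[of q G z] nb_sym[of r G z] in auto)
      have "r \<notin> nb G r" using nb_ne by blast
      have P: "{p, q, r} \<subseteq> verts G"
      proof -
        from c obtain z where "z \<in> nb G r" by fastforce
        with z have "{p, q, r} = nb G z" by simp
        then show ?thesis using nb_subset[OF simple] by metis
      qed
      have V: "{p, q, r} \<union> nb G r = verts G"
        by (rule conn) (use P pqr z nb_subset[OF simple] in auto)
      have disj: "{p, q, r} \<inter> nb G r = {}"
        using pqr nb_ne[of p p] nb_ne[of q q] nb_ne[of r r] by auto
      have "isomorphic G (complete_bipartite_graph 3 3)"
        by (rule K33_isomorphic[OF V[symmetric] disj _ _ c z]) (use pqr in auto)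
      with assms(4) show False ..
    qed
    have "cov G {} (beta G + (if \<forall>v\<in>verts G. card (nb G v) = 3 then 2 else 0))"
      by (rule leafless_cov, rule noK33, assumption+, rule ne)
    with three have "cov G {} (beta G + 2)" by simp
    then obtain M where M: "maximal_matching G M" "6 * int (card M) \<le> beta G + 2"
      by (auto simp: cov_def ach_def)
    have no_leaf: "{v \<in> verts G. degree G v = 1} = {}" using True by (auto simp: cubic_def)
    have "real_of_int (beta G + 2) \<le> 6 * mu G"
      unfolding mu_def Let_def beta_def no_leaf using True by (simp add: field_simps)
    moreover have "real_of_int (6 * int (card M)) \<le> real_of_int (beta G + 2)"
      using M(2) by (simp only: of_int_le_iff)
    ultimately have "real (card M) \<le> mu G" by simp
    with gamma_le[OF assms(1) M(1)] have "real (gamma G) \<le> mu G" by linarith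
    with no_leaf show ?thesis by blast
  next
    case False
    have bound: "real (card M) \<le> mu G" if "6 * int (card M) \<le> budget G" for M :: "'a set set"
    proof -
      have "real_of_int (6 * int (card M)) \<le> real_of_int (budget G)" using that by (simp only: of_int_le_iff)
      with budget_le_mu[OF descent_axioms False] show ?thesis by simp
    qed
    have "no_cubic_part G"
    proof (rule no_cubic_partI)
      fix U assume "U \<subseteq> verts G" "U \<noteq> {}" "\<And>u. u \<in> U \<Longrightarrow> nb G u \<subseteq> U" "\<And>u. u \<in> U \<Longrightarrow> card (nb G u) = 3"
      with conn[of U] False show False by (simp add: cubic_def deg)
    qed
    from cov_budget[OF subcubic_graph this] obtain M where M: "maximal_matching G M" "6 * int (card M) \<le> budget G"
      by (auto simp: cov_def ach_def)
    have "real (gamma G) \<le> mu G"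
      using gamma_le[OF assms(1) M(1)] bound[OF M(2)] by linarith
    moreover have "\<exists>M. maximal_matching G M \<and> real (card M) \<le> mu G \<and> {u, v} \<notin> M"
      if nK: "\<not> isomorphic G (complete_graph 2)" and v: "v \<in> verts G" "degree G v = 1" "{u, v} \<in> edges G" for u v
    proof -
      have u: "u \<in> nb G v" "v \<in> nb G u" using v(3) nb_edge(1)[of u G v] nb_edge(2)[of v G u] by simp_all
      have nv: "nb G v = {u}" using v(2) u by (auto simp: deg card_1_singleton_iff)
      have "nb G u \<noteq> {v}"
      proof
        assume "nb G u = {v}"
        from leaf_K2(1,2)[OF v(1) nv this] K2_isomorphic[of G u v] nb_ne[OF u(1)] nK show False by simp
      qed
      with u(2) obtain a where "a \<in> nb G u" "a \<noteq> v" by auto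
      from leaf_avoid[OF v(1) nv this] bound show ?thesis by blast
    qed
    ultimately show ?thesis by blast
  qed
qed

end
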